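(* Let $p$ be a complex polynomial with $d$ distinct roots, and let $\mathbf{rts}$ be its set of roots. Each regular level set determines a partition of $\mathbf{rts}$. Taken together, the collection of all regular level sets determines a chain in the partition lattice $\Pi_{\mathbf{rts}}$. Meanwhile, each regular direction set determines a cyclic ordering of $\mathbf{rts}$. Taken together, the collection of all regular direction sets determines a factorization of the $d$-cycle $(1\ \cdots\ d)$. Finally, given any regular level set and any regular direction set, the partition determined by the former is noncrossing with respect to the cyclic ordering (cyclic permutation of the roots) determined by the latter.
   Context: Branched annulus. Here $p$ has degree $d$. Let $\mathbb{S}=\{u\in\mathbb{C}:|u|=1\}$, $\mathbb{I}=[-1,1]$, and let $\mathbb{A}=\mathbb{S}\times\mathbb{I}$ carry the flat product Riemannian metric. Let $i_A\colon\mathbb{C}\setminus\{0\}\to\mathbb{A}$ be $i_A(ru)=\left(u,\frac{r^2-1}{r^2+1}\right)$ for $r>0$, $u\in\mathbb{S}$; it is a homeomorphism onto $\mathbb{S}\times(-1,1)$. Let $\mathbf{cpt}$ be the set of zeros of $p'$ and $\mathbf{cvl}=p(\mathbf{cpt})\subset\mathbb{C}\setminus\{0\}$. The open branched annulus is $\mathbb{C}\setminus\mathbf{rts}$ with the pullback metric along $i_A\circ p$ (length of a curve = length of its image; distance = infimum of lengths of connecting rectifiable curves). The branched annulus $\mathbb{B}_p$ is its metric completion, and $p_A\colon\mathbb{B}_p\to\mathbb{A}$ is the continuous extension of $i_A\circ p$. $\mathbb{B}_p$ is a compact surface whose boundary consists of one root circle for each root $a$ (the limit points as $z\to a$), mapped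 homeomorphically onto $\mathbb{S}\times\{-1\}$, and one circle at infinity (the limit points as $|z|\to\infty$), mapped onto $\mathbb{S}\times\{1\}$ by a connected $d$-fold covering and oriented counterclockwise. Level and direction sets. For $t\in\mathbb{I}$ let $\mathrm{Lvl}_t=p_A^{-1}(\mathbb{S}\times\{t\})$ (level set), and for $u\in\mathbb{S}$ let $\mathrm{Dir}_u=p_A^{-1}(\{u\}\times\mathbb{I})$ (direction set). $\mathrm{Lvl}_t$ (resp. $\mathrm{Dir}_u$) is regular if $\mathbb{S}\times\{t\}$ (resp. $\{u\}\times\mathbb{I}$) contains no point of $i_A(\mathbf{cvl})$, and critical otherwise. Partition of a level set. For $t\in(-1,1)$ put $r=\sqrt{(1+t)/(1-t)}$; the partition $\lambda_t$ determined by $\mathrm{Lvl}_t$ puts two roots in the same block iff they lie in the same connected component of $\{z\in\mathbb{C}:|p(z)|\le r\}$. $\Pi_{\mathbf{rts}}$ is the set of all partitions of $\mathbf{rts}$ ordered by refinement; a chain is a sequence $\lambda_1<\cdots<\lambda_k$. Cyclic ordering of a direction set. The components of a regular $\mathrm{Dir}_u$ are arcs joining root circles to the points of $\mathrm{Dir}_u$ on the circle at infinity, giving a bijection between roots and these $d$ points; the cyclic ordering is obtained by reading the roots counterclockwise around the circle at infinity. Factorization. Starting from a given point of the circle at infinity lying on a regular direction set, the same reading gives a linear ordering of the roots, constant along each arc of such points. Consecutive linear orderings, on either side of a critical direction, describe in two-line notation a permutation of the set of positions $\{1,\dots,d\}$. The factorization of the $d$-cycle is by the sequence of permutations obtained as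 one moves counterclockwise until the image in $\mathbb{S}$ has made one full turn, multiplied with the appropriate choice of conventions for multiplying permutations. Noncrossing. Given a finite set $A$ of size $d$ with a cyclic ordering, label the vertices of a convex $d$-gon by $A$ in this cyclic order. A partition of $A$ is noncrossing with respect to the ordering if the convex hulls of distinct blocks are disjoint. *)

theory Defs
  imports
    "HOL-Analysis.Analysis"
    "HOL-Computational_Algebra.Polynomial"
    "HOL-Combinatorics.Cycles"
    "HOL-Library.Disjoint_Sets"
begin

section \<open>Metric completions\<close>

definition is_completion ::
    "'a set \<Rightarrow> ('a \<Rightarrow> 'a \<Rightarrow> real) \<Rightarrow> 'b metric \<Rightarrow> ('a \<Rightarrow> 'b) \<Rightarrow> bool" where
  "is_completion M d B \<iota> \<longleftrightarrow>
     mcomplete_of B \<and> \<iota> \<in> M \<rightarrow> mspace B \<and>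
     mtopology_of B closure_of (\<iota> ` M) = mspace B \<and>
     (\<forall>x\<in>M. \<forall>y\<in>M. mdist B (\<iota> x) (\<iota> y) = d x y)"

text \<open>The completion is unique up to isometry; the type of its points is the one for which
  the library proves existence, by embedding into bounded functions.\<close>

definition completion_of ::
    "'a set \<Rightarrow> ('a \<Rightarrow> 'a \<Rightarrow> real) \<Rightarrow> ('a \<Rightarrow> real) metric \<times> ('a \<Rightarrow> 'a \<Rightarrow> real)" where
  "completion_of M d = (SOME (B, \<iota>). is_completion M d B \<iota>)"

lemma is_completion_completion_of:
  assumes "Metric_space M d"
  shows "is_completion M d (fst (completion_of M d)) (snd (completion_of M d))"
proof -
  obtain f :: "'a \<Rightarrow> 'a \<Rightarrow> real" and m' where "is_completion M d m' f"
    using Metric_space.metric_completion[OF assms] unfolding is_completion_def by metis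
  then have "\<exists>Bi. case Bi of (B, \<iota>) \<Rightarrow> is_completion M d B (\<iota> :: 'a \<Rightarrow> 'a \<Rightarrow> real)"
    by (intro exI[of _ "(m', f)"]) simp
  then have "case completion_of M d of (B, \<iota>) \<Rightarrow> is_completion M d B \<iota>"
    unfolding completion_of_def by (rule someI_ex)
  then show ?thesis by (simp add: case_prod_beta)
qed


section \<open>The branched annulus\<close>

definition rts :: "complex poly \<Rightarrow> complex set" where
  "rts p = {z. poly p z = 0}"

definition cpt :: "complex poly \<Rightarrow> complex set" where
  "cpt p = {z. poly (pderiv p) z = 0}"

definition cvl :: "complex poly \<Rightarrow> complex set" where
  "cvl p = poly p ` cpt p"

definition annulus :: "(complex \<times> real) set" where
  "annulus = sphere 0 1 \<times> {-1..1}"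

definition iA :: "complex \<Rightarrow> complex \<times> real" where
  "iA z = (sgn z, ((cmod z)\<^sup>2 - 1) / ((cmod z)\<^sup>2 + 1))"

text \<open>Lengths of curves in the annulus are measured in the ambient space
  \<^typ>\<open>complex \<times> real\<close>, whose distance is the Euclidean product distance: it induces the flat
  product Riemannian metric on the annulus, so the lengths are the same.\<close>

definition variation_sums :: "(real \<Rightarrow> 'a::metric_space) \<Rightarrow> real set" where
  "variation_sums g = {\<Sum>i<n. dist (g (s i)) (g (s (Suc i))) | (n::nat) (s::nat \<Rightarrow> real).
     s 0 = 0 \<and> s n = 1 \<and> (\<forall>i<n. s i \<le> s (Suc i))}"

definition rectifiable :: "(real \<Rightarrow> 'a::metric_space) \<Rightarrow> bool" where
  "rectifiable g \<longleftrightarrow> path g \<and> bdd_above (variation_sums g)"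

definition curve_length :: "(real \<Rightarrow> 'a::metric_space) \<Rightarrow> real" where
  "curve_length g = Sup (variation_sums g)"

definition pullback_dist :: "complex poly \<Rightarrow> complex \<Rightarrow> complex \<Rightarrow> real" where
  "pullback_dist p z w = Inf {curve_length (iA \<circ> poly p \<circ> \<gamma>) | \<gamma>.
     path \<gamma> \<and> path_image \<gamma> \<subseteq> - rts p \<and> pathstart \<gamma> = z \<and> pathfinish \<gamma> = w \<and>
     rectifiable (iA \<circ> poly p \<circ> \<gamma>)}"

type_synonym bpoint = "complex \<Rightarrow> real"

definition branched_annulus :: "complex poly \<Rightarrow> bpoint metric" where
  "branched_annulus p = fst (completion_of (- rts p) (pullback_dist p))"

definition emb :: "complex poly \<Rightarrow> complex \<Rightarrow> bpoint" where
  "emb p = snd (completion_of (- rts p) (pullback_dist p))"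

abbreviation btop :: "complex poly \<Rightarrow> bpoint topology" where
  "btop p \<equiv> mtopology_of (branched_annulus p)"

text \<open>The extension is unique on the points of the branched annulus; its values elsewhere in the
  type are irrelevant, which is why \<open>SOME\<close> is used.\<close>

definition pA :: "complex poly \<Rightarrow> bpoint \<Rightarrow> complex \<times> real" where
  "pA p = (SOME f. continuous_map (btop p) (top_of_set annulus) f \<and>
                   (\<forall>z \<in> - rts p. f (emb p z) = iA (poly p z)))"

definition root_circle :: "complex poly \<Rightarrow> complex \<Rightarrow> bpoint set" where
  "root_circle p a = {x. \<exists>\<zeta>. range \<zeta> \<subseteq> - rts p \<and> \<zeta> \<longlonglongrightarrow> a \<and>
                         limitin (btop p) (emb p \<circ> \<zeta>) x sequentially}"

definition circle_at_infinity :: "complex poly \<Rightarrow> bpoint set" where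
  "circle_at_infinity p = {x. \<exists>\<zeta>. range \<zeta> \<subseteq> - rts p \<and> filterlim \<zeta> at_infinity sequentially \<and>
                              limitin (btop p) (emb p \<circ> \<zeta>) x sequentially}"

text \<open>The circle at infinity, parametrized counterclockwise: the endpoint of the ray from the
  origin at angle \<open>\<theta>\<close>.\<close>

definition inf_pt :: "complex poly \<Rightarrow> real \<Rightarrow> bpoint" where
  "inf_pt p \<theta> = (THE x. limitin (btop p) (\<lambda>r. emb p (complex_of_real r * cis \<theta>)) x at_top)"


section \<open>Level sets\<close>

definition regular_Lvl :: "complex poly \<Rightarrow> real \<Rightarrow> bool" where
  "regular_Lvl p t \<longleftrightarrow> (sphere 0 1 \<times> {t}) \<inter> iA ` cvl p = {}"

text \<open>A level set enters only through its height \<open>t\<close>; the boundary heights \<open>t = -1\<close>, \<open>t = 1\<close>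
  are excluded, there being no radius for \<open>t = 1\<close>.\<close>

definition level_partition :: "complex poly \<Rightarrow> real \<Rightarrow> complex set set" where
  "level_partition p t = (\<lambda>a. {b \<in> rts p.
     connected_component {z. cmod (poly p z) \<le> sqrt ((1 + t) / (1 - t))} a b}) ` rts p"


section \<open>Direction sets and cyclic orderings\<close>

definition Dir :: "complex poly \<Rightarrow> complex \<Rightarrow> bpoint set" where
  "Dir p u = {x \<in> mspace (branched_annulus p). pA p x \<in> {u} \<times> {-1..1}}"

definition regular_Dir :: "complex poly \<Rightarrow> complex \<Rightarrow> bool" where
  "regular_Dir p u \<longleftrightarrow> ({u} \<times> {-1..1}) \<inter> iA ` cvl p = {}"

definition joined :: "complex poly \<Rightarrow> complex \<Rightarrow> complex \<Rightarrow> bpoint \<Rightarrow> bool" where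
  "joined p u a x \<longleftrightarrow>
     (\<exists>y \<in> root_circle p a. connected_component_of (subtopology (btop p) (Dir p u)) y x)"

definition root_joined_to :: "complex poly \<Rightarrow> complex \<Rightarrow> bpoint \<Rightarrow> complex" where
  "root_joined_to p u x = (THE a. a \<in> rts p \<and> joined p u a x)"

definition dir_at :: "complex poly \<Rightarrow> real \<Rightarrow> complex" where
  "dir_at p \<theta> = fst (pA p (inf_pt p \<theta>))"

text \<open>The roots read counterclockwise, starting from the point at infinity at angle \<open>\<theta>\<close>.\<close>

definition linear_ordering :: "complex poly \<Rightarrow> real \<Rightarrow> complex list" where
  "linear_ordering p \<theta> =
     map (\<lambda>\<phi>. root_joined_to p (dir_at p \<theta>) (inf_pt p \<phi>))
       (sorted_list_of_set {\<phi> \<in> {\<theta>..<\<theta> + 2 * pi}. inf_pt p \<phi> \<in> Dir p (dir_at p \<theta>)})"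

text \<open>A cyclic ordering is a class of enumerations modulo rotation.\<close>

definition is_cyclic_ordering :: "'a set \<Rightarrow> 'a list set \<Rightarrow> bool" where
  "is_cyclic_ordering A C \<longleftrightarrow>
     (\<exists>xs. distinct xs \<and> set xs = A \<and> C = {rotate n xs | n. True})"

definition cyclic_ordering :: "complex poly \<Rightarrow> complex \<Rightarrow> complex list set" where
  "cyclic_ordering p u = {linear_ordering p \<theta> | \<theta>. inf_pt p \<theta> \<in> Dir p u}"

text \<open>The convex polygon is the regular one inscribed in the unit circle.\<close>

definition noncrossing :: "'a list set \<Rightarrow> 'a set set \<Rightarrow> bool" where
  "noncrossing C P \<longleftrightarrow>
     (\<forall>xs\<in>C. let hull_of = (\<lambda>X. convex hull
                {cis (2 * pi * real k / real (length xs)) | k. k < length xs \<and> xs ! k \<in> X})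
             in \<forall>X\<in>P. \<forall>Y\<in>P. X \<noteq> Y \<longrightarrow> hull_of X \<inter> hull_of Y = {})"


section \<open>The factorization of the cycle\<close>

definition ordering_before :: "complex poly \<Rightarrow> real \<Rightarrow> complex list" where
  "ordering_before p \<phi> = (THE xs. \<forall>\<^sub>F \<theta> in at_left \<phi>. linear_ordering p \<theta> = xs)"

definition ordering_after :: "complex poly \<Rightarrow> real \<Rightarrow> complex list" where
  "ordering_after p \<phi> = (THE xs. \<forall>\<^sub>F \<theta> in at_right \<phi>. linear_ordering p \<theta> = xs)"

text \<open>The two-line notation with rows \<open>xs\<close> and \<open>ys\<close>, the entries being named by their positions
  \<open>1, \<dots>, d\<close> in \<open>xs\<close>, so that the first row becomes \<open>1 2 \<dots> d\<close>. Since \<open>two_line xs zs = two_line xs ys \<circ> two_line ys zs\<close>, successive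
  factors have to be composed with the earlier one on the left.\<close>

definition two_line :: "'a list \<Rightarrow> 'a list \<Rightarrow> nat \<Rightarrow> nat" where
  "two_line xs ys i =
     (if i \<in> {1..length xs}
      then THE j. j \<in> {1..length xs} \<and> xs ! (j - 1) = ys ! (i - 1) else i)"

text \<open>\<^term>\<open>dir_at p\<close> wraps the circle at infinity \<^term>\<open>degree p\<close> times around the unit circle,
  so that the direction makes one full turn when the angle grows by \<open>2\<pi>/d\<close>.\<close>

definition critical_angles :: "complex poly \<Rightarrow> real \<Rightarrow> real set" where
  "critical_angles p \<theta> =
     {\<phi> \<in> {\<theta><..<\<theta> + 2 * pi / real (degree p)}. \<not> regular_Dir p (dir_at p \<phi>)}"

definition factors :: "complex poly \<Rightarrow> real \<Rightarrow> (nat \<Rightarrow> nat) list" where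
  "factors p \<theta> = map (\<lambda>\<phi>. two_line (ordering_before p \<phi>) (ordering_after p \<phi>))
     (sorted_list_of_set (critical_angles p \<theta>))"

end

theory Submission
  imports
    Defs
    "HOL-Complex_Analysis.Complex_Analysis"
    "HOL-Computational_Algebra.Fundamental_Theorem_Algebra"
begin

text \<open>Over the union of a thin sector around a regular direction \<open>u\<close> and a small disc around the
  origin, which is simply connected and avoids the critical values, \<open>p\<close> has \<open>d\<close> inverse branches, one
  for each root. Their images of the sector are disjoint open sheets, and a curve from one sheet to
  another has to leave the sector in the annulus; hence the sheets stay a positive distance apart and
  split \<open>Dir p u\<close> into \<open>d\<close> closed pieces, each containing one arc with one end on the circle at
  infinity. Near infinity the pullback metric is controlled by polar coordinates, so that the ends
  depend continuously on the angle. Thus the ordering of the roots is locally constant along regular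
  directions, and over a full turn of the direction it rotates by one step, which makes the product
  of the factors telescope to the cycle.

  If two blocks of a level partition crossed, two disjoint components of a sublevel set, extended by
  arcs to infinity, would form disjoint continua in a disc joining interlaced pairs of boundary
  points, which Fashoda's theorem excludes.\<close>

text \<open>The branched annulus is an abstract completion, and its boundary is reached only through
  limits of \<open>emb p\<close>. Distances are bounded above by explicit Lipschitz curves, and
  below because \<open>iA \<circ> poly p\<close> does not increase distances. Separation of the
  closed pieces of \<open>Dir p u\<close> is a statement of this metric kind, whereas recognising
  arcs would require charts at the boundary.

  That the roots are distinct means that 0 is not a critical value; hence a branch can be named by
  the root that it takes at 0.

  Two orders at infinity have to be matched: that of the points \<open>inf_pt p \<theta>\<close> in
  the completion, by which the roots are read, and that of the directions in the plane, on which the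
  crossing argument rests. The link is that along a lifted ray the direction in the plane converges.

  Fashoda's theorem speaks of paths in a box. Therefore the plane is shrunk to a disc, so that
  lifted rays acquire end points, the disc is mapped to a half-plane, and the continua are replaced
  by paths in small neighbourhoods.\<close>

section \<open>Lengths of curves\<close>

lemma variation_sums_nonempty: "variation_sums g \<noteq> {}"
proof -
  have "(\<Sum>i<1. dist (g (real i)) (g (real (Suc i)))) \<in> variation_sums g"
    unfolding variation_sums_def by (intro CollectI exI[of _ 1] exI[of _ real]) auto
  then show ?thesis by blast
qed

lemma partition_mono:
  fixes s :: "nat \<Rightarrow> real"
  assumes "\<forall>i<n. s i \<le> s (Suc i)" "i \<le> j" "j \<le> n"
  shows "s i \<le> s j"
  using assms(2,3)
proof (induction j rule: dec_induct)
  case (step k)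
  then show ?case using assms(1) by (meson Suc_le_lessD less_imp_le order_trans)
qed simp

lemma curve_length_upper:
  assumes "bdd_above (variation_sums g)" "s 0 = 0" "s n = 1" "\<forall>i<n. s i \<le> s (Suc i)"
  shows "(\<Sum>i<n. dist (g (s i)) (g (s (Suc i)))) \<le> curve_length g"
  unfolding curve_length_def
  by (rule cSup_upper[OF _ assms(1)]) (use assms in \<open>auto simp: variation_sums_def\<close>)

lemma variation_sums_bound_imp:
  assumes "\<And>n s. s 0 = 0 \<Longrightarrow> s n = 1 \<Longrightarrow> (\<forall>i<n. s i \<le> s (Suc i)) \<Longrightarrow>
      (\<Sum>i<n. dist (g (s i)) (g (s (Suc i)))) \<le> B"
  shows "bdd_above (variation_sums g)" "curve_length g \<le> B"
proof -
  have *: "x \<le> B" if "x \<in> variation_sums g" for x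
    using that assms by (force simp: variation_sums_def)
  show "bdd_above (variation_sums g)" using * by (meson bdd_above.I)
  show "curve_length g \<le> B"
    unfolding curve_length_def by (rule cSup_least[OF variation_sums_nonempty *])
qed

text \<open>The partition \<open>0, s, 1\<close> suffices. All lower bounds on lengths of admissible
  curves come from this: the curve is caught at one well chosen point.\<close>

lemma curve_length_ge_dist:
  assumes "bdd_above (variation_sums g)" "s \<in> {0..1}"
  shows "dist (g 0) (g s) \<le> curve_length g"
proof -
  define f where "f = (\<lambda>i::nat. if i = 0 then 0 else if i = 1 then s else (1::real))"
  have f: "f 0 = 0" "f (Suc 0) = s" "f (Suc (Suc 0)) = 1" by (auto simp: f_def)
  have "\<forall>i<Suc (Suc 0). f i \<le> f (Suc i)"
    using assms(2) f by (auto simp: less_Suc_eq)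
  from curve_length_upper[of g f, OF assms(1) f(1) f(3) this]
  have "dist (g 0) (g s) + dist (g s) (g 1) \<le> curve_length g"
    by (simp add: f)
  then show ?thesis by (rule order_trans[rotated]) simp
qed

text \<open>On the unit interval the increments of the parameter sum to 1, so the Lipschitz constant
  itself bounds the length. Explicit curves are measured in this way.\<close>

lemma curve_length_lipschitz:
  assumes "L-lipschitz_on {0..1} g"
  shows "rectifiable g" "curve_length g \<le> L"
proof -
  have B: "(\<Sum>i<n. dist (g (s i)) (g (s (Suc i)))) \<le> L"
    if s: "s 0 = 0" "s n = 1" "\<forall>i<n. s i \<le> s (Suc i)" for n :: nat and s
  proof -
    have in01: "s i \<in> {0..1}" if "i \<le> n" for i
      using partition_mono[OF s(3), of 0 i] partition_mono[OF s(3), of i n] that s by auto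
    have "(\<Sum>i<n. dist (g (s i)) (g (s (Suc i)))) \<le> (\<Sum>i<n. L * (s (Suc i) - s i))"
    proof (rule sum_mono)
      fix i assume "i \<in> {..<n}"
      then have "dist (g (s i)) (g (s (Suc i))) \<le> L * dist (s i) (s (Suc i))"
        by (intro lipschitz_onD[OF assms] in01) auto
      also have "dist (s i) (s (Suc i)) = s (Suc i) - s i"
        using s(3) \<open>i \<in> {..<n}\<close> by (simp add: dist_real_def)
      finally show "dist (g (s i)) (g (s (Suc i))) \<le> L * (s (Suc i) - s i)" .
    qed
    also have "\<dots> = L" using s by (simp add: sum_distrib_left[symmetric] sum_lessThan_telescope)
    finally show ?thesis .
  qed
  note bound = variation_sums_bound_imp[of g L]
  have "bdd_above (variation_sums g)" by (rule bound(1)) (fact B)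
  then show "rectifiable g"
    unfolding rectifiable_def path_def using lipschitz_on_continuous_on[OF assms] by blast
  show "curve_length g \<le> L" by (rule bound(2)) (fact B)
qed

lemma curve_length_reversepath:
  assumes "rectifiable g"
  shows "rectifiable (g \<circ> (\<lambda>t. 1 - t))" "curve_length (g \<circ> (\<lambda>t. 1 - t)) \<le> curve_length g"
proof -
  let ?g = "g \<circ> (\<lambda>t. 1 - t)"
  have bdd: "bdd_above (variation_sums g)" and "path g" using assms by (auto simp: rectifiable_def)
  have B: "(\<Sum>i<n. dist (?g (s i)) (?g (s (Suc i)))) \<le> curve_length g"
    if s: "s 0 = 0" "s n = 1" "\<forall>i<n. s i \<le> s (Suc i)" for n :: nat and s
  proof -
    define f where "f = (\<lambda>i. 1 - s (n - i))"
    have "(\<Sum>i<n. dist (?g (s i)) (?g (s (Suc i)))) = (\<Sum>i<n. dist (g (f i)) (g (f (Suc i))))"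
    proof (rule sum.reindex_bij_witness[of _ "\<lambda>i. n - Suc i" "\<lambda>i. n - Suc i"])
      fix i assume "i \<in> {..<n}"
      then show "dist (g (f (n - Suc i))) (g (f (Suc (n - Suc i)))) = dist (?g (s i)) (?g (s (Suc i)))"
        by (simp add: f_def dist_commute Suc_diff_Suc)
    qed auto
    also have "\<dots> \<le> curve_length g"
    proof (rule curve_length_upper[OF bdd])
      show "\<forall>i<n. f i \<le> f (Suc i)"
      proof (intro allI impI)
        fix i assume "i < n"
        then have "s (n - Suc i) \<le> s (Suc (n - Suc i))" using s(3) by simp
        with \<open>i < n\<close> show "f i \<le> f (Suc i)" by (simp add: f_def Suc_diff_Suc)
      qed
    qed (use s in \<open>auto simp: f_def\<close>)
    finally show ?thesis .
  qed
  have path: "path ?g" using \<open>path g\<close> path_reversepath[of g] by (simp add: reversepath_def o_def)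
  note bound = variation_sums_bound_imp[of ?g "curve_length g"]
  have "bdd_above (variation_sums ?g)" by (rule bound(1)) (fact B)
  with path show "rectifiable ?g" by (simp add: rectifiable_def)
  show "curve_length ?g \<le> curve_length g" by (rule bound(2)) (fact B)
qed

lemma curve_length_joinpaths:
  assumes "rectifiable g" "rectifiable h" "pathfinish g = pathstart h"
  shows "rectifiable (g +++ h)" "curve_length (g +++ h) \<le> curve_length g + curve_length h"
proof -
  let ?j = "g +++ h"
  have bg: "bdd_above (variation_sums g)" and bh: "bdd_above (variation_sums h)"
    using assms by (auto simp: rectifiable_def)
  have gh: "g 1 = h 0" using assms(3) by (simp add: pathfinish_def pathstart_def)
  have B: "(\<Sum>i<n. dist (?j (s i)) (?j (s (Suc i)))) \<le> curve_length g + curve_length h"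
    if s: "s 0 = 0" "s n = 1" "\<forall>i<n. s i \<le> s (Suc i)" for n :: nat and s
  proof -
    \<comment> \<open>Clamping splits a partition of the concatenation into one for each half; the
      clamped points stand still while the other half is traversed.\<close>
    define a where "a = (\<lambda>i. min (2 * s i) 1)"
    define b where "b = (\<lambda>i. max (2 * s i - 1) 0)"
    \<comment> \<open>The inequality holds term by term, so that no point has to be inserted into the partition.\<close>
    have "(\<Sum>i<n. dist (?j (s i)) (?j (s (Suc i)))) \<le>
          (\<Sum>i<n. dist (g (a i)) (g (a (Suc i))) + dist (h (b i)) (h (b (Suc i))))"
    proof (rule sum_mono)
      fix i assume "i \<in> {..<n}"
      then have le: "s i \<le> s (Suc i)" using s(3) by simp
      consider "s (Suc i) \<le> 1/2" | "s i \<le> 1/2" "s (Suc i) > 1/2" | "s i > 1/2" by linarith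
      then show "dist (?j (s i)) (?j (s (Suc i))) \<le>
          dist (g (a i)) (g (a (Suc i))) + dist (h (b i)) (h (b (Suc i)))"
      proof cases
        case 2
        have "dist (g (2 * s i)) (h (2 * s (Suc i) - 1))
            \<le> dist (g (2 * s i)) (g 1) + dist (h 0) (h (2 * s (Suc i) - 1))"
          using dist_triangle[of "g (2 * s i)" "h (2 * s (Suc i) - 1)" "g 1"] gh by simp
        moreover from 2 have "?j (s i) = g (2 * s i)" "?j (s (Suc i)) = h (2 * s (Suc i) - 1)"
          "a i = 2 * s i" "a (Suc i) = 1" "b i = 0" "b (Suc i) = 2 * s (Suc i) - 1"
          by (auto simp: joinpaths_def a_def b_def)
        ultimately show ?thesis by simp
      next
        case 1
        with le have "s i \<le> 1/2" by linarith
        with 1 have "?j (s i) = g (a i)" "?j (s (Suc i)) = g (a (Suc i))"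
          by (simp_all add: joinpaths_def a_def)
        then show ?thesis by simp
      next
        case 3
        with le have "s (Suc i) > 1/2" by linarith
        with 3 have "?j (s i) = h (b i)" "?j (s (Suc i)) = h (b (Suc i))"
          by (simp_all add: joinpaths_def b_def)
        then show ?thesis by simp
      qed
    qed
    also have "\<dots> = (\<Sum>i<n. dist (g (a i)) (g (a (Suc i)))) + (\<Sum>i<n. dist (h (b i)) (h (b (Suc i))))"
      by (rule sum.distrib)
    also have "\<dots> \<le> curve_length g + curve_length h"
    proof (rule add_mono)
      show "(\<Sum>i<n. dist (g (a i)) (g (a (Suc i)))) \<le> curve_length g"
        by (rule curve_length_upper[of g a n, OF bg]) (use s in \<open>auto simp: a_def min_def\<close>)
      show "(\<Sum>i<n. dist (h (b i)) (h (b (Suc i)))) \<le> curve_length h"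
        by (rule curve_length_upper[of h b n, OF bh]) (use s in \<open>auto simp: b_def max_def\<close>)
    qed
    finally show ?thesis .
  qed
  have path: "path ?j" using assms by (auto simp: rectifiable_def)
  note bound = variation_sums_bound_imp[of ?j "curve_length g + curve_length h"]
  have "bdd_above (variation_sums ?j)" by (rule bound(1)) (fact B)
  with path show "rectifiable ?j" by (simp add: rectifiable_def)
  show "curve_length ?j \<le> curve_length g + curve_length h" by (rule bound(2)) (fact B)
qed

section \<open>The map to the annulus\<close>

definition height :: "real \<Rightarrow> real" where
  "height r = (r\<^sup>2 - 1) / (r\<^sup>2 + 1)"

text \<open>The inverse of \<open>height\<close> on nonnegative reals, and the radius that occurs in
  \<open>level_partition\<close>: heights parametrise both the lifted rays and the sublevel
  sets.\<close>

definition radius :: "real \<Rightarrow> real" where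
  "radius t = sqrt ((1 + t) / (1 - t))"

lemma iA_eq: "iA z = (sgn z, height (cmod z))"
  by (simp add: iA_def height_def)

lemma height_eq: "height r = 1 - 2 / (r\<^sup>2 + 1)"
proof -
  have "r\<^sup>2 + 1 \<noteq> 0" by (metis add_nonneg_eq_0_iff zero_le_power2 zero_le_one zero_neq_one)
  then show ?thesis by (simp add: height_def divide_simps)
qed

lemma height_bounds: "-1 \<le> height r" "height r < 1" "r \<noteq> 0 \<Longrightarrow> -1 < height r"
proof -
  have pos: "r\<^sup>2 + 1 > 0" by (simp add: add_nonneg_pos)
  show "-1 \<le> height r" "height r < 1" using pos by (auto simp: height_def divide_simps)
  show "-1 < height r" if "r \<noteq> 0"
  proof -
    have "r\<^sup>2 > 0" using that by simp
    then show ?thesis using pos by (auto simp: height_def divide_simps)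
  qed
qed

lemma height_lipschitz:
  assumes "r \<ge> 0" "r' \<ge> 0"
  shows "\<bar>height r - height r'\<bar> \<le> 2 * \<bar>r - r'\<bar>"
proof -
  have pos: "r\<^sup>2 + 1 > 0" "r'\<^sup>2 + 1 > 0" by (auto simp: add_nonneg_pos)
  have "height r - height r' = 2 * (r - r') * ((r + r') / ((r\<^sup>2 + 1) * (r'\<^sup>2 + 1)))"
    using pos by (simp add: height_eq divide_simps) (simp add: power2_eq_square algebra_simps)
  \<comment> \<open>Completing the squares even leaves a surplus of 1/2; the quotient above is thus
    at most 1, and only the factor 2 remains.\<close>
  moreover have "r + r' \<le> (r\<^sup>2 + 1) * (r'\<^sup>2 + 1)"
  proof -
    have "0 \<le> (r - 1/2)\<^sup>2 + (r' - 1/2)\<^sup>2 + r\<^sup>2 * r'\<^sup>2" by simp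
    then show ?thesis by (simp add: power2_eq_square algebra_simps)
  qed
  then have "(r + r') / ((r\<^sup>2 + 1) * (r'\<^sup>2 + 1)) \<le> 1" using pos by simp
  moreover have "0 \<le> (r + r') / ((r\<^sup>2 + 1) * (r'\<^sup>2 + 1))" using assms pos by simp
  moreover have "\<bar>2 * (r - r') * x\<bar> \<le> 2 * \<bar>r - r'\<bar>" if "0 \<le> x" "x \<le> 1" for x
  proof -
    have "\<bar>2 * (r - r') * x\<bar> = 2 * \<bar>r - r'\<bar> * x" using that by (simp only: abs_mult)
    also have "\<dots> \<le> 2 * \<bar>r - r'\<bar>" using that by (intro mult_left_le) auto
    finally show ?thesis .
  qed
  ultimately show ?thesis by metis
qed

text \<open>Inverting the modulus reflects the annulus, so estimates at the outer boundary can be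
  made for \<open>1 / p\<close>, which is small there.\<close>

lemma height_inverse: "r \<noteq> 0 \<Longrightarrow> height (inverse r) = - height r"
  by (simp add: height_def divide_simps power2_eq_square)

lemma radius_pos: "t \<in> {-1<..<1} \<Longrightarrow> radius t > 0"
  by (simp add: radius_def)

lemma height_radius: "t \<in> {-1<..<1} \<Longrightarrow> height (radius t) = t"
  by (simp add: height_def radius_def divide_simps)

lemma radius_height: 
  assumes "r \<ge> 0" shows "radius (height r) = r"
proof -
  have pos: "r\<^sup>2 + 1 > 0" by (simp add: add_nonneg_pos)
  have "(1 + height r) / (1 - height r) = r\<^sup>2"
    using pos by (simp add: height_eq field_simps)
  then show ?thesis using assms by (simp add: radius_def)
qed

lemma radius_mono: "s \<in> {-1<..<1} \<Longrightarrow> t \<in> {-1<..<1} \<Longrightarrow> s \<le> t \<Longrightarrow> radius s \<le> radius t"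
  unfolding radius_def by (auto intro!: frac_le)

lemma continuous_on_radius: "continuous_on {-1<..<1} radius"
  unfolding radius_def by (intro continuous_intros) auto

lemma dist_sgn_le:
  fixes x y :: complex
  assumes "m > 0" "m \<le> norm x" "m \<le> norm y"
  shows "dist (sgn x) (sgn y) \<le> 2 / m * dist x y"
proof -
  have "norm x > 0" "norm y > 0" using assms by auto
  have "sgn x - sgn y = (x - y) /\<^sub>R norm x + (inverse (norm x) - inverse (norm y)) *\<^sub>R y"
    by (simp add: sgn_div_norm algebra_simps)
  also have "norm \<dots> \<le> norm (x - y) / norm x + \<bar>inverse (norm x) - inverse (norm y)\<bar> * norm y"
    by (rule order_trans[OF norm_triangle_ineq]) (simp add: divide_inverse mult.commute)
  also have "\<bar>inverse (norm x) - inverse (norm y)\<bar> * norm y = \<bar>norm y - norm x\<bar> / norm x"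
  proof -
    have "inverse (norm x) - inverse (norm y) = (norm y - norm x) / (norm x * norm y)"
      using \<open>norm x > 0\<close> \<open>norm y > 0\<close> by (simp add: divide_simps)
    then show ?thesis using \<open>norm x > 0\<close> \<open>norm y > 0\<close> by (simp add: abs_mult)
  qed
  also have "norm (x - y) / norm x + \<bar>norm y - norm x\<bar> / norm x \<le> 2 * norm (x - y) / norm x"
    using \<open>norm x > 0\<close> norm_triangle_ineq3[of y x]
    by (simp add: add_divide_distrib[symmetric] divide_right_mono norm_minus_commute)
  also have "\<dots> \<le> 2 * norm (x - y) / m"
    using assms \<open>norm x > 0\<close> by (intro divide_left_mono) (auto intro!: mult_pos_pos)
  finally show ?thesis by (simp add: dist_norm)
qed

lemma dist_prod_le: "dist (a, b) (c, d) \<le> dist a c + dist b d"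
  unfolding dist_Pair_Pair by (rule sqrt_sum_squares_le_sum) auto

lemma dist_iA_le: "dist (iA x) (iA y) \<le> dist (sgn x) (sgn y) + \<bar>height (cmod x) - height (cmod y)\<bar>"
  unfolding iA_eq by (rule order_trans[OF dist_prod_le]) (simp add: dist_real_def)

text \<open>The circle coordinate alone bounds distances from below: a curve pays for every change
  of the direction of \<open>p\<close>.\<close>

lemma dist_sgn_le_iA: "dist (sgn x) (sgn y) \<le> dist (iA x) (iA y)"
  using dist_fst_le[of "iA x" "iA y"] by (simp add: iA_eq)

text \<open>The constant blows up at the origin because \<open>sgn\<close> has no limit there; hence
  the distance \<open>m\<close>.\<close>

lemma iA_lipschitz:
  assumes "m > 0"
  shows "(2 / m + 2)-lipschitz_on {z. m \<le> norm z} iA"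
proof (rule lipschitz_onI)
  fix x y :: complex assume "x \<in> {z. m \<le> norm z}" "y \<in> {z. m \<le> norm z}"
  then have "dist (sgn x) (sgn y) \<le> 2 / m * dist x y" using dist_sgn_le[OF assms] by auto
  moreover have "\<bar>height (cmod x) - height (cmod y)\<bar> \<le> 2 * dist x y"
    using height_lipschitz[of "cmod x" "cmod y"] norm_triangle_ineq3[of x y] by (simp add: dist_norm)
  ultimately show "dist (iA x) (iA y) \<le> (2 / m + 2) * dist x y"
    using dist_iA_le[of x y] by (simp add: algebra_simps)
qed (use assms in simp)

lemma continuous_on_iA: "continuous_on (- {0}) iA"
proof -
  have "(cmod x)\<^sup>2 + 1 \<noteq> 0" for x :: complex
    by (metis add_nonneg_eq_0_iff zero_le_power2 zero_le_one zero_neq_one)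
  then show ?thesis unfolding iA_def sgn_div_norm by (intro continuous_intros) auto
qed

lemma iA_in_annulus: "z \<noteq> 0 \<Longrightarrow> iA z \<in> annulus"
  using height_bounds[of "cmod z"] by (auto simp: annulus_def iA_eq norm_sgn)

lemma holomorphic_imp_lipschitz:
  fixes f :: "complex \<Rightarrow> complex"
  assumes "f holomorphic_on S" "open S" "K \<subseteq> S" "compact K" "convex K"
  obtains L where "L-lipschitz_on K f"
proof -
  have "continuous_on K (deriv f)"
    using assms holomorphic_deriv holomorphic_on_imp_continuous_on continuous_on_subset by blast
  then have "compact (deriv f ` K)" using assms(4) compact_continuous_image by blast
  then obtain B where B: "\<And>x. x \<in> K \<Longrightarrow> norm (deriv f x) \<le> B"
    by (meson bounded_iff compact_imp_bounded imageI)
  have "\<bar>B\<bar>-lipschitz_on K f"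
  proof (rule lipschitz_onI)
    fix x y assume "x \<in> K" "y \<in> K"
    have "norm (f x - f y) \<le> \<bar>B\<bar> * norm (x - y)"
    proof (rule field_differentiable_bound[OF assms(5) _ _ \<open>x \<in> K\<close> \<open>y \<in> K\<close>])
      show "(f has_field_derivative deriv f z) (at z within K)" if "z \<in> K" for z
        using assms that holomorphic_derivI by blast
      show "norm (deriv f z) \<le> \<bar>B\<bar>" if "z \<in> K" for z using B[OF that] by linarith
    qed
    then show "dist (f x) (f y) \<le> \<bar>B\<bar> * dist x y" by (simp add: dist_norm)
  qed simp
  then show ?thesis using that by blast
qed

lemma norm_mult_sgn: "complex_of_real (cmod z) * sgn z = z"
  by (cases "z = 0") (auto simp: sgn_eq)

section \<open>The pullback metric\<close>

definition admissible :: "complex poly \<Rightarrow> complex \<Rightarrow> complex \<Rightarrow> (real \<Rightarrow> complex) \<Rightarrow> bool" where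
  "admissible p z w \<gamma> \<longleftrightarrow> path \<gamma> \<and> path_image \<gamma> \<subseteq> - rts p \<and> pathstart \<gamma> = z \<and> pathfinish \<gamma> = w \<and>
     rectifiable (iA \<circ> poly p \<circ> \<gamma>)"

lemma pullback_dist_eq:
  "pullback_dist p z w = Inf ((\<lambda>\<gamma>. curve_length (iA \<circ> poly p \<circ> \<gamma>)) ` {\<gamma>. admissible p z w \<gamma>})"
  unfolding pullback_dist_def admissible_def image_def by (rule arg_cong[where f = Inf]) auto

lemma admissibleD:
  assumes "admissible p z w \<gamma>" "s \<in> {0..1}"
  shows "\<gamma> s \<notin> rts p" "dist (iA (poly p z)) (iA (poly p (\<gamma> s))) \<le> curve_length (iA \<circ> poly p \<circ> \<gamma>)"
proof -
  have "\<gamma> s \<in> path_image \<gamma>" using assms(2) by (simp add: path_image_def)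
  then show "\<gamma> s \<notin> rts p" using assms(1) by (auto simp: admissible_def)
  show "dist (iA (poly p z)) (iA (poly p (\<gamma> s))) \<le> curve_length (iA \<circ> poly p \<circ> \<gamma>)"
    using curve_length_ge_dist[of "iA \<circ> poly p \<circ> \<gamma>" s] assms
    by (auto simp: admissible_def rectifiable_def pathstart_def)
qed

lemma admissible_length_nonneg: "admissible p z w \<gamma> \<Longrightarrow> 0 \<le> curve_length (iA \<circ> poly p \<circ> \<gamma>)"
  by (rule order_trans[OF zero_le_dist admissibleD(2)[of p z w \<gamma> 0]]) auto

lemma pullback_dist_le:
  assumes "admissible p z w \<gamma>"
  shows "pullback_dist p z w \<le> curve_length (iA \<circ> poly p \<circ> \<gamma>)"
  unfolding pullback_dist_eq
  by (rule cInf_lower) (use assms admissible_length_nonneg in \<open>auto intro!: bdd_belowI[where m = 0]\<close>)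

lemma admissible_lipschitz:
  assumes "path \<gamma>" "path_image \<gamma> \<subseteq> - rts p" "L-lipschitz_on {0..1} (iA \<circ> poly p \<circ> \<gamma>)"
  shows "admissible p (\<gamma> 0) (\<gamma> 1) \<gamma>" "pullback_dist p (\<gamma> 0) (\<gamma> 1) \<le> L"
proof -
  show *: "admissible p (\<gamma> 0) (\<gamma> 1) \<gamma>"
    using assms curve_length_lipschitz(1)[OF assms(3)]
    by (simp add: admissible_def pathstart_def pathfinish_def)
  show "pullback_dist p (\<gamma> 0) (\<gamma> 1) \<le> L"
    using pullback_dist_le[OF *] curve_length_lipschitz(2)[OF assms(3)] by linarith
qed

text \<open>The metric, its completion and the circle at infinity are treated here. Simple roots
  enter in the extension \<open>simple_poly\<close>, for the sake of the inverse branches.\<close>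

locale nonconstant_poly =
  fixes p :: "complex poly"
  assumes degree_pos: "degree p > 0"
begin

lemma finite_fiber: "finite {z. poly p z = w}"
proof -
  have "finite {z. poly (p - [:w:]) z = 0}"
    using degree_pos by (intro poly_roots_finite) (auto simp: degree_pCons_0)
  then show ?thesis by simp
qed

lemma finite_rts: "finite (rts p)"
  using finite_fiber[of 0] by (simp add: rts_def)

lemma poly_nz: "z \<notin> rts p \<Longrightarrow> poly p z \<noteq> 0"
  by (simp add: rts_def)

lemma open_minus_rts: "open (- rts p)"
  using finite_rts by (simp add: finite_imp_closed open_Compl)

text \<open>Without this the infimum in \<open>pullback_dist\<close> might be over the empty set. A
  merely continuous path could have infinite length; a polynomial path is Lipschitz, and by
  compactness \<open>p\<close> stays away from 0 along it, where \<open>iA\<close> is Lipschitz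
  too.\<close>

lemma admissible_ex:
  assumes "z \<notin> rts p" "w \<notin> rts p"
  shows "\<exists>\<gamma>. admissible p z w \<gamma>"
proof -
  have "connected (- rts p)"
    using connected_open_delete_finite[of UNIV "rts p"] finite_rts
    by (simp add: Compl_eq_Diff_UNIV connected_UNIV)
  then have "\<exists>g. polynomial_function g \<and> path_image g \<subseteq> - rts p \<and> pathstart g = z \<and> pathfinish g = w"
    by (intro connected_open_polynomial_connected open_minus_rts) (use assms in auto)
  then obtain g where g: "polynomial_function g" "path_image g \<subseteq> - rts p" "pathstart g = z" "pathfinish g = w"
    by blast
  obtain g' where g': "polynomial_function g'" "\<And>x. (g has_vector_derivative g' x) (at x)"
    using has_vector_derivative_polynomial_function[OF g(1)] by metis
  have "compact (g' ` {0..1})"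
    using g'(1) by (intro compact_continuous_image continuous_on_polymonial_function compact_Icc)
  then obtain B where B: "\<And>x. x \<in> {0..1} \<Longrightarrow> norm (g' x) \<le> B"
    by (meson bounded_iff compact_imp_bounded imageI)
  have lg: "\<bar>B\<bar>-lipschitz_on {0..1} g"
  proof (rule lipschitz_onI)
    fix x y :: real assume "x \<in> {0..1}" "y \<in> {0..1}"
    have "norm (g x - g y) \<le> \<bar>B\<bar> * norm (x - y)"
    proof (rule differentiable_bound[where S = "{0..1}" and f' = "\<lambda>x h. h *\<^sub>R g' x"])
      show "(g has_derivative (\<lambda>h. h *\<^sub>R g' x)) (at x within {0..1})" if "x \<in> {0..1}" for x
        using g'(2)[of x] has_derivative_at_withinI by (auto simp: has_vector_derivative_def)
      show "onorm (\<lambda>h. h *\<^sub>R g' x) \<le> \<bar>B\<bar>" if "x \<in> {0..1}" for x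
        
      proof (rule onorm_le)
        fix h :: real
        have "\<bar>h\<bar> * norm (g' x) \<le> \<bar>h\<bar> * \<bar>B\<bar>" using B[OF that] by (intro mult_left_mono) auto
        then show "norm (h *\<^sub>R g' x) \<le> \<bar>B\<bar> * norm h" by (simp add: mult.commute)
      qed
    qed (use \<open>x \<in> {0..1}\<close> \<open>y \<in> {0..1}\<close> in auto)
    then show "dist (g x) (g y) \<le> \<bar>B\<bar> * dist x y" by (simp add: dist_norm)
  qed simp
  have comp: "compact (g ` {0..1})"
    using g(1) by (intro compact_continuous_image continuous_on_polymonial_function compact_Icc)
  from compact_imp_bounded[OF this]
  obtain R where "\<forall>x\<in>g ` {0..1}. norm x \<le> R" unfolding bounded_iff by blast
  then have R: "g ` {0..1} \<subseteq> cball 0 R" by auto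
  obtain L where L: "L-lipschitz_on (cball 0 R) (poly p)"
    by (rule holomorphic_imp_lipschitz[of "poly p" UNIV "cball 0 R"])
       (auto intro!: holomorphic_intros)
  have "compact (poly p ` g ` {0..1})"
    by (intro compact_continuous_image continuous_intros comp)
  moreover have "0 \<notin> poly p ` g ` {0..1}" using g(2) by (auto simp: path_image_def rts_def)
  ultimately obtain m where m: "m > 0" "\<And>x. x \<in> {0..1} \<Longrightarrow> m \<le> norm (poly p (g x))"
    using separate_point_closed[OF compact_imp_closed, of "poly p ` g ` {0..1}" 0] by auto
  have "((2 / m + 2) * (L * \<bar>B\<bar>))-lipschitz_on {0..1} (iA \<circ> (poly p \<circ> g))"
    by (intro lipschitz_on_compose lg lipschitz_on_subset[OF L] lipschitz_on_subset[OF iA_lipschitz[OF m(1)]])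
       (use R m in auto)
  then have "admissible p (g 0) (g 1) g"
    using g by (intro admissible_lipschitz(1)) (auto simp: o_assoc path_polynomial_function)
  then show ?thesis using g by (auto simp: pathstart_def pathfinish_def)
qed

lemma pullback_dist_ge:
  assumes "z \<notin> rts p" "w \<notin> rts p" "\<And>\<gamma>. admissible p z w \<gamma> \<Longrightarrow> B \<le> curve_length (iA \<circ> poly p \<circ> \<gamma>)"
  shows "B \<le> pullback_dist p z w"
  unfolding pullback_dist_eq
  by (rule cInf_greatest) (use assms admissible_ex[OF assms(1,2)] in auto)

lemma pullback_dist_ge_dist:
  assumes "z \<notin> rts p" "w \<notin> rts p"
  shows "dist (iA (poly p z)) (iA (poly p w)) \<le> pullback_dist p z w"
  using assms
proof (rule pullback_dist_ge)
  fix \<gamma> assume g: "admissible p z w \<gamma>"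
  then have "\<gamma> 1 = w" by (simp add: admissible_def pathfinish_def)
  then show "dist (iA (poly p z)) (iA (poly p w)) \<le> curve_length (iA \<circ> poly p \<circ> \<gamma>)"
    using admissibleD(2)[OF g, of 1] by simp
qed

text \<open>A curve from \<open>z\<close> to another point crosses a small circle around \<open>z\<close>, on which \<open>p\<close> stays away
  from \<open>p(z)\<close>.\<close>

lemma pullback_dist_pos:
  assumes "z \<notin> rts p" "w \<notin> rts p" "z \<noteq> w"
  shows "0 < pullback_dist p z w"
proof -
  have "finite ({x. poly p x = poly p z} \<union> rts p)" using finite_fiber finite_rts by blast
  then obtain e0 where e0: "e0 > 0" "\<And>x. x \<in> {x. poly p x = poly p z} \<union> rts p \<Longrightarrow> x \<noteq> z \<Longrightarrow> e0 \<le> dist z x"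
    using finite_set_avoid[of "{x. poly p x = poly p z} \<union> rts p" z] by blast
  define e where "e = min (e0 / 2) (dist z w / 2)"
  have e: "e > 0" "e < e0" "e < dist z w" using e0 assms(3) by (auto simp: e_def min_def)
  have nz: "poly p x \<noteq> poly p z" "x \<notin> rts p" if "x \<in> sphere z e" for x
    using e0(2)[of x] that e by auto
  have "compact ((\<lambda>x. iA (poly p x)) ` sphere z e)"
    by (intro compact_continuous_image continuous_on_compose2[OF continuous_on_iA] continuous_intros)
       (use nz poly_nz in auto)
  moreover have "iA (poly p z) \<notin> (\<lambda>x. iA (poly p x)) ` sphere z e"
  proof
    assume "iA (poly p z) \<in> (\<lambda>x. iA (poly p x)) ` sphere z e"
    then obtain x where x: "x \<in> sphere z e" "iA (poly p z) = iA (poly p x)" by blast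
    then have "sgn (poly p z) = sgn (poly p x)" "norm (poly p z) = norm (poly p x)"
      using radius_height[of "cmod (poly p x)"] radius_height[of "cmod (poly p z)"] by (auto simp: iA_eq)
    then have "poly p z = poly p x" by (subst (1 2) norm_mult_sgn[symmetric]) simp
    with nz(1) x show False by metis
  qed
  ultimately have "\<exists>d>0. \<forall>x\<in>(\<lambda>x. iA (poly p x)) ` sphere z e. d \<le> dist (iA (poly p z)) x"
    by (intro separate_point_closed compact_imp_closed)
  then obtain m where "m > 0" "\<forall>x\<in>(\<lambda>x. iA (poly p x)) ` sphere z e. m \<le> dist (iA (poly p z)) x"
    by blast
  then have m: "m > 0" "\<And>x. x \<in> sphere z e \<Longrightarrow> m \<le> dist (iA (poly p z)) (iA (poly p x))"
    by (auto simp del: mem_sphere)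
  have "m \<le> pullback_dist p z w" using assms(1,2)
  proof (rule pullback_dist_ge)
    fix \<gamma> assume g: "admissible p z w \<gamma>"
    then have "connected (path_image \<gamma>)" "z \<in> path_image \<gamma>" "w \<in> path_image \<gamma>"
      by (auto simp: admissible_def connected_path_image)
    moreover have "z \<in> ball z e" "w \<notin> ball z e" using e by auto
    ultimately have "path_image \<gamma> \<inter> frontier (ball z e) \<noteq> {}"
      by (intro connected_Int_frontier) auto
    moreover have "frontier (ball z e) = sphere z e" using e(1) by simp
    ultimately obtain y where "y \<in> path_image \<gamma>" "y \<in> sphere z e" by blast
    then obtain s where "s \<in> {0..1}" "\<gamma> s \<in> sphere z e" unfolding path_image_def by blast
    then show "m \<le> curve_length (iA \<circ> poly p \<circ> \<gamma>)"
      using admissibleD(2)[OF g] m(2) by (meson order_trans)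
  qed
  with m(1) show ?thesis by linarith
qed

lemma pullback_dist_self:
  assumes "z \<notin> rts p" shows "pullback_dist p z z = 0"
proof (rule antisym)
  have "0-lipschitz_on {0..1} (iA \<circ> poly p \<circ> (\<lambda>_::real. z))"
    by (rule lipschitz_onI) auto
  from admissible_lipschitz(2)[OF _ _ this]
  show "pullback_dist p z z \<le> 0" using assms by (auto simp: path_def path_image_def)
qed (use pullback_dist_ge_dist[OF assms assms] in simp)

lemma pullback_dist_nonneg: "z \<notin> rts p \<Longrightarrow> w \<notin> rts p \<Longrightarrow> 0 \<le> pullback_dist p z w"
  using pullback_dist_pos[of z w] pullback_dist_self[of z] by fastforce

lemma pullback_dist_commute_le:
  assumes "z \<notin> rts p" "w \<notin> rts p" shows "pullback_dist p z w \<le> pullback_dist p w z"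
proof (rule pullback_dist_ge[OF assms(2,1)])
  fix \<gamma> assume g: "admissible p w z \<gamma>"
  let ?h = "\<gamma> \<circ> (\<lambda>t. 1 - t)"
  have "?h = reversepath \<gamma>" by (auto simp: reversepath_def)
  then have "path ?h" "path_image ?h = path_image \<gamma>" "pathstart ?h = z" "pathfinish ?h = w"
    using g by (auto simp: admissible_def)
  then have "admissible p z w ?h"
    using g curve_length_reversepath(1)[of "iA \<circ> poly p \<circ> \<gamma>"] by (auto simp: admissible_def o_assoc)
  from pullback_dist_le[OF this] show "pullback_dist p z w \<le> curve_length (iA \<circ> poly p \<circ> \<gamma>)"
    using curve_length_reversepath(2)[of "iA \<circ> poly p \<circ> \<gamma>"] g by (auto simp: admissible_def o_assoc)
qed

lemma pullback_dist_triangle: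
  assumes "x \<notin> rts p" "y \<notin> rts p" "z \<notin> rts p"
  shows "pullback_dist p x z \<le> pullback_dist p x y + pullback_dist p y z"
proof -
  \<comment> \<open>With the terms rearranged, both infima on the right can be treated as lower
    bounds: first the second one, then, for a fixed curve \<open>h\<close>, the first.\<close>
  have "pullback_dist p x z - pullback_dist p x y \<le> pullback_dist p y z"
  proof (rule pullback_dist_ge[OF assms(2,3)])
    fix h assume h: "admissible p y z h"
    have "pullback_dist p x z - curve_length (iA \<circ> poly p \<circ> h) \<le> pullback_dist p x y"
    proof (rule pullback_dist_ge[OF assms(1,2)])
      fix g assume g: "admissible p x y g"
      have eq: "iA \<circ> poly p \<circ> (g +++ h) = (iA \<circ> poly p \<circ> g) +++ (iA \<circ> poly p \<circ> h)"
        by (auto simp: joinpaths_def)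
      have fin: "pathfinish (iA \<circ> poly p \<circ> g) = pathstart (iA \<circ> poly p \<circ> h)"
        using g h by (simp add: admissible_def pathfinish_def pathstart_def)
      have "rectifiable (iA \<circ> poly p \<circ> g)" "rectifiable (iA \<circ> poly p \<circ> h)"
        using g h by (auto simp: admissible_def)
      note J = curve_length_joinpaths[OF this fin]
      have "admissible p x z (g +++ h)"
        unfolding admissible_def eq
        using g h J(1) path_image_join_subset[of g h] by (auto simp: admissible_def)
      from pullback_dist_le[OF this]
      show "pullback_dist p x z - curve_length (iA \<circ> poly p \<circ> h) \<le> curve_length (iA \<circ> poly p \<circ> g)"
        using J(2) unfolding eq by linarith
    qed
    then show "pullback_dist p x z - pullback_dist p x y \<le> curve_length (iA \<circ> poly p \<circ> h)" by linarith
  qed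
  then show ?thesis by linarith
qed

text \<open>\<^const>\<open>Metric_space\<close> requires nonnegativity for all arguments, but \<^const>\<open>pullback_dist\<close> is a
  junk value \<open>Inf {}\<close> at the roots; hence the detour through a modified distance.\<close>

lemma is_completion_branched_annulus:
  "is_completion (- rts p) (pullback_dist p) (branched_annulus p) (emb p)"
proof -
  define d' where "d' = (\<lambda>x y. if x \<in> rts p \<or> y \<in> rts p then 0 else pullback_dist p x y)"
  have eq: "is_completion (- rts p) (pullback_dist p) B \<iota> = is_completion (- rts p) d' B \<iota>"
    for B :: "bpoint metric" and \<iota>
    unfolding is_completion_def by (auto simp: d'_def)
  have "Metric_space (- rts p) d'"
  proof
    show "0 \<le> d' x y" for x y by (simp add: d'_def pullback_dist_nonneg)
    show "d' x y = d' y x" for x y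
      using pullback_dist_commute_le[of x y] pullback_dist_commute_le[of y x] by (auto simp: d'_def)
    show "d' x y = 0 \<longleftrightarrow> x = y" if "x \<in> - rts p" "y \<in> - rts p" for x y
      using that pullback_dist_pos[of x y] pullback_dist_self[of x]
      by (cases "x = y") (simp_all add: d'_def)
    show "d' x z \<le> d' x y + d' y z" if "x \<in> - rts p" "y \<in> - rts p" "z \<in> - rts p" for x y z
      using that pullback_dist_triangle by (auto simp: d'_def)
  qed
  from is_completion_completion_of[OF this]
  show ?thesis unfolding branched_annulus_def emb_def completion_of_def eq .
qed

end

section \<open>Inverse branches\<close>

lemma card_roots_simple:
  fixes q :: "complex poly"
  assumes "q \<noteq> 0" "\<And>z. poly q z = 0 \<Longrightarrow> poly (pderiv q) z \<noteq> 0"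
  shows "card {z. poly q z = 0} = degree q"
proof -
  have "rsquarefree q" using assms(2) by (auto simp: rsquarefree_roots)
  then have "count (proots q) z = (if poly q z = 0 then 1 else 0)" for z
    using assms(1) by (auto simp: rsquarefree_root_order order_root)
  then have "proots q = mset_set {z. poly q z = 0}"
    using poly_roots_finite[OF assms(1)] by (intro multiset_eqI) (simp add: count_mset_set')
  then show ?thesis using size_proots_complex[of q] by simp
qed

text \<open>This turns the count of roots into simplicity. The distinct roots, taken once each,
  already exhaust the multiset of roots, so every order is 1; a common zero with the derivative
  would have order at least 2.\<close>

lemma pderiv_nz_of_card_roots:
  fixes q :: "complex poly"
  assumes "q \<noteq> 0" "card {z. poly q z = 0} = degree q" "poly q a = 0"
  shows "poly (pderiv q) a \<noteq> 0"
proof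
  assume d: "poly (pderiv q) a = 0"
  have fin: "finite {z. poly q z = 0}" by (rule poly_roots_finite[OF assms(1)])
  have sub: "mset_set {z. poly q z = 0} \<subseteq># proots q"
    by (rule mset_subset_eqI) (use assms(1) in \<open>auto simp: count_mset_set' order_root Suc_le_eq\<close>)
  have "size (mset_set {z. poly q z = 0}) = size (proots q)"
    using assms(2) by (simp add: size_proots_complex)
  then have "mset_set {z. poly q z = 0} = proots q"
    using sub by (metis mset_subset_size subset_mset.le_imp_less_or_eq less_irrefl)
  then have "order a q = 1"
    using assms(1,3) fin by (metis count_mset_set(1) count_proots mem_Collect_eq)
  moreover have "order a q \<noteq> 0" using assms(1,3) order_root by blast
  then have "order a q = Suc (order a (pderiv q))"
    using order_pderiv[of q a] by (metis assms(1) order_0I pderiv_0)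
  moreover have "pderiv q \<noteq> 0" using assms \<open>order a q \<noteq> 0\<close>
    by (metis degree_0 degree_pCons_eq_if order_degree pderiv_eq_0_iff le_zero_eq)
  then have "order a (pderiv q) \<noteq> 0" using d order_root by blast
  ultimately show False by simp
qed

locale simple_poly = nonconstant_poly +
  assumes card_rts: "card (rts p) = degree p"
begin

lemma p_nz: "p \<noteq> 0" using degree_pos by auto

lemma pderiv_nz: "pderiv p \<noteq> 0" using degree_pos by (simp add: pderiv_eq_0_iff)

lemma finite_cvl: "finite (cvl p)"
  unfolding cvl_def cpt_def by (intro finite_imageI poly_roots_finite pderiv_nz)

text \<open>Here the distinctness of the roots becomes a statement about critical values. It allows
  a disc around 0 to be joined to a sector without meeting a critical value.\<close>

lemma zero_notin_cvl: "0 \<notin> cvl p"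
  using pderiv_nz_of_card_roots[OF p_nz] card_rts by (auto simp: cvl_def cpt_def rts_def)

lemma card_fiber:
  assumes "w \<notin> cvl p" shows "card {z. poly p z = w} = degree p"
proof -
  define q where "q = p + [:-w:]"
  have "degree q = degree p" unfolding q_def using degree_pos by (intro degree_add_eq_left) simp
  moreover have "q \<noteq> 0" using calculation degree_pos by auto
  moreover have "pderiv q = pderiv p" by (simp add: q_def pderiv_add pderiv_pCons)
  ultimately have "card {z. poly q z = 0} = degree p"
    using card_roots_simple[of q] assms by (auto simp: q_def cvl_def cpt_def)
  then show ?thesis by (simp add: q_def)
qed

text \<open>Around each of the \<open>d\<close> preimages of \<open>w0\<close> the inverse function
  theorem gives a homeomorphic ball; the images are intersected to a common target \<open>T\<close>.
  Even covering also requires that nothing else lies over \<open>T\<close>, and this is a matter of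
  counting fibres.\<close>

lemma covering: "covering_space (- (poly p -` cvl p)) (poly p) (- cvl p)"
proof
  show "continuous_on (- (poly p -` cvl p)) (poly p)" by (intro continuous_intros)
  show "poly p ` (- (poly p -` cvl p)) = - cvl p"
  proof -
    have "w \<in> poly p ` (- (poly p -` cvl p))" if "w \<notin> cvl p" for w
    proof -
      have "{z. poly p z = w} \<noteq> {}" using card_fiber[OF that] degree_pos by (metis card.empty less_irrefl)
      then show ?thesis using that by auto
    qed
    then show ?thesis by auto
  qed
  fix w0 assume "w0 \<in> - cvl p"
  define Z where "Z = {z. poly p z = w0}"
  have Z: "finite Z" "card Z = degree p" "Z \<noteq> {}"
  proof -
    show "finite Z" using finite_fiber by (simp add: Z_def)
    show "card Z = degree p" using card_fiber[of w0] \<open>w0 \<in> - cvl p\<close> by (simp add: Z_def)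
    then show "Z \<noteq> {}" using degree_pos by auto
  qed
  \<comment> \<open>The factor 2 makes balls around different preimages disjoint, also when their
    radii differ.\<close>
  have "\<exists>e>0. open (poly p ` ball z e) \<and> inj_on (poly p) (ball z e) \<and> (\<forall>z'\<in>Z. z' \<noteq> z \<longrightarrow> 2 * e \<le> dist z z')"
    if "z \<in> Z" for z
  proof -
    have "poly (pderiv p) z \<noteq> 0" using that \<open>w0 \<in> - cvl p\<close> by (auto simp: Z_def cvl_def cpt_def)
    then have "deriv (poly p) z \<noteq> 0" by (simp add: DERIV_imp_deriv[OF poly_DERIV])
    moreover have "poly p holomorphic_on UNIV" by (intro holomorphic_intros)
    ultimately obtain r where r: "r > 0" "inj_on (poly p) (ball z r)"
      using has_complex_derivative_locally_invertible[of "poly p" UNIV z] by auto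
    obtain e where e: "e > 0" "\<forall>z'\<in>Z. z' \<noteq> z \<longrightarrow> e \<le> dist z z'"
      using finite_set_avoid[OF Z(1), of z] by blast
    define s where "s = min r (e / 2)"
    have inj: "inj_on (poly p) (ball z s)" using r(2) by (rule inj_on_subset) (auto simp: s_def)
    moreover have "open (poly p ` ball z s)"
      by (rule invariance_of_domain[OF _ _ inj]) (auto intro!: continuous_intros)
    moreover have "\<forall>z'\<in>Z. z' \<noteq> z \<longrightarrow> 2 * s \<le> dist z z'" using e(2) by (force simp: s_def)
    moreover have "s > 0" using r e by (simp add: s_def)
    ultimately show ?thesis by blast
  qed
  then obtain e where e: "\<And>z. z \<in> Z \<Longrightarrow> e z > 0" "\<And>z. z \<in> Z \<Longrightarrow> open (poly p ` ball z (e z))"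
    "\<And>z. z \<in> Z \<Longrightarrow> inj_on (poly p) (ball z (e z))"
    "\<And>z z'. z \<in> Z \<Longrightarrow> z' \<in> Z \<Longrightarrow> z' \<noteq> z \<Longrightarrow> 2 * e z \<le> dist z z'"
    by metis
  have disj: "ball z (e z) \<inter> ball z' (e z') = {}" if "z \<in> Z" "z' \<in> Z" "z \<noteq> z'" for z z'
  proof -
    have "e z + e z' \<le> dist z z'" using e(4)[of z z'] e(4)[of z' z] that by (simp add: dist_commute)
    then show ?thesis by (rule disjoint_ballI)
  qed
  define T where "T = (\<Inter>z\<in>Z. poly p ` ball z (e z)) - cvl p"
  define U where "U = (\<lambda>z. ball z (e z) \<inter> poly p -` T)"
  have "open T" unfolding T_def
    using Z(1) e(2) finite_cvl by (intro open_Diff open_INT finite_imp_closed) auto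
  then have openU: "open (U z)" for z
    unfolding U_def by (intro open_Int open_ball open_vimage continuous_intros)
  have UT: "poly p ` U z = T" if "z \<in> Z" for z
  proof
    show "poly p ` U z \<subseteq> T" by (auto simp: U_def)
    show "T \<subseteq> poly p ` U z"
    proof
      fix w assume w: "w \<in> T"
      then have "w \<in> poly p ` ball z (e z)" using that unfolding T_def by blast
      then show "w \<in> poly p ` U z" using w unfolding U_def by blast
    qed
  qed
  \<comment> \<open>Each of the \<open>d\<close> disjoint balls already contributes a point of the
    fibre, and \<open>card_fiber\<close> leaves no room for another.\<close>
  have fib: "\<exists>z\<in>Z. x \<in> U z" if "poly p x \<in> T" for x
  proof -
    define F where "F = {y. poly p y = poly p x}"
    have "\<forall>z\<in>Z. \<exists>y. y \<in> U z \<and> poly p y = poly p x" using UT that by (metis imageE)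
    then obtain y where y: "\<And>z. z \<in> Z \<Longrightarrow> y z \<in> U z \<and> poly p (y z) = poly p x" by metis
    have "inj_on y Z"
    proof (rule inj_onI)
      fix z z' assume "z \<in> Z" "z' \<in> Z" "y z = y z'"
      then have "y z \<in> ball z (e z) \<inter> ball z' (e z')" using y[of z] y[of z'] unfolding U_def by simp
      then show "z = z'" using disj[of z z'] \<open>z \<in> Z\<close> \<open>z' \<in> Z\<close> by blast
    qed
    then have "card (y ` Z) = degree p" using Z(2) by (simp add: card_image)
    moreover have "card F = degree p" using card_fiber[of "poly p x"] that by (simp add: F_def T_def)
    moreover have "y ` Z \<subseteq> F" using y by (auto simp: F_def)
    ultimately have "y ` Z = F" using finite_fiber by (metis F_def card_subset_eq)
    then have "x \<in> y ` Z" by (simp add: F_def)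
    then show ?thesis using y by auto
  qed
  show "\<exists>T. w0 \<in> T \<and> openin (top_of_set (- cvl p)) T \<and>
      (\<exists>v. \<Union> v = - (poly p -` cvl p) \<inter> poly p -` T \<and>
           (\<forall>u\<in>v. openin (top_of_set (- (poly p -` cvl p))) u) \<and>
           pairwise disjnt v \<and> (\<forall>u\<in>v. \<exists>q. homeomorphism u T (poly p) q))"
  proof (intro exI[of _ T] exI[of _ "U ` Z"] conjI ballI)
    show "w0 \<in> T"
    proof -
      have "w0 \<in> poly p ` ball z (e z)" if "z \<in> Z" for z
        using e(1)[OF that] that by (intro image_eqI[of _ _ z]) (auto simp: Z_def)
      then show ?thesis using \<open>w0 \<in> - cvl p\<close> by (auto simp: T_def)
    qed
    show "openin (top_of_set (- cvl p)) T"
      by (rule open_subset) (use \<open>open T\<close> in \<open>auto simp: T_def\<close>)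
    show "\<Union> (U ` Z) = - (poly p -` cvl p) \<inter> poly p -` T"
      using fib by (auto simp: U_def T_def)
    show "pairwise disjnt (U ` Z)"
      using disj by (auto simp: pairwise_image pairwise_def disjnt_def U_def)
  next
    fix u assume "u \<in> U ` Z"
    then obtain z where z: "z \<in> Z" "u = U z" by blast
    show "openin (top_of_set (- (poly p -` cvl p))) u"
      by (rule open_subset) (use z openU in \<open>auto simp: U_def T_def\<close>)
    have "inj_on (poly p) u" using e(3)[OF z(1)] by (rule inj_on_subset) (auto simp: z U_def)
    moreover have "open u" using openU z by blast
    moreover have "continuous_on u (poly p)" by (intro continuous_intros)
    ultimately obtain q where "homeomorphism u (poly p ` u) (poly p) q"
      using invariance_of_domain_homeomorphism[of u "poly p"] by blast
    then show "\<exists>q. homeomorphism u T (poly p) q" using UT z by auto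
  qed
qed

end

text \<open>Directions are compared by chordal rather than angular distance, since the chordal distance is
  what the ambient metric of the annulus bounds directly.\<close>

definition sector :: "complex \<Rightarrow> real \<Rightarrow> complex set" where
  "sector u \<delta> = {w. w \<noteq> 0 \<and> dist (sgn w) u < \<delta>}"

text \<open>The disc ties the sector to the roots: a branch is named by its value at 0, a point that
  the sector omits.\<close>

definition keyhole :: "complex \<Rightarrow> real \<Rightarrow> real \<Rightarrow> complex set" where
  "keyhole u \<delta> \<epsilon> = sector u \<delta> \<union> ball 0 \<epsilon>"

lemma continuous_on_sgn': "continuous_on (- {0}) (sgn :: complex \<Rightarrow> complex)"
  unfolding sgn_div_norm by (intro continuous_intros) auto

lemma open_sector: "open (sector u \<delta>)"
proof -
  have "sector u \<delta> = (- {0}) \<inter> sgn -` ball u \<delta>" by (auto simp: sector_def dist_commute)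
  then show ?thesis
    using continuous_on_sgn' by (simp add: continuous_on_open_vimage open_delete open_Compl Int_commute[of "- {0}"])
qed

lemma open_keyhole: "open (keyhole u \<delta> \<epsilon>)"
  by (simp add: keyhole_def open_sector open_Un)

lemma sgn_mult_pos: "r > 0 \<Longrightarrow> sgn (complex_of_real r * z) = sgn z"
  by (simp add: sgn_mult sgn_of_real)

lemma keyhole_scale:
  assumes "w \<in> keyhole u \<delta> \<epsilon>" "0 \<le> r" "r \<le> 1" "\<epsilon> > 0"
  shows "complex_of_real r * w \<in> keyhole u \<delta> \<epsilon>"
proof (cases "r = 0")
  case True then show ?thesis using assms by (simp add: keyhole_def)
next
  case False
  then have "r > 0" using assms by simp
  have "w \<in> sector u \<delta> \<Longrightarrow> complex_of_real r * w \<in> sector u \<delta>"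
    using sgn_mult_pos[OF \<open>r > 0\<close>, of w] \<open>r > 0\<close> by (auto simp: sector_def)
  moreover have "w \<in> ball 0 \<epsilon> \<Longrightarrow> complex_of_real r * w \<in> ball 0 \<epsilon>"
    using assms mult_right_mono[of r 1 "cmod w"] by (auto simp: norm_mult)
  ultimately show ?thesis using assms(1) by (auto simp: keyhole_def)
qed

text \<open>Segments to 0 stay inside, which yields the simple connectivity that lifting requires; a
  sector with a disc attached is in general not convex.\<close>

lemma starlike_keyhole:
  assumes "\<epsilon> > 0" shows "starlike (keyhole u \<delta> \<epsilon>)"
  unfolding starlike_def
proof (intro bexI ballI)
  show "0 \<in> keyhole u \<delta> \<epsilon>" using assms by (simp add: keyhole_def)
  fix w assume w: "w \<in> keyhole u \<delta> \<epsilon>"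
  show "closed_segment 0 w \<subseteq> keyhole u \<delta> \<epsilon>"
    using keyhole_scale[OF w _ _ assms] by (auto simp: in_segment scaleR_conv_of_real)
qed

lemma dist_cis_le: "dist (cis x) (cis y) \<le> \<bar>x - y\<bar>"
proof -
  have "cis x - cis y = cis y * (cis (x - y) - 1)" by (simp add: algebra_simps cis_mult)
  then have "norm (cis x - cis y) = norm (cis (x - y) - 1)" by (simp add: norm_mult)
  also have "\<dots> \<le> \<bar>x - y\<bar>"
    using dist_exp_i_1[of "x - y"] abs_sin_x_le_abs_x[of "(x - y) / 2"] by (simp add: cis_conv_exp)
  finally show ?thesis by (simp add: dist_norm)
qed

lemma convex_Ioo_path: "t \<in> {-1<..<1::real} \<Longrightarrow> t' \<in> {-1<..<1} \<Longrightarrow> s \<in> {0..1} \<Longrightarrow> t + s * (t' - t) \<in> {-1<..<1}"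
proof -
  assume a: "t \<in> {-1<..<1::real}" "t' \<in> {-1<..<1}" "s \<in> {0..1}"
  have "(1 - s) *\<^sub>R t + s *\<^sub>R t' \<in> {-1<..<1}"
    by (rule convexD) (use a in auto)
  then show ?thesis by (simp add: algebra_simps)
qed

text \<open>Later arguments see the covering only through these properties. As a locale they can be
  instantiated for several nearby directions with one and the same family \<open>g\<close>, and the
  local constancy of the orderings relies on this.\<close>

locale branches = simple_poly +
  fixes u :: complex and \<delta> \<epsilon> :: real and g :: "complex \<Rightarrow> complex \<Rightarrow> complex"
  assumes norm_u: "norm u = 1" and delta_pos: "0 < \<delta>" and eps_pos: "0 < \<epsilon>"
    and g_cont: "\<And>a. a \<in> rts p \<Longrightarrow> continuous_on (keyhole u \<delta> \<epsilon>) (g a)"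
    and g_inv: "\<And>a w. a \<in> rts p \<Longrightarrow> w \<in> keyhole u \<delta> \<epsilon> \<Longrightarrow> poly p (g a w) = w"
    and g_0: "\<And>a. a \<in> rts p \<Longrightarrow> g a 0 = a"
    and g_inj: "\<And>a b w. a \<in> rts p \<Longrightarrow> b \<in> rts p \<Longrightarrow> w \<in> keyhole u \<delta> \<epsilon> \<Longrightarrow> g a w = g b w \<Longrightarrow> a = b"
    and g_surj: "\<And>z. poly p z \<in> keyhole u \<delta> \<epsilon> \<Longrightarrow> \<exists>a\<in>rts p. z = g a (poly p z)"

context simple_poly
begin

lemma regular_Dir_iff:
  assumes "norm u = 1" shows "regular_Dir p u \<longleftrightarrow> u \<notin> sgn ` cvl p"
proof -
  have "iA v \<in> {u} \<times> {-1..1} \<longleftrightarrow> u = sgn v" if "v \<in> cvl p" for v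
    using height_bounds[of "cmod v"] by (auto simp: iA_eq)
  moreover have "regular_Dir p u \<longleftrightarrow> (\<forall>v\<in>cvl p. iA v \<notin> {u} \<times> {-1..1})"
  proof
    assume *: "regular_Dir p u"
    show "\<forall>v\<in>cvl p. iA v \<notin> {u} \<times> {-1..1}"
    proof
      fix v assume "v \<in> cvl p"
      then have "iA v \<in> iA ` cvl p" by (rule imageI)
      with * show "iA v \<notin> {u} \<times> {-1..1}" unfolding regular_Dir_def by (metis IntI empty_iff)
    qed
  next
    assume *: "\<forall>v\<in>cvl p. iA v \<notin> {u} \<times> {-1..1}"
    show "regular_Dir p u" unfolding regular_Dir_def
    proof (rule equals0I)
      fix x assume "x \<in> {u} \<times> {-1..1} \<inter> iA ` cvl p"
      then obtain v where "v \<in> cvl p" "x = iA v" "x \<in> {u} \<times> {-1..1}" by blast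
      with * show False by metis
    qed
  qed
  ultimately show ?thesis by (simp add: image_iff)
qed

lemma branches_exist:
  assumes "norm u = 1" "regular_Dir p u"
  obtains \<delta> \<epsilon> g where "branches p u \<delta> \<epsilon> g"
proof -
  have "finite (insert u (sgn ` cvl p))" using finite_cvl by simp
  \<comment> \<open>The two margins exclude all critical values: \<delta> keeps the sector away from
    their directions, \<epsilon> keeps the disc below their moduli.\<close>
  then obtain \<delta> where \<delta>: "\<delta> > 0" "\<forall>v\<in>insert u (sgn ` cvl p). v \<noteq> u \<longrightarrow> \<delta> \<le> dist u v"
    using finite_set_avoid by blast
  obtain \<epsilon> where \<epsilon>: "\<epsilon> > 0" "\<forall>v\<in>cvl p. v \<noteq> 0 \<longrightarrow> \<epsilon> \<le> dist 0 v"
    using finite_set_avoid[OF finite_cvl] by blast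
  let ?K = "keyhole u \<delta> \<epsilon>"
  have K: "?K \<subseteq> - cvl p"
  proof
    fix w assume w: "w \<in> ?K"
    have "False" if "w \<in> cvl p"
    proof -
      have "w \<noteq> 0" using that zero_notin_cvl by blast
      moreover have "sgn w \<noteq> u" using that assms regular_Dir_iff by blast
      ultimately show False using w \<delta>(2) \<epsilon>(2) that by (auto simp: keyhole_def sector_def dist_commute)
    qed
    then show "w \<in> - cvl p" by blast
  qed
  have "0 \<in> ?K" using \<epsilon>(1) by (simp add: keyhole_def)
  have sc: "simply_connected ?K" by (intro starlike_imp_simply_connected starlike_keyhole \<epsilon>)
  have lpc: "locally path_connected ?K" by (intro open_imp_locally_path_connected open_keyhole)
  have "\<exists>h. continuous_on ?K h \<and> h \<in> ?K \<rightarrow> - (poly p -` cvl p) \<and> h 0 = a \<and> (\<forall>w\<in>?K. poly p (h w) = w)"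
    if "a \<in> rts p" for a
  proof -
    have pa: "poly p a = 0" using that by (simp add: rts_def)
    then have "a \<in> - (poly p -` cvl p)" using zero_notin_cvl by simp
    moreover have "(\<lambda>w. w) \<in> ?K \<rightarrow> - cvl p" using K by auto
    ultimately obtain h where "continuous_on ?K h" "h \<in> ?K \<rightarrow> - (poly p -` cvl p)" "h 0 = a"
      "\<And>w. w \<in> ?K \<Longrightarrow> poly p (h w) = w"
      by (rule covering_space_lift_strong[OF covering _ \<open>0 \<in> ?K\<close> sc lpc continuous_on_id])
         (use pa in auto)
    then show ?thesis by blast
  qed
  then obtain g where g: "\<And>a. a \<in> rts p \<Longrightarrow> continuous_on ?K (g a)"
    "\<And>a. a \<in> rts p \<Longrightarrow> g a \<in> ?K \<rightarrow> - (poly p -` cvl p)" "\<And>a. a \<in> rts p \<Longrightarrow> g a 0 = a"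
    "\<And>a w. a \<in> rts p \<Longrightarrow> w \<in> ?K \<Longrightarrow> poly p (g a w) = w"
    by metis
  \<comment> \<open>Two lifts of the inclusion that agree at one point agree on the whole connected
    keyhole, hence at 0, where their values are \<open>a\<close> and \<open>b\<close>.\<close>
  have inj: "a = b" if "a \<in> rts p" "b \<in> rts p" "w \<in> ?K" "g a w = g b w" for a b w
  proof -
    have "connected ?K" using sc by (rule simply_connected_imp_connected)
    have "g a 0 = g b 0"
    proof (rule covering_space_lift_unique[OF covering, of "g a" w "g b" ?K "\<lambda>w. w" 0])
      show "connected ?K" "w \<in> ?K" "0 \<in> ?K" "g a w = g b w" by fact+
      show "continuous_on ?K (\<lambda>w. w)" "(\<lambda>w. w) \<in> ?K \<rightarrow> - cvl p"
        using K by (auto intro: continuous_on_id)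
    qed (use g(1,2,4) that(1,2) in simp_all)
    then show "a = b" using g(3) that by simp
  qed
  \<comment> \<open>The branches take \<open>d\<close> distinct values in a fibre of
    \<open>d\<close> points and so exhaust it.\<close>
  have surj: "\<exists>a\<in>rts p. z = g a (poly p z)" if "poly p z \<in> ?K" for z
  proof -
    define F where "F = {y. poly p y = poly p z}"
    have "inj_on (\<lambda>a. g a (poly p z)) (rts p)" using inj that by (auto intro!: inj_onI)
    then have "card ((\<lambda>a. g a (poly p z)) ` rts p) = card F"
      using K that card_fiber[of "poly p z"] card_rts by (auto simp: card_image F_def)
    moreover have "(\<lambda>a. g a (poly p z)) ` rts p \<subseteq> F" using g(4) that by (auto simp: F_def)
    ultimately have "(\<lambda>a. g a (poly p z)) ` rts p = F"
      using finite_fiber by (metis F_def card_subset_eq)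
    then show ?thesis by (auto simp: F_def)
  qed
  have "branches p u \<delta> \<epsilon> g"
    by unfold_locales (use assms \<delta> \<epsilon> g inj surj in auto)
  then show ?thesis by (rule that)
qed

end

lemma sector_mono: "sector v (\<delta> - dist u v) \<subseteq> sector u \<delta>"
proof
  fix w assume "w \<in> sector v (\<delta> - dist u v)"
  then show "w \<in> sector u \<delta>" using dist_triangle[of "sgn w" u v] by (simp add: sector_def dist_commute)
qed

text \<open>The smaller sector around \<open>v\<close> lies in the sector around \<open>u\<close>,
  so the same functions serve. The sheets for the two directions thereby carry the same names, and
  the roots read along them can be compared.\<close>

lemma branches_shift:
  assumes "branches p u \<delta> \<epsilon> g" "norm v = 1" "dist u v < \<delta>"
  shows "branches p v (\<delta> - dist u v) \<epsilon> g"
proof -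
  interpret branches p u \<delta> \<epsilon> g by fact
  have sub: "keyhole v (\<delta> - dist u v) \<epsilon> \<subseteq> keyhole u \<delta> \<epsilon>"
    using sector_mono by (auto simp: keyhole_def)
  show ?thesis
  proof unfold_locales
    show "continuous_on (keyhole v (\<delta> - dist u v) \<epsilon>) (g a)" if "a \<in> rts p" for a
      using g_cont[OF that] sub by (rule continuous_on_subset)
    show "\<exists>a\<in>rts p. z = g a (poly p z)" if "poly p z \<in> keyhole v (\<delta> - dist u v) \<epsilon>" for z
      using g_surj sub that by blast
    show "a = b" if "a \<in> rts p" "b \<in> rts p" "w \<in> keyhole v (\<delta> - dist u v) \<epsilon>" "g a w = g b w" for a b w
      using g_inj[OF that(1,2) _ that(4)] sub that(3) by blast
    show "poly p (g a w) = w" if "a \<in> rts p" "w \<in> keyhole v (\<delta> - dist u v) \<epsilon>" for a w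
      using g_inv[OF that(1)] sub that(2) by blast
  qed (use assms eps_pos g_0 in auto)
qed

section \<open>Sheets and lifted rays over a regular direction\<close>

context branches
begin

abbreviation "Sec \<equiv> sector u \<delta>"

definition sheet :: "complex \<Rightarrow> complex set" where
  "sheet a = g a ` Sec"

text \<open>The lift of the ray in direction \<open>u\<close>, parametrised by height rather than by
  modulus: its image in the annulus is \<open>(u, t)\<close>, so it is 1-Lipschitz for the pullback
  metric.\<close>

definition arc_pt :: "complex \<Rightarrow> real \<Rightarrow> complex" where
  "arc_pt a t = g a (complex_of_real (radius t) * u)"

lemma sector_keyhole: "Sec \<subseteq> keyhole u \<delta> \<epsilon>"
  by (auto simp: keyhole_def)

lemma g_cont_sec: "a \<in> rts p \<Longrightarrow> continuous_on Sec (g a)"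
  using g_cont sector_keyhole continuous_on_subset by blast

lemma g_inv_sec: "a \<in> rts p \<Longrightarrow> w \<in> Sec \<Longrightarrow> poly p (g a w) = w"
  using g_inv sector_keyhole by blast

lemma sgn_u: "sgn u = u"
  using norm_u by (simp add: sgn_div_norm)

lemma u_nz: "u \<noteq> 0" using norm_u by auto

lemma ray_in_sector: "r > 0 \<Longrightarrow> complex_of_real r * u \<in> Sec"
  using sgn_mult_pos[of r u] delta_pos u_nz sgn_u by (auto simp: sector_def)

lemma ray_in_keyhole: "r \<ge> 0 \<Longrightarrow> complex_of_real r * u \<in> keyhole u \<delta> \<epsilon>"
  using ray_in_sector[of r] eps_pos by (cases "r = 0") (auto simp: keyhole_def)

lemma sheetD:
  assumes "z \<in> sheet a" "a \<in> rts p"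
  shows "poly p z \<in> Sec" "z = g a (poly p z)" "z \<notin> rts p"
proof -
  obtain w where w: "w \<in> Sec" "z = g a w" using assms(1) by (auto simp: sheet_def)
  then have "poly p z = w" using g_inv_sec assms(2) by simp
  with w show "poly p z \<in> Sec" "z = g a (poly p z)" "z \<notin> rts p"
    by (auto simp: sector_def rts_def)
qed

lemma sheets_cover: "poly p z \<in> Sec \<Longrightarrow> \<exists>a\<in>rts p. z \<in> sheet a"
  using g_surj[of z] sector_keyhole by (auto simp: sheet_def)

lemma open_branch_image:
  assumes "a \<in> rts p" "S \<subseteq> keyhole u \<delta> \<epsilon>" "open S"
  shows "open (g a ` S)"
proof (rule invariance_of_domain)
  show "continuous_on S (g a)" using g_cont[OF assms(1)] assms(2) by (rule continuous_on_subset)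
  show "inj_on (g a) S" by (rule inj_on_inverseI[where g = "poly p"]) (use assms g_inv in blast)
qed fact

lemma open_sheet: "a \<in> rts p \<Longrightarrow> open (sheet a)"
  unfolding sheet_def by (rule open_branch_image[OF _ sector_keyhole open_sector])

lemma sheets_disjoint:
  assumes "a \<in> rts p" "b \<in> rts p" "z \<in> sheet a" "z \<in> sheet b" shows "a = b"
  using g_inj[of a b "poly p z"] sheetD[OF assms(3,1)] sheetD[OF assms(4,2)] sector_keyhole assms
  by (metis subsetD)

lemma connected_in_one_sheet:
  assumes "connected C" "\<And>z. z \<in> C \<Longrightarrow> poly p z \<in> Sec" "a \<in> rts p" "b \<in> rts p"
    "C \<inter> sheet a \<noteq> {}" "C \<inter> sheet b \<noteq> {}"
  shows "a = b"
proof (rule ccontr)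
  assume "a \<noteq> b"
  let ?V = "\<Union>c\<in>rts p - {a}. sheet c"
  have "open ?V" using open_sheet by blast
  moreover have "sheet a \<inter> ?V \<inter> C = {}" using sheets_disjoint[OF assms(3)] by blast
  moreover have "C \<subseteq> sheet a \<union> ?V" using assms(2) sheets_cover by blast
  ultimately show False
    using connectedD[OF assms(1) open_sheet[OF assms(3)], of ?V] assms(4-6) \<open>a \<noteq> b\<close> by blast
qed

text \<open>Only the direction of \<open>z\<close> enters the bound. As \<open>z\<close> approaches
  \<open>Dir p u\<close> the subtracted term tends to 0, which leaves the full separation \<delta>
  for boundary points.\<close>

lemma sheet_separation:
  assumes "a \<in> rts p" "b \<in> rts p" "a \<noteq> b" "z \<in> sheet a" "z' \<in> sheet b"
  shows "\<delta> - dist (sgn (poly p z)) u \<le> pullback_dist p z z'"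
proof (rule pullback_dist_ge)
  show "z \<notin> rts p" "z' \<notin> rts p" using sheetD assms by blast+
  fix \<gamma> assume adm: "admissible p z z' \<gamma>"
  then have C: "connected (path_image \<gamma>)" "z \<in> path_image \<gamma>" "z' \<in> path_image \<gamma>"
    by (auto simp: admissible_def connected_path_image)
  have "\<exists>y\<in>path_image \<gamma>. poly p y \<notin> Sec"
    using connected_in_one_sheet[OF C(1) _ assms(1,2)] C assms(3-5) by blast
  then obtain s where s: "s \<in> {0..1}" "poly p (\<gamma> s) \<notin> Sec" by (auto simp: path_image_def)
  have "\<gamma> s \<notin> rts p" using admissibleD(1)[OF adm s(1)] .
  then have "\<delta> \<le> dist (sgn (poly p (\<gamma> s))) u" using s(2) by (auto simp: sector_def rts_def)
  moreover have "dist (sgn (poly p z)) (sgn (poly p (\<gamma> s))) \<le> curve_length (iA \<circ> poly p \<circ> \<gamma>)"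
    using dist_sgn_le_iA admissibleD(2)[OF adm s(1)] order_trans by blast
  moreover have "dist (sgn (poly p (\<gamma> s))) u \<le> dist (sgn (poly p z)) (sgn (poly p (\<gamma> s))) + dist (sgn (poly p z)) u"
    by (metis dist_triangle dist_commute)
  ultimately show "\<delta> - dist (sgn (poly p z)) u \<le> curve_length (iA \<circ> poly p \<circ> \<gamma>)" by linarith
qed

text \<open>Upper bounds are reduced to curves in the sector. Since \<open>p\<close> undoes the
  branch, the length of the lifted curve is read off in the annulus, without any estimate of the
  branch itself.\<close>

lemma dist_along_branch:
  assumes "a \<in> rts p" "continuous_on {0..1::real} w" "w ` {0..1} \<subseteq> Sec" "L-lipschitz_on {0..1} (iA \<circ> w)"
  shows "pullback_dist p (g a (w 0)) (g a (w 1)) \<le> L"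
proof -
  let ?\<gamma> = "g a \<circ> w"
  have "path ?\<gamma>" unfolding path_def
    by (intro continuous_on_compose assms(2) continuous_on_subset[OF g_cont_sec[OF assms(1)] assms(3)])
  moreover have "path_image ?\<gamma> \<subseteq> - rts p"
    using sheetD(3) assms(1,3) by (fastforce simp: path_image_def sheet_def)
  moreover have "L-lipschitz_on {0..1} (iA \<circ> poly p \<circ> ?\<gamma>)"
  proof (rule lipschitz_on_transform[OF assms(4)])
    fix s :: real assume "s \<in> {0..1}"
    then have "w s \<in> Sec" using assms(3) by blast
    then show "(iA \<circ> poly p \<circ> ?\<gamma>) s = (iA \<circ> w) s" using g_inv_sec[OF assms(1), of "w s"] by simp
  qed
  ultimately show ?thesis using admissible_lipschitz(2)[of ?\<gamma> p L] by simp
qed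

lemma iA_ray: "t \<in> {-1<..<1} \<Longrightarrow> iA (complex_of_real (radius t) * u) = (u, t)"
  using radius_pos[of t] sgn_mult_pos[of "radius t" u] height_radius[of t]
  by (simp add: iA_eq sgn_u norm_mult norm_u)

lemma dist_arc_pt:
  assumes "a \<in> rts p" "t \<in> {-1<..<1}" "t' \<in> {-1<..<1}"
  shows "pullback_dist p (arc_pt a t) (arc_pt a t') \<le> \<bar>t - t'\<bar>"
proof -
  define \<tau> where "\<tau> = (\<lambda>s. t + s * (t' - t))"
  have \<tau>: "\<tau> s \<in> {-1<..<1}" if "s \<in> {0..1}" for s
    unfolding \<tau>_def using convex_Ioo_path assms(2,3) that by blast
  define w where "w = (\<lambda>s. complex_of_real (radius (\<tau> s)) * u)"
  have "pullback_dist p (g a (w 0)) (g a (w 1)) \<le> \<bar>t - t'\<bar>"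
  proof (rule dist_along_branch[OF assms(1)])
    show "continuous_on {0..1} w" unfolding w_def
      by (intro continuous_intros continuous_on_compose2[OF continuous_on_radius])
         (use \<tau> in \<open>auto simp: \<tau>_def intro!: continuous_intros\<close>)
    show "w ` {0..1} \<subseteq> Sec" using \<tau> radius_pos ray_in_sector by (auto simp: w_def)
    have "\<bar>t - t'\<bar>-lipschitz_on {0..1} (\<lambda>s. (u, \<tau> s))"
    proof (rule lipschitz_onI)
      fix x y :: real
      have "\<tau> x - \<tau> y = (t' - t) * (x - y)" by (simp add: \<tau>_def algebra_simps)
      then show "dist (u, \<tau> x) (u, \<tau> y) \<le> \<bar>t - t'\<bar> * dist x y"
        by (simp add: dist_Pair_Pair dist_real_def abs_mult abs_minus_commute)
    qed simp
    then show "\<bar>t - t'\<bar>-lipschitz_on {0..1} (iA \<circ> w)"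
      by (rule lipschitz_on_transform) (use \<tau> iA_ray in \<open>simp add: w_def\<close>)
  qed
  then show ?thesis by (simp add: w_def \<tau>_def arc_pt_def)
qed

lemma arc_pt_sheet: "t \<in> {-1<..<1} \<Longrightarrow> arc_pt a t \<in> sheet a"
  using radius_pos ray_in_sector by (auto simp: arc_pt_def sheet_def)

lemma poly_arc_pt: "a \<in> rts p \<Longrightarrow> t \<in> {-1<..<1} \<Longrightarrow> poly p (arc_pt a t) = complex_of_real (radius t) * u"
  unfolding arc_pt_def using radius_pos[of t] ray_in_sector g_inv_sec by blast

end

section \<open>The behaviour at infinity\<close>

context nonconstant_poly
begin

text \<open>The direction of the leading term of \<open>p\<close> on the ray at angle \<theta>. It
  turns out to be \<open>dir_at p \<theta>\<close>, in a form that can be computed with.\<close>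

definition asymp_dir :: "real \<Rightarrow> complex" where
  "asymp_dir \<theta> = sgn (lead_coeff p) * cis (real (degree p) * \<theta>)"

text \<open>Polar coordinates centred at infinity: \<open>q\<close> is the reciprocal of the
  modulus, so the circle at infinity corresponds to the missing value \<open>q = 0\<close>.\<close>

definition far_pt :: "real \<Rightarrow> real \<Rightarrow> complex" where
  "far_pt q \<psi> = cis \<psi> / complex_of_real q"

lemma lc_nz: "lead_coeff p \<noteq> 0" using degree_pos by auto

lemma norm_sgn_lc: "norm (sgn (lead_coeff p)) = 1" using lc_nz by (simp add: norm_sgn)

lemma norm_asymp_dir: "norm (asymp_dir \<theta>) = 1"
  using norm_sgn_lc by (simp add: asymp_dir_def norm_mult)

text \<open>This splits \<open>p\<close> near infinity into a pure power and a factor that extends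
  to infinity with the nonzero value \<open>lead_coeff p\<close>.\<close>

lemma poly_reflect_inverse:
  assumes "z \<noteq> 0" shows "poly p z = poly (reflect_poly p) (inverse z) * z ^ degree p"
  using poly_reflect_poly_nz[of "inverse z" p] assms by (simp add: power_inverse)

lemma sgn_power: "sgn (z ^ n) = sgn z ^ n" for z :: complex
  by (induction n) (auto simp: sgn_mult)

lemma sgn_poly_eq:
  assumes "z \<noteq> 0" shows "sgn (poly p z) = sgn (poly (reflect_poly p) (inverse z)) * sgn z ^ degree p"
  by (subst poly_reflect_inverse[OF assms]) (simp add: sgn_mult sgn_power)

lemma reflect_tendsto: "((\<lambda>z. poly (reflect_poly p) (inverse z)) \<longlongrightarrow> lead_coeff p) at_infinity"
proof -
  have "((\<lambda>z. poly (reflect_poly p) (inverse z)) \<longlongrightarrow> poly (reflect_poly p) 0) at_infinity"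
    by (intro tendsto_intros tendsto_inverse_0)
  then show ?thesis by simp
qed

lemma sgn_reflect_tendsto:
  "((\<lambda>z. sgn (poly (reflect_poly p) (inverse z))) \<longlongrightarrow> sgn (lead_coeff p)) at_infinity"
  by (rule tendsto_sgn[OF reflect_tendsto lc_nz])

lemma asymp_dir_tendsto:
  "((\<lambda>r. sgn (poly p (complex_of_real r * cis \<theta>))) \<longlongrightarrow> asymp_dir \<theta>) at_top"
proof -
  have lim: "filterlim (\<lambda>r. complex_of_real r * cis \<theta>) at_infinity at_top"
  proof (rule filterlim_norm_at_top_imp_at_infinity)
    have "\<forall>\<^sub>F r in at_top. norm (complex_of_real r * cis \<theta>) = r"
      using eventually_ge_at_top[of 0] by eventually_elim (simp add: norm_mult)
    then show "filterlim (\<lambda>r. norm (complex_of_real r * cis \<theta>)) at_top at_top"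
      by (subst filterlim_cong[OF refl refl]) (auto simp: filterlim_ident)
  qed
  have "((\<lambda>r. sgn (poly (reflect_poly p) (inverse (complex_of_real r * cis \<theta>))) * cis \<theta> ^ degree p)
      \<longlongrightarrow> sgn (lead_coeff p) * cis \<theta> ^ degree p) at_top"
    by (intro tendsto_intros filterlim_compose[OF sgn_reflect_tendsto lim])
  moreover have "\<forall>\<^sub>F r in at_top. sgn (poly (reflect_poly p) (inverse (complex_of_real r * cis \<theta>))) * cis \<theta> ^ degree p
      = sgn (poly p (complex_of_real r * cis \<theta>))"
    using eventually_gt_at_top[of 0]
  proof eventually_elim
    case (elim r)
    then have "sgn (complex_of_real r * cis \<theta>) = cis \<theta>"
      using sgn_mult_pos[of r "cis \<theta>"] by (simp add: sgn_div_norm)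
    then show ?case using sgn_poly_eq[of "complex_of_real r * cis \<theta>"] elim by simp
  qed
  ultimately show ?thesis
    by (auto simp: asymp_dir_def Complex.DeMoivre mult.commute elim: Lim_transform_eventually)
qed

text \<open>In polar coordinates at infinity the circle coordinate of
  \<open>iA \<circ> poly p\<close> is a rotation by \<open>degree p * \<psi>\<close> times a factor
  that is regular at infinity, and its height is minus the height of \<open>1 / p\<close>. Both are
  Lipschitz in \<open>(q, \<psi>)\<close>, with one constant valid up to the boundary.\<close>

lemma near_infinity:
  obtains q0 C where "0 < q0" "0 < C"
    "\<And>q \<psi>. 0 < q \<Longrightarrow> q \<le> q0 \<Longrightarrow> far_pt q \<psi> \<notin> rts p"
    "\<And>q q' \<psi> \<psi>'. 0 < q \<Longrightarrow> q \<le> q0 \<Longrightarrow> 0 < q' \<Longrightarrow> q' \<le> q0 \<Longrightarrow>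
       pullback_dist p (far_pt q \<psi>) (far_pt q' \<psi>') \<le> C * (\<bar>q - q'\<bar> + \<bar>\<psi> - \<psi>'\<bar>)"
proof -
  let ?P = "poly (reflect_poly p)"
  let ?d = "degree p"
  define m where "m = norm (lead_coeff p) / 2"
  have m: "m > 0" using lc_nz by (simp add: m_def)
  have "isCont ?P 0" by simp
  then obtain e where e: "e > 0" "\<And>\<zeta>. dist \<zeta> 0 < e \<Longrightarrow> dist (?P \<zeta>) (?P 0) < m"
    using m by (auto simp: continuous_at_eps_delta dist_commute)
  have Pm: "m \<le> norm (?P \<zeta>)" if "\<zeta> \<in> ball 0 e" for \<zeta>
  proof -
    have "dist (?P \<zeta>) (lead_coeff p) < m" using e(2)[of \<zeta>] that by (simp add: dist_commute)
    moreover have "norm (lead_coeff p) = 2 * m" by (simp add: m_def)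
    moreover have "norm (lead_coeff p) \<le> norm (?P \<zeta>) + dist (?P \<zeta>) (lead_coeff p)"
      using norm_triangle_ineq2[of "lead_coeff p" "?P \<zeta>"] by (simp add: dist_norm norm_minus_commute)
    ultimately show ?thesis by linarith
  qed
  \<comment> \<open>The bound 1 absorbs the factor \<open>q'\<close> in front of the difference of
    angles; \<open>e / 2\<close> keeps the closed disc inside the region where the reflected
    polynomial is bounded away from 0.\<close>
  define q0 where "q0 = min 1 (e / 2)"
  have q0: "0 < q0" "q0 \<le> 1" "q0 < e" using e by (auto simp: q0_def)
  \<comment> \<open>In the coordinate \<open>\<zeta> = 1 / z\<close> this is \<open>1 / p\<close>,
    which is holomorphic near infinity.\<close>
  define Q where "Q = (\<lambda>\<zeta>. \<zeta> ^ ?d / ?P \<zeta>)"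
  have sub: "cball 0 q0 \<subseteq> ball (0::complex) e" using q0 by auto
  have Pnz: "?P \<zeta> \<noteq> 0" if "\<zeta> \<in> ball 0 e" for \<zeta> using Pm[OF that] m by auto
  obtain L1 where L1: "L1-lipschitz_on (cball 0 q0) ?P"
    by (rule holomorphic_imp_lipschitz[of ?P UNIV "cball 0 q0"]) (auto intro!: holomorphic_intros)
  have "Q holomorphic_on ball 0 e" unfolding Q_def by (intro holomorphic_intros Pnz)
  then obtain L2 where L2: "L2-lipschitz_on (cball 0 q0) Q"
    by (rule holomorphic_imp_lipschitz[of Q "ball 0 e" "cball 0 q0"]) (use sub in auto)
  \<comment> \<open>One term for each source of variation: the sign of the reflected polynomial, the
    height of \<open>1 / p\<close>, and the rotation by \<open>degree p * \<psi>\<close>. The last 1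
    secures positivity.\<close>
  define C where "C = 2 / m * L1 + 2 * L2 + real ?d + 1"
  have L_nn: "0 \<le> L1" "0 \<le> L2" using L1 L2 lipschitz_on_nonneg by blast+
  then have "C > 0" using m by (simp add: C_def add_nonneg_pos)
  define \<zeta> where "\<zeta> = (\<lambda>q \<psi>. complex_of_real q * cis (- \<psi>))"
  have \<zeta>_inv: "inverse (\<zeta> q \<psi>) = far_pt q \<psi>" for q \<psi>
    by (simp add: \<zeta>_def far_pt_def divide_inverse cis_inverse mult.commute)
  have \<zeta>_in: "\<zeta> q \<psi> \<in> cball 0 q0" if "0 < q" "q \<le> q0" for q \<psi>
    using that by (simp add: \<zeta>_def norm_mult)
  have \<zeta>_in': "\<zeta> q \<psi> \<in> ball 0 e" if "0 < q" "q \<le> q0" for q \<psi>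
    using \<zeta>_in[OF that] sub by blast
  have \<zeta>_nz: "\<zeta> q \<psi> \<noteq> 0" if "0 < q" for q \<psi> using that by (simp add: \<zeta>_def)
  have p_eq: "poly p (far_pt q \<psi>) = inverse (Q (\<zeta> q \<psi>))" if "0 < q" for q \<psi>
    using poly_reflect_inverse[of "far_pt q \<psi>"] \<zeta>_nz[OF that, of \<psi>]
    by (simp add: \<zeta>_inv[symmetric] Q_def divide_inverse power_inverse)
  have Qnz: "Q (\<zeta> q \<psi>) \<noteq> 0" if "0 < q" "q \<le> q0" for q \<psi>
    using \<zeta>_nz[OF that(1)] Pnz[OF \<zeta>_in'[OF that]] by (simp add: Q_def)
  have iA_p: "iA (poly p (far_pt q \<psi>)) = (sgn (?P (\<zeta> q \<psi>)) * cis (real ?d * \<psi>), - height (cmod (Q (\<zeta> q \<psi>))))"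
    if "0 < q" "q \<le> q0" for q \<psi>
  proof -
    have "far_pt q \<psi> \<noteq> 0" using that by (simp add: far_pt_def)
    moreover have "sgn (far_pt q \<psi>) = cis \<psi>"
      using that sgn_mult_pos[of "inverse q" "cis \<psi>"]
      by (simp add: far_pt_def divide_inverse mult.commute sgn_div_norm)
    moreover have "inverse (far_pt q \<psi>) = \<zeta> q \<psi>" by (simp flip: \<zeta>_inv)
    ultimately have "sgn (poly p (far_pt q \<psi>)) = sgn (?P (\<zeta> q \<psi>)) * cis (real ?d * \<psi>)"
      using sgn_poly_eq[of "far_pt q \<psi>"] Complex.DeMoivre[of \<psi> ?d] by simp
    moreover have "height (cmod (poly p (far_pt q \<psi>))) = - height (cmod (Q (\<zeta> q \<psi>)))"
      using p_eq[OF that(1)] Qnz[OF that] height_inverse by (simp add: norm_inverse)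
    ultimately show ?thesis by (simp add: iA_eq)
  qed
  have \<zeta>_dist: "dist (\<zeta> q \<psi>) (\<zeta> q' \<psi>') \<le> \<bar>q - q'\<bar> + \<bar>\<psi> - \<psi>'\<bar>"
    if "0 < q" "q \<le> q0" "0 < q'" "q' \<le> q0" for q q' \<psi> \<psi>'
  proof -
    have "\<zeta> q \<psi> - \<zeta> q' \<psi>' = complex_of_real (q - q') * cis (- \<psi>) + complex_of_real q' * (cis (- \<psi>) - cis (- \<psi>'))"
      by (simp add: \<zeta>_def algebra_simps)
    then have "norm (\<zeta> q \<psi> - \<zeta> q' \<psi>') \<le> \<bar>q - q'\<bar> + q' * norm (cis (- \<psi>) - cis (- \<psi>'))"
      using norm_triangle_ineq[of "complex_of_real (q - q') * cis (- \<psi>)"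
        "complex_of_real q' * (cis (- \<psi>) - cis (- \<psi>'))"] that by (simp add: norm_mult del: of_real_diff)
    also have "q' * norm (cis (- \<psi>) - cis (- \<psi>')) \<le> 1 * \<bar>\<psi> - \<psi>'\<bar>"
      using that q0 dist_cis_le[of "-\<psi>" "-\<psi>'"] by (intro mult_mono) (auto simp: dist_norm)
    finally show ?thesis by (simp add: dist_norm)
  qed
  have G: "dist (iA (poly p (far_pt q \<psi>))) (iA (poly p (far_pt q' \<psi>'))) \<le> C * (\<bar>q - q'\<bar> + \<bar>\<psi> - \<psi>'\<bar>)"
    if qq: "0 < q" "q \<le> q0" "0 < q'" "q' \<le> q0" for q q' \<psi> \<psi>'
  proof -
    define D where "D = \<bar>q - q'\<bar> + \<bar>\<psi> - \<psi>'\<bar>"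
    define x where "x = \<zeta> q \<psi>"
    define y where "y = \<zeta> q' \<psi>'"
    have xy: "x \<in> cball 0 q0" "y \<in> cball 0 q0" using \<zeta>_in qq by (auto simp: x_def y_def)
    have dxy: "dist x y \<le> D" using \<zeta>_dist[OF qq] by (simp add: x_def y_def D_def)
    have "dist (sgn (?P x)) (sgn (?P y)) \<le> 2 / m * dist (?P x) (?P y)"
      using Pm sub xy by (intro dist_sgn_le m) auto
    also have "\<dots> \<le> 2 / m * (L1 * D)"
      using lipschitz_onD[OF L1 xy] mult_left_mono[OF dxy L_nn(1)] m by (intro mult_left_mono) auto
    finally have 1: "dist (sgn (?P x)) (sgn (?P y)) \<le> 2 / m * (L1 * D)" .
    have 2: "dist (cis (real ?d * \<psi>)) (cis (real ?d * \<psi>')) \<le> real ?d * D"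
    proof -
      have "dist (cis (real ?d * \<psi>)) (cis (real ?d * \<psi>')) \<le> \<bar>real ?d * \<psi> - real ?d * \<psi>'\<bar>" by (rule dist_cis_le)
      also have "\<dots> = real ?d * \<bar>\<psi> - \<psi>'\<bar>" by (simp add: abs_mult flip: right_diff_distrib)
      also have "\<dots> \<le> real ?d * D" by (intro mult_left_mono) (auto simp: D_def)
      finally show ?thesis .
    qed
    have "dist (sgn (?P x) * cis (real ?d * \<psi>)) (sgn (?P y) * cis (real ?d * \<psi>'))
        \<le> dist (sgn (?P x)) (sgn (?P y)) + dist (cis (real ?d * \<psi>)) (cis (real ?d * \<psi>'))"
    proof -
      have "norm (sgn (?P y)) = 1" using Pnz[of y] sub xy by (auto simp: norm_sgn)
      moreover have "sgn (?P x) * cis (real ?d * \<psi>) - sgn (?P y) * cis (real ?d * \<psi>')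
        = (sgn (?P x) - sgn (?P y)) * cis (real ?d * \<psi>) + sgn (?P y) * (cis (real ?d * \<psi>) - cis (real ?d * \<psi>'))"
        by (simp add: algebra_simps)
      ultimately show ?thesis
        unfolding dist_norm by (metis (no_types, lifting) mult_1 mult.right_neutral norm_cis norm_mult norm_triangle_ineq)
    qed
    with 1 2 have 3: "dist (sgn (?P x) * cis (real ?d * \<psi>)) (sgn (?P y) * cis (real ?d * \<psi>'))
        \<le> 2 / m * (L1 * D) + real ?d * D" by linarith
    have "\<bar>height (cmod (Q x)) - height (cmod (Q y))\<bar> \<le> 2 * \<bar>cmod (Q x) - cmod (Q y)\<bar>"
      by (rule height_lipschitz) auto
    also have "\<dots> \<le> 2 * dist (Q x) (Q y)" using norm_triangle_ineq3[of "Q x" "Q y"] by (simp add: dist_norm)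
    also have "\<dots> \<le> 2 * (L2 * D)"
      using lipschitz_onD[OF L2 xy] mult_left_mono[OF dxy L_nn(2)] by linarith
    finally have 4: "\<bar>height (cmod (Q x)) - height (cmod (Q y))\<bar> \<le> 2 * (L2 * D)" .
    have "dist (iA (poly p (far_pt q \<psi>))) (iA (poly p (far_pt q' \<psi>')))
       \<le> dist (sgn (?P x) * cis (real ?d * \<psi>)) (sgn (?P y) * cis (real ?d * \<psi>'))
         + dist (- height (cmod (Q x))) (- height (cmod (Q y)))"
      unfolding iA_p[OF qq(1,2)] iA_p[OF qq(3,4)] x_def[symmetric] y_def[symmetric] by (rule dist_prod_le)
    also have "\<dots> \<le> 2 / m * (L1 * D) + real ?d * D + 2 * (L2 * D)"
      using 3 4 by (simp add: dist_real_def)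
    also have "\<dots> \<le> C * D"
      by (simp add: C_def D_def algebra_simps)
    finally show ?thesis by (simp add: D_def)
  qed
  have nr: "far_pt q \<psi> \<notin> rts p" if "0 < q" "q \<le> q0" for q \<psi>
    using p_eq[OF that(1)] Qnz[OF that] by (simp add: rts_def)
  show ?thesis
  proof (rule that[OF q0(1) \<open>C > 0\<close> nr])
    fix q q' \<psi> \<psi>' :: real
    assume qq: "0 < q" "q \<le> q0" "0 < q'" "q' \<le> q0"
    \<comment> \<open>A segment in the coordinates \<open>(q, \<psi>)\<close>. The estimate
      \<open>G\<close> scales with the parameter along it, so the bound for distances in the annulus
      is also one for the length.\<close>
    define \<gamma> where "\<gamma> = (\<lambda>s. far_pt (q + s * (q' - q)) (\<psi> + s * (\<psi>' - \<psi>)))"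
    have q_s: "0 < q + s * (q' - q)" "q + s * (q' - q) \<le> q0" if "s \<in> {0..1}" for s
    proof -
      have "(1 - s) *\<^sub>R q + s *\<^sub>R q' \<in> {0<..q0}" by (rule convexD) (use qq that in auto)
      then show "0 < q + s * (q' - q)" "q + s * (q' - q) \<le> q0" by (simp_all add: algebra_simps)
    qed
    have "pullback_dist p (\<gamma> 0) (\<gamma> 1) \<le> C * (\<bar>q - q'\<bar> + \<bar>\<psi> - \<psi>'\<bar>)"
    proof (rule admissible_lipschitz)
      have "complex_of_real (q + s * (q' - q)) \<noteq> 0" if "s \<in> {0..1}" for s
        using q_s(1)[OF that] by (simp only: of_real_eq_0_iff)
      then show "path \<gamma>" unfolding path_def \<gamma>_def far_pt_def cis_conv_exp
        by (intro continuous_intros) blast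
      show "path_image \<gamma> \<subseteq> - rts p" using nr q_s by (auto simp: path_image_def \<gamma>_def)
      show "(C * (\<bar>q - q'\<bar> + \<bar>\<psi> - \<psi>'\<bar>))-lipschitz_on {0..1} (iA \<circ> poly p \<circ> \<gamma>)"
      proof (rule lipschitz_onI)
        fix s t :: real assume "s \<in> {0..1}" "t \<in> {0..1}"
        then have "dist ((iA \<circ> poly p \<circ> \<gamma>) s) ((iA \<circ> poly p \<circ> \<gamma>) t)
          \<le> C * (\<bar>q + s * (q' - q) - (q + t * (q' - q))\<bar> + \<bar>\<psi> + s * (\<psi>' - \<psi>) - (\<psi> + t * (\<psi>' - \<psi>))\<bar>)"
          unfolding \<gamma>_def o_def by (intro G q_s)
        also have "q + s * (q' - q) - (q + t * (q' - q)) = (s - t) * (q' - q)" by (simp add: algebra_simps)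
        also have "\<psi> + s * (\<psi>' - \<psi>) - (\<psi> + t * (\<psi>' - \<psi>)) = (s - t) * (\<psi>' - \<psi>)" by (simp add: algebra_simps)
        also have "C * (\<bar>(s - t) * (q' - q)\<bar> + \<bar>(s - t) * (\<psi>' - \<psi>)\<bar>) = C * (\<bar>q - q'\<bar> + \<bar>\<psi> - \<psi>'\<bar>) * dist s t"
          by (simp only: abs_mult dist_real_def abs_minus_commute[of q'] abs_minus_commute[of \<psi>']) (simp add: algebra_simps)
        finally show "dist ((iA \<circ> poly p \<circ> \<gamma>) s) ((iA \<circ> poly p \<circ> \<gamma>) t) \<le> C * (\<bar>q - q'\<bar> + \<bar>\<psi> - \<psi>'\<bar>) * dist s t" .
      qed (use \<open>C > 0\<close> in auto)
    qed
    then show "pullback_dist p (far_pt q \<psi>) (far_pt q' \<psi>') \<le> C * (\<bar>q - q'\<bar> + \<bar>\<psi> - \<psi>'\<bar>)"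
      by (simp add: \<gamma>_def)
  qed
qed

end

section \<open>The completed surface\<close>

context nonconstant_poly
begin

abbreviation "BA \<equiv> branched_annulus p"

interpretation B: Metric_space "mspace BA" "mdist BA" by simp

lemma btop_eq: "btop p = B.mtopology"
  by (simp add: mtopology_of_def)

lemma limitin_btop:
  "limitin (btop p) f x F \<longleftrightarrow> x \<in> mspace BA \<and>
     (\<forall>e>0. eventually (\<lambda>y. f y \<in> mspace BA \<and> mdist BA (f y) x < e) F)"
  unfolding btop_eq by (rule B.limitin_metric)

lemma emb_in: "z \<notin> rts p \<Longrightarrow> emb p z \<in> mspace BA"
  using is_completion_branched_annulus by (auto simp: is_completion_def)

lemma emb_dist: "z \<notin> rts p \<Longrightarrow> w \<notin> rts p \<Longrightarrow> mdist BA (emb p z) (emb p w) = pullback_dist p z w"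
  using is_completion_branched_annulus by (auto simp: is_completion_def)

lemma emb_dense: "x \<in> mspace BA \<Longrightarrow> 0 < e \<Longrightarrow> \<exists>z. z \<notin> rts p \<and> mdist BA x (emb p z) < e"
proof -
  assume x: "x \<in> mspace BA" "0 < e"
  have "B.mtopology closure_of (emb p ` (- rts p)) = mspace BA"
    using is_completion_branched_annulus by (simp add: is_completion_def btop_eq)
  with x have "\<exists>y\<in>emb p ` (- rts p). y \<in> B.mball x e" unfolding B.metric_closure_of by blast
  then show ?thesis by auto
qed

lemma in_closure_emb:
  "x \<in> btop p closure_of (emb p ` S) \<longleftrightarrow>
     x \<in> mspace BA \<and> (\<forall>e>0. \<exists>z\<in>S. emb p z \<in> mspace BA \<and> mdist BA x (emb p z) < e)"
  unfolding btop_eq B.metric_closure_of by (auto simp: B.in_mball)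

lemma emb_inj:
  assumes "z \<notin> rts p" "w \<notin> rts p" "emb p z = emb p w" shows "z = w"
proof (rule ccontr)
  assume "z \<noteq> w"
  then have "0 < mdist BA (emb p z) (emb p w)"
    using pullback_dist_pos[OF assms(1,2)] emb_dist[OF assms(1,2)] by simp
  with assms(3) show False using emb_in[OF assms(2)] by simp
qed

lemma approx_sequence:
  assumes "x \<in> mspace BA"
  obtains \<zeta> where "\<And>n. \<zeta> n \<notin> rts p" "limitin (btop p) (\<lambda>n. emb p (\<zeta> n)) x sequentially"
proof -
  have "\<exists>z. z \<notin> rts p \<and> mdist BA x (emb p z) < inverse (real (Suc n))" for n
    using emb_dense[OF assms, of "inverse (real (Suc n))"] by simp
  then obtain \<zeta> where \<zeta>: "\<And>n. \<zeta> n \<notin> rts p" "\<And>n. mdist BA x (emb p (\<zeta> n)) < inverse (real (Suc n))"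
    by metis
  have "limitin (btop p) (\<lambda>n. emb p (\<zeta> n)) x sequentially"
    unfolding limitin_btop
  proof (intro conjI allI impI assms)
    fix e :: real assume "0 < e"
    then obtain N where N: "inverse (real (Suc N)) < e" using reals_Archimedean by blast
    show "\<forall>\<^sub>F n in sequentially. emb p (\<zeta> n) \<in> mspace BA \<and> mdist BA (emb p (\<zeta> n)) x < e"
      using eventually_ge_at_top[of N]
    proof eventually_elim
      case (elim n)
      then have "inverse (real (Suc n)) \<le> inverse (real (Suc N))" by (simp add: field_simps)
      then have "mdist BA (emb p (\<zeta> n)) x < e"
        using \<zeta>(2)[of n] N B.commute[of x "emb p (\<zeta> n)"] by linarith
      then show ?case using emb_in[OF \<zeta>(1)[of n]] by simp
    qed
  qed
  with \<zeta>(1) show ?thesis by (rule that)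
qed

text \<open>This gives the choice in \<open>pA\<close> its meaning. On the dense image of
  \<open>emb p\<close> the map is 1-Lipschitz, hence it extends into the complete space that
  contains the annulus; closedness of the annulus then catches the values of the extension.\<close>

lemma pA_exists:
  "\<exists>f. continuous_map (btop p) (top_of_set annulus) f \<and> (\<forall>z \<in> - rts p. f (emb p z) = iA (poly p z))"
proof -
  let ?S = "emb p ` (- rts p)"
  define f where "f = (\<lambda>x. iA (poly p (inv_into (- rts p) (emb p) x)))"
  have f: "f (emb p z) = iA (poly p z)" if "z \<notin> rts p" for z
  proof -
    have "inj_on (emb p) (- rts p)" using emb_inj by (intro inj_onI) auto
    then show ?thesis using that by (simp add: f_def inv_into_f_f)
  qed
  have "Lipschitz_continuous_map (submetric BA ?S) euclidean_metric f"
    unfolding Lipschitz_continuous_map_def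
  proof (intro conjI exI[of _ 1] ballI)
    fix x y assume "x \<in> mspace (submetric BA ?S)" "y \<in> mspace (submetric BA ?S)"
    then obtain z w where zw: "x = emb p z" "y = emb p w" "z \<notin> rts p" "w \<notin> rts p" by auto
    then show "mdist euclidean_metric (f x) (f y) \<le> 1 * mdist (submetric BA ?S) x y"
      using pullback_dist_ge_dist[OF zw(3,4)] by (simp add: f emb_dist)
  qed auto
  moreover have "mcomplete_of (euclidean_metric :: (complex \<times> real) metric)"
    by (simp add: mcomplete_of_def mcomplete_iff_complete complete_UNIV)
  ultimately obtain g where g: "Lipschitz_continuous_map (submetric BA (btop p closure_of ?S)) euclidean_metric g"
    "\<And>x. x \<in> ?S \<Longrightarrow> g x = f x"
    using Lipschitz_continuous_map_extends_to_closure_of by blast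
  have "btop p closure_of ?S = mspace BA"
    using is_completion_branched_annulus by (simp add: is_completion_def)
  with g(1) have "Lipschitz_continuous_map BA euclidean_metric g" by simp
  then have cont: "continuous_map (btop p) euclidean g"
    using Lipschitz_continuous_imp_continuous_map by fastforce
  have g_emb: "g (emb p z) = iA (poly p z)" if "z \<notin> rts p" for z using g(2) f that by auto
  have "g x \<in> annulus" if x: "x \<in> mspace BA" for x
  proof -
    obtain \<zeta> where \<zeta>: "\<And>n. \<zeta> n \<notin> rts p" "limitin (btop p) (\<lambda>n. emb p (\<zeta> n)) x sequentially"
      using approx_sequence[OF x] by blast
    have lim: "((\<lambda>n. g (emb p (\<zeta> n))) \<longlonglongrightarrow> g x)"
      using continuous_map_limit[OF cont \<zeta>(2)] by (simp add: o_def)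
    have "g (emb p (\<zeta> n)) \<in> annulus" for n
      using g_emb[OF \<zeta>(1)] iA_in_annulus[OF poly_nz[OF \<zeta>(1)]] by simp
    moreover have "closed annulus" unfolding annulus_def by (intro closed_Times closed_sphere closed_atLeastAtMost)
    ultimately show ?thesis using Lim_in_closed_set[OF _ _ _ lim] by (simp add: always_eventually)
  qed
  then have "continuous_map (btop p) (top_of_set annulus) g"
    using cont by (auto simp: continuous_map_in_subtopology)
  then show ?thesis using g_emb by auto
qed

lemma pA_cont: "continuous_map (btop p) (top_of_set annulus) (pA p)"
  and pA_emb: "z \<notin> rts p \<Longrightarrow> pA p (emb p z) = iA (poly p z)"
  using someI_ex[OF pA_exists] unfolding pA_def[symmetric] by auto

lemma pA_cont': "continuous_map (btop p) euclidean (pA p)"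
  using pA_cont by (simp add: continuous_map_in_subtopology)

lemma pA_in_annulus: "x \<in> mspace BA \<Longrightarrow> pA p x \<in> annulus"
  using pA_cont by (auto simp: continuous_map_def)

lemma pA_lim:
  assumes "limitin (btop p) (\<lambda>y. emb p (f y)) x F" "\<forall>\<^sub>F y in F. f y \<notin> rts p"
  shows "((\<lambda>y. iA (poly p (f y))) \<longlongrightarrow> pA p x) F"
proof -
  have "((\<lambda>y. pA p (emb p (f y))) \<longlongrightarrow> pA p x) F"
    using continuous_map_limit[OF pA_cont' assms(1)] by (simp add: o_def)
  then show ?thesis
    by (rule Lim_transform_eventually) (use assms(2) in \<open>auto elim!: eventually_mono simp: pA_emb\<close>)
qed

text \<open>Stated for one point of the completion and one of the plane, because it serves to
  compare a boundary point with its approximants.\<close>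

lemma pA_dist:
  assumes "x \<in> mspace BA" "z \<notin> rts p"
  shows "dist (pA p x) (iA (poly p z)) \<le> mdist BA x (emb p z)"
proof -
  obtain \<zeta> where \<zeta>: "\<And>n. \<zeta> n \<notin> rts p" "limitin (btop p) (\<lambda>n. emb p (\<zeta> n)) x sequentially"
    using approx_sequence[OF assms(1)] by blast
  have "((\<lambda>n. iA (poly p (\<zeta> n))) \<longlonglongrightarrow> pA p x)" by (rule pA_lim) (use \<zeta> in auto)
  then have 1: "(\<lambda>n. dist (iA (poly p (\<zeta> n))) (iA (poly p z))) \<longlonglongrightarrow> dist (pA p x) (iA (poly p z))"
    by (intro tendsto_intros)
  show ?thesis
  proof (rule field_le_epsilon)
    fix e :: real assume "0 < e"
    have "\<forall>\<^sub>F n in sequentially. dist (iA (poly p (\<zeta> n))) (iA (poly p z)) \<le> mdist BA x (emb p z) + e"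
      using \<zeta>(2)[unfolded limitin_btop] \<open>0 < e\<close>
    proof -
      have "\<forall>\<^sub>F n in sequentially. mdist BA (emb p (\<zeta> n)) x < e"
        using \<zeta>(2) \<open>0 < e\<close> unfolding limitin_btop by (auto elim: eventually_mono)
      then show ?thesis
      proof eventually_elim
        case (elim n)
        have "dist (iA (poly p (\<zeta> n))) (iA (poly p z)) \<le> mdist BA (emb p (\<zeta> n)) (emb p z)"
          using pullback_dist_ge_dist \<zeta>(1) assms(2) by (simp add: emb_dist)
        also have "\<dots> \<le> mdist BA (emb p (\<zeta> n)) x + mdist BA x (emb p z)"
          by (intro B.triangle emb_in \<zeta>(1) assms)
        finally show ?case using elim by linarith
      qed
    qed
    then show "dist (pA p x) (iA (poly p z)) \<le> mdist BA x (emb p z) + e"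
      by (rule tendsto_upperbound[OF 1]) simp
  qed
qed

text \<open>Completeness speaks of sequences, while the limits wanted are along
  \<open>at_top\<close> and one-sided neighbourhoods. A sequence meeting the first \<open>n\<close>
  Cauchy conditions at its \<open>n\<close>-th term converges, and the whole filter follows
  it.\<close>

lemma Cauchy_filter_limit:
  assumes "F \<noteq> bot"
    and "\<And>e. 0 < e \<Longrightarrow> \<exists>P. eventually P F \<and> (\<forall>x y. P x \<longrightarrow> P y \<longrightarrow> f x \<in> mspace BA \<and> mdist BA (f x) (f y) < e)"
  obtains l where "limitin (btop p) f l F"
proof -
  have "\<exists>P. eventually P F \<and> (\<forall>x y. P x \<longrightarrow> P y \<longrightarrow> f x \<in> mspace BA \<and> mdist BA (f x) (f y) < inverse (real (Suc n)))" for n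
    by (rule assms(2)) simp
  then obtain P where P: "\<And>n. eventually (P n) F"
    "\<And>n x y. P n x \<Longrightarrow> P n y \<Longrightarrow> f x \<in> mspace BA \<and> mdist BA (f x) (f y) < inverse (real (Suc n))"
    by metis
  have "\<exists>x. \<forall>k\<le>n. P k x" for n
  proof -
    have "\<forall>\<^sub>F x in F. \<forall>k\<in>{..n}. P k x" using P(1) by (intro eventually_ball_finite) auto
    then show ?thesis using eventually_happens'[OF assms(1)] by fastforce
  qed
  then obtain s where s: "\<And>n k. k \<le> n \<Longrightarrow> P k (s n)" by metis
  have "B.MCauchy (f \<circ> s)" unfolding B.MCauchy_def
  proof (intro conjI allI impI)
    show "range (f \<circ> s) \<subseteq> mspace BA" using P(2) s by fastforce
    fix e :: real assume "0 < e"
    then obtain N where N: "inverse (real (Suc N)) < e" using reals_Archimedean by blast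
    have "mdist BA ((f \<circ> s) n) ((f \<circ> s) n') < e" if "N \<le> n" "N \<le> n'" for n n'
      using P(2)[OF s[OF that(1)] s[OF that(2)]] N by simp
    then show "\<exists>N. \<forall>n n'. N \<le> n \<longrightarrow> N \<le> n' \<longrightarrow> mdist BA ((f \<circ> s) n) ((f \<circ> s) n') < e" by blast
  qed
  moreover have "B.mcomplete"
    using is_completion_branched_annulus by (simp add: is_completion_def mcomplete_of_def)
  ultimately obtain l where l: "limitin B.mtopology (f \<circ> s) l sequentially" unfolding B.mcomplete_def by blast
  have "limitin (btop p) f l F" unfolding limitin_btop
  proof (intro conjI allI impI)
    show lM: "l \<in> mspace BA" using l unfolding B.limitin_metric by blast
    fix e :: real assume "0 < e"
    then obtain N where N: "inverse (real (Suc N)) < e / 2" using reals_Archimedean[of "e / 2"] by auto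
    have "\<forall>\<^sub>F n in sequentially. mdist BA (f (s n)) l < e / 2"
      using l \<open>0 < e\<close> unfolding B.limitin_metric by (auto elim!: allE[of _ "e / 2"] eventually_mono)
    then obtain m where m: "N \<le> m" "mdist BA (f (s m)) l < e / 2"
      unfolding eventually_sequentially by (meson le_cases order_refl)
    show "\<forall>\<^sub>F y in F. f y \<in> mspace BA \<and> mdist BA (f y) l < e"
      using P(1)[of N]
    proof eventually_elim
      case (elim y)
      have "mdist BA (f y) l \<le> mdist BA (f y) (f (s m)) + mdist BA (f (s m)) l"
        using P(2)[OF elim elim] P(2)[OF s[OF m(1)] s[OF m(1)]] lM by (intro B.triangle) auto
      then show ?case using P(2)[OF elim s[OF m(1)]] m(2) N by auto
    qed
  qed
  then show ?thesis by (rule that)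
qed

lemma mdist_le_limit:
  assumes "limitin (btop p) f x F" "limitin (btop p) g y F" "F \<noteq> bot" "\<forall>\<^sub>F t in F. mdist BA (f t) (g t) \<le> B"
  shows "mdist BA x y \<le> B"
proof (rule field_le_epsilon)
  fix e :: real assume "0 < e"
  have M: "x \<in> mspace BA" "y \<in> mspace BA" using assms(1,2) unfolding limitin_btop by auto
  have "\<forall>\<^sub>F t in F. f t \<in> mspace BA \<and> mdist BA (f t) x < e / 2" "\<forall>\<^sub>F t in F. g t \<in> mspace BA \<and> mdist BA (g t) y < e / 2"
    using assms(1,2) \<open>0 < e\<close> unfolding limitin_btop by (metis half_gt_zero)+
  then have "\<forall>\<^sub>F t in F. mdist BA x y \<le> B + e" using assms(4)
  proof eventually_elim
    case (elim t)
    then have "mdist BA x y \<le> mdist BA x (f t) + (mdist BA (f t) (g t) + mdist BA (g t) y)"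
      using M by (meson B.triangle add_left_mono order_trans)
    then show ?case using elim B.commute[of x] by simp
  qed
  then show "mdist BA x y \<le> B + e" using assms(3) by (simp add: eventually_const_iff)
qed

lemma limit_in_closure:
  assumes "limitin (btop p) f x F" "F \<noteq> bot" "\<forall>\<^sub>F t in F. f t \<in> S" shows "x \<in> btop p closure_of S"
  unfolding btop_eq B.metric_closure_of
proof (intro CollectI conjI allI impI)
  show "x \<in> mspace BA" using assms(1) unfolding limitin_btop by blast
  fix r :: real assume "0 < r"
  then have "\<forall>\<^sub>F t in F. f t \<in> mspace BA \<and> mdist BA (f t) x < r" using assms(1) unfolding limitin_btop by blast
  then have "\<forall>\<^sub>F t in F. f t \<in> mspace BA \<and> mdist BA (f t) x < r \<and> f t \<in> S"
    using assms(3) by eventually_elim simp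
  then obtain t where "f t \<in> mspace BA" "mdist BA (f t) x < r" "f t \<in> S"
    using eventually_happens'[OF assms(2)] by blast
  then show "\<exists>y\<in>S. y \<in> B.mball x r" using \<open>x \<in> mspace BA\<close> B.commute[of x] by (auto simp: B.in_mball)
qed

lemma limitin_btop_close:
  assumes "limitin (btop p) f x F" "\<forall>\<^sub>F t in F. g t \<in> mspace BA" "((\<lambda>t. mdist BA (f t) (g t)) \<longlongrightarrow> 0) F"
  shows "limitin (btop p) g x F"
  unfolding limitin_btop
proof (intro conjI allI impI)
  show M: "x \<in> mspace BA" using assms(1) unfolding limitin_btop by blast
  fix e :: real assume "0 < e"
  have "\<forall>\<^sub>F t in F. mdist BA (f t) (g t) < e / 2"
    by (rule order_tendstoD(2)[OF assms(3)]) (use \<open>0 < e\<close> in simp)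
  moreover have "\<forall>\<^sub>F t in F. f t \<in> mspace BA \<and> mdist BA (f t) x < e / 2"
    using assms(1) \<open>0 < e\<close> unfolding limitin_btop by (metis half_gt_zero)
  ultimately show "\<forall>\<^sub>F t in F. g t \<in> mspace BA \<and> mdist BA (g t) x < e" using assms(2)
  proof eventually_elim
    case (elim t)
    then have "mdist BA (g t) x \<le> mdist BA (g t) (f t) + mdist BA (f t) x" using M by (intro B.triangle) auto
    then show ?case using elim B.commute[of "g t"] by simp
  qed
qed

lemma limitin_btop_unique:
  assumes "limitin (btop p) f x F" "limitin (btop p) f y F" "F \<noteq> bot" shows "x = y"
  using assms unfolding btop_eq by (rule B.limitin_metric_unique)

section \<open>Points at infinity and their directions\<close>

lemma far_pt_inverse: "far_pt (inverse r) \<theta> = complex_of_real r * cis \<theta>"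
  by (simp add: far_pt_def divide_inverse mult.commute)

text \<open>This makes the \<open>THE\<close> in \<open>inf_pt\<close> legitimate. On one ray the
  angles agree, so \<open>near_infinity\<close> bounds distances by the reciprocals of the moduli
  alone and gives the Cauchy property.\<close>

lemma inf_pt_limit: "limitin (btop p) (\<lambda>r. emb p (complex_of_real r * cis \<theta>)) (inf_pt p \<theta>) at_top"
proof -
  obtain q0 C where C: "0 < q0" "0 < C"
    "\<And>q \<psi>. 0 < q \<Longrightarrow> q \<le> q0 \<Longrightarrow> far_pt q \<psi> \<notin> rts p"
    "\<And>q q' \<psi> \<psi>'. 0 < q \<Longrightarrow> q \<le> q0 \<Longrightarrow> 0 < q' \<Longrightarrow> q' \<le> q0 \<Longrightarrow>
       pullback_dist p (far_pt q \<psi>) (far_pt q' \<psi>') \<le> C * (\<bar>q - q'\<bar> + \<bar>\<psi> - \<psi>'\<bar>)"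
    by (rule near_infinity) (rule that)
  let ?f = "\<lambda>r. emb p (complex_of_real r * cis \<theta>)"
  have "\<exists>l. limitin (btop p) ?f l at_top"
  proof -
    have "\<exists>P. eventually P at_top \<and> (\<forall>x y. P x \<longrightarrow> P y \<longrightarrow> ?f x \<in> mspace BA \<and> mdist BA (?f x) (?f y) < e)"
      if "0 < e" for e
    proof (intro exI[of _ "\<lambda>r. 0 < r \<and> inverse r \<le> q0 \<and> C * inverse r < e / 2"] conjI allI impI)
      have "((\<lambda>r. inverse r) \<longlongrightarrow> (0::real)) at_top" by (rule tendsto_inverse_0_at_top[OF filterlim_ident])
      then have "\<forall>\<^sub>F r in at_top. inverse r < min q0 (e / 2 / C)"
        by (rule order_tendstoD) (use C that in auto)
      then show "\<forall>\<^sub>F r in at_top. 0 < r \<and> inverse r \<le> q0 \<and> C * inverse r < e / 2"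
        using eventually_gt_at_top[of 0]
      proof eventually_elim
        case (elim r)
        then have "C * inverse r < C * (e / 2 / C)" using C by (intro mult_strict_left_mono) auto
        then show ?case using elim C by auto
      qed
      fix x y assume x: "0 < x \<and> inverse x \<le> q0 \<and> C * inverse x < e / 2"
        and y: "0 < y \<and> inverse y \<le> q0 \<and> C * inverse y < e / 2"
      have nr: "complex_of_real x * cis \<theta> \<notin> rts p" "complex_of_real y * cis \<theta> \<notin> rts p"
        using C(3)[of "inverse x" \<theta>] C(3)[of "inverse y" \<theta>] x y by (simp_all add: far_pt_inverse)
      then show "?f x \<in> mspace BA" by (simp add: emb_in)
      have "mdist BA (?f x) (?f y) \<le> C * (\<bar>inverse x - inverse y\<bar> + \<bar>\<theta> - \<theta>\<bar>)"
        using C(4)[of "inverse x" "inverse y" \<theta> \<theta>] x y nr by (simp add: emb_dist far_pt_inverse)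
      also have "\<dots> \<le> C * (inverse x + inverse y)"
        using C(2) x y by (intro mult_left_mono) (auto simp: abs_real_def)
      also have "\<dots> < e" using x y by (simp add: distrib_left)
      finally show "mdist BA (?f x) (?f y) < e" .
    qed
    from Cauchy_filter_limit[OF trivial_limit_at_top_linorder this] show ?thesis by blast
  qed
  then have "\<exists>!l. limitin (btop p) ?f l at_top"
    using limitin_btop_unique trivial_limit_at_top_linorder by blast
  then show ?thesis unfolding inf_pt_def by (rule theI')
qed

text \<open>The second point of \<open>near_infinity\<close> is sent to infinity; the factor 2 is
  slack. Points of the plane that tend to infinity with angles tending to \<theta> therefore
  converge to \<open>inf_pt p \<theta>\<close>.\<close>

lemma inf_pt_near:
  obtains q0 C where "0 < q0" "0 < C"
    "\<And>q \<psi>. 0 < q \<Longrightarrow> q \<le> q0 \<Longrightarrow> far_pt q \<psi> \<notin> rts p"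
    "\<And>q \<psi> \<theta>. 0 < q \<Longrightarrow> q \<le> q0 \<Longrightarrow> mdist BA (emb p (far_pt q \<psi>)) (inf_pt p \<theta>) \<le> C * (2 * q + \<bar>\<psi> - \<theta>\<bar>)"
proof -
  obtain q0 C where C: "0 < q0" "0 < C"
    "\<And>q \<psi>. 0 < q \<Longrightarrow> q \<le> q0 \<Longrightarrow> far_pt q \<psi> \<notin> rts p"
    "\<And>q q' \<psi> \<psi>'. 0 < q \<Longrightarrow> q \<le> q0 \<Longrightarrow> 0 < q' \<Longrightarrow> q' \<le> q0 \<Longrightarrow>
       pullback_dist p (far_pt q \<psi>) (far_pt q' \<psi>') \<le> C * (\<bar>q - q'\<bar> + \<bar>\<psi> - \<psi>'\<bar>)"
    by (rule near_infinity) (rule that)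
  have "mdist BA (emb p (far_pt q \<psi>)) (inf_pt p \<theta>) \<le> C * (2 * q + \<bar>\<psi> - \<theta>\<bar>)"
    if q: "0 < q" "q \<le> q0" for q \<psi> \<theta>
  proof (rule mdist_le_limit[OF _ inf_pt_limit trivial_limit_at_top_linorder])
    show "limitin (btop p) (\<lambda>_. emb p (far_pt q \<psi>)) (emb p (far_pt q \<psi>)) at_top"
      using emb_in[OF C(3)[OF q]] by (simp add: btop_eq)
    have "((\<lambda>r. inverse r) \<longlongrightarrow> (0::real)) at_top" by (rule tendsto_inverse_0_at_top[OF filterlim_ident])
    then have "\<forall>\<^sub>F r in at_top. inverse r < q" by (rule order_tendstoD) (use q in auto)
    then show "\<forall>\<^sub>F r in at_top. mdist BA (emb p (far_pt q \<psi>)) (emb p (complex_of_real r * cis \<theta>))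
        \<le> C * (2 * q + \<bar>\<psi> - \<theta>\<bar>)"
      using eventually_gt_at_top[of 0]
    proof eventually_elim
      case (elim r)
      then have r: "0 < inverse r" "inverse r \<le> q0" using q by auto
      have "mdist BA (emb p (far_pt q \<psi>)) (emb p (complex_of_real r * cis \<theta>)) \<le> C * (\<bar>q - inverse r\<bar> + \<bar>\<psi> - \<theta>\<bar>)"
        using C(4)[OF q r, of \<psi> \<theta>] C(3)[OF q, of \<psi>] C(3)[OF r, of \<theta>]
        by (simp add: emb_dist far_pt_inverse)
      also have "\<dots> \<le> C * (2 * q + \<bar>\<psi> - \<theta>\<bar>)"
      proof -
        have "\<bar>q - inverse r\<bar> \<le> 2 * q" using elim(1) r(1) q(1) by linarith
        then show ?thesis using C(2) by (intro mult_left_mono) auto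
      qed
      finally show ?case .
    qed
  qed
  then show ?thesis using C(1-3) by (intro that[of q0 C]) auto
qed

lemma inf_pt_in: "inf_pt p \<theta> \<in> mspace BA"
  using inf_pt_limit unfolding limitin_btop by blast

lemma inf_pt_lipschitz:
  obtains C where "0 < C" "\<And>\<theta> \<theta>'. mdist BA (inf_pt p \<theta>) (inf_pt p \<theta>') \<le> C * \<bar>\<theta> - \<theta>'\<bar>"
proof -
  obtain q0 C where C: "0 < q0" "0 < C"
    "\<And>q \<psi>. 0 < q \<Longrightarrow> q \<le> q0 \<Longrightarrow> far_pt q \<psi> \<notin> rts p"
    "\<And>q \<psi> \<theta>. 0 < q \<Longrightarrow> q \<le> q0 \<Longrightarrow> mdist BA (emb p (far_pt q \<psi>)) (inf_pt p \<theta>) \<le> C * (2 * q + \<bar>\<psi> - \<theta>\<bar>)"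
    by (rule inf_pt_near) (rule that)
  have "mdist BA (inf_pt p \<theta>) (inf_pt p \<theta>') \<le> C * \<bar>\<theta> - \<theta>'\<bar>" for \<theta> \<theta>'
  proof (rule field_le_epsilon)
    fix e :: real assume "0 < e"
    \<comment> \<open>Each of the two legs through \<open>far_pt q \<theta>\<close> costs at most
      \<open>2 * C * q\<close> beyond the angular term, whence the divisor
      \<open>4 * C\<close>.\<close>
    define q where "q = min q0 (e / (4 * C))"
    have q: "0 < q" "q \<le> q0" using C \<open>0 < e\<close> by (auto simp: q_def)
    have "C * q \<le> C * (e / (4 * C))" using C by (intro mult_left_mono) (auto simp: q_def)
    then have Cq: "C * q \<le> e / 4" using C by simp
    have "mdist BA (inf_pt p \<theta>) (inf_pt p \<theta>') \<le> mdist BA (inf_pt p \<theta>) (emb p (far_pt q \<theta>)) + mdist BA (emb p (far_pt q \<theta>)) (inf_pt p \<theta>')"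
      by (intro B.triangle inf_pt_in emb_in C(3) q)
    also have "\<dots> \<le> C * (2 * q + \<bar>\<theta> - \<theta>\<bar>) + C * (2 * q + \<bar>\<theta> - \<theta>'\<bar>)"
      using C(4)[OF q, of \<theta> \<theta>] C(4)[OF q, of \<theta> \<theta>'] by (simp add: B.commute)
    also have "\<dots> \<le> C * \<bar>\<theta> - \<theta>'\<bar> + e" using Cq by (simp add: algebra_simps)
    finally show "mdist BA (inf_pt p \<theta>) (inf_pt p \<theta>') \<le> C * \<bar>\<theta> - \<theta>'\<bar> + e" .
  qed
  then show ?thesis using C(2) that by blast
qed

lemma inf_pt_cis: "cis \<theta> = cis \<theta>' \<Longrightarrow> inf_pt p \<theta> = inf_pt p \<theta>'"
  by (simp add: inf_pt_def)

lemma eventually_ray_notin_rts: "\<forall>\<^sub>F r in at_top. complex_of_real r * cis \<theta> \<notin> rts p"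
proof -
  obtain q0 C where C: "0 < q0" "\<And>q \<psi>. 0 < q \<Longrightarrow> q \<le> q0 \<Longrightarrow> far_pt q \<psi> \<notin> rts p"
    by (rule inf_pt_near) (rule that)
  show ?thesis using eventually_ge_at_top[of "inverse q0"] eventually_gt_at_top[of 0]
  proof eventually_elim
    case (elim r)
    then have "inverse r \<le> q0" using C(1) by (metis inverse_inverse_eq inverse_positive_iff_positive le_imp_inverse_le)
    then show ?case using C(2)[of "inverse r" \<theta>] elim by (simp add: far_pt_inverse)
  qed
qed

lemma ray_at_infinity: "filterlim (\<lambda>r. complex_of_real r * cis \<theta>) at_infinity at_top"
proof (rule filterlim_norm_at_top_imp_at_infinity)
  have "\<forall>\<^sub>F r in at_top. norm (complex_of_real r * cis \<theta>) = r"
    using eventually_ge_at_top[of 0] by eventually_elim (simp add: norm_mult)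
  then show "filterlim (\<lambda>r. norm (complex_of_real r * cis \<theta>)) at_top at_top"
    by (subst filterlim_cong[OF refl refl]) (auto simp: filterlim_ident)
qed

lemma poly_at_infinity: "filterlim (poly p) at_infinity at_infinity"
  using filterlim_poly_at_infinity degree_pos by blast

lemma height_tendsto: "(height \<longlongrightarrow> 1) at_top"
  unfolding height_def by real_asymp

lemma pA_inf_pt: "pA p (inf_pt p \<theta>) = (asymp_dir \<theta>, 1)"
proof -
  have "((\<lambda>r. iA (poly p (complex_of_real r * cis \<theta>))) \<longlongrightarrow> pA p (inf_pt p \<theta>)) at_top"
    by (rule pA_lim[OF inf_pt_limit eventually_ray_notin_rts])
  moreover have "((\<lambda>r. iA (poly p (complex_of_real r * cis \<theta>))) \<longlongrightarrow> (asymp_dir \<theta>, 1)) at_top"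
    unfolding iA_eq
  proof (intro tendsto_Pair asymp_dir_tendsto)
    show "((\<lambda>r. height (cmod (poly p (complex_of_real r * cis \<theta>)))) \<longlongrightarrow> 1) at_top"
      by (rule filterlim_compose[OF height_tendsto filterlim_compose[OF filterlim_at_infinity_imp_norm_at_top
        [OF poly_at_infinity] ray_at_infinity]])
  qed
  ultimately show ?thesis by (rule tendsto_unique[OF trivial_limit_at_top_linorder])
qed

lemma dir_at_eq: "dir_at p \<theta> = asymp_dir \<theta>"
  by (simp add: dir_at_def pA_inf_pt)

lemma inf_pt_in_Dir: "inf_pt p \<theta> \<in> Dir p v \<longleftrightarrow> asymp_dir \<theta> = v"
  by (auto simp: Dir_def pA_inf_pt inf_pt_in)

lemma inf_pt_circle: "inf_pt p \<theta> \<in> circle_at_infinity p"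
proof -
  obtain R where R: "\<And>r. R \<le> r \<Longrightarrow> complex_of_real r * cis \<theta> \<notin> rts p"
    using eventually_ray_notin_rts[of \<theta>] by (auto simp: eventually_at_top_linorder)
  define \<zeta> where "\<zeta> = (\<lambda>n. complex_of_real (R + real n) * cis \<theta>)"
  have lim: "filterlim (\<lambda>n. R + real n) at_top sequentially"
    by (rule filterlim_tendsto_add_at_top[OF tendsto_const filterlim_real_sequentially])
  have "\<zeta> n \<notin> rts p" for n unfolding \<zeta>_def by (rule R) simp
  then have "range \<zeta> \<subseteq> - rts p" by blast
  moreover have "filterlim \<zeta> at_infinity sequentially"
    unfolding \<zeta>_def by (rule filterlim_compose[OF ray_at_infinity lim])
  moreover have "limitin (btop p) (emb p \<circ> \<zeta>) (inf_pt p \<theta>) sequentially"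
    unfolding limitin_btop
  proof (intro conjI allI impI inf_pt_in)
    fix e :: real assume "0 < e"
    then have "\<forall>\<^sub>F r in at_top. emb p (complex_of_real r * cis \<theta>) \<in> mspace BA \<and>
        mdist BA (emb p (complex_of_real r * cis \<theta>)) (inf_pt p \<theta>) < e"
      using inf_pt_limit[of \<theta>] unfolding limitin_btop by blast
    then show "\<forall>\<^sub>F n in sequentially. (emb p \<circ> \<zeta>) n \<in> mspace BA \<and> mdist BA ((emb p \<circ> \<zeta>) n) (inf_pt p \<theta>) < e"
      unfolding \<zeta>_def o_def by (rule eventually_compose_filterlim[OF _ lim])
  qed
  ultimately show ?thesis unfolding circle_at_infinity_def by blast
qed

lemma asymp_dir_eq_iff: "asymp_dir \<theta> = asymp_dir \<theta>' \<longleftrightarrow> (\<exists>k::int. \<theta>' = \<theta> + 2 * pi * real_of_int k / real (degree p))"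
proof -
  have "asymp_dir \<theta> = asymp_dir \<theta>' \<longleftrightarrow> cis (real (degree p) * \<theta>) = cis (real (degree p) * \<theta>')"
    using norm_sgn_lc by (auto simp: asymp_dir_def)
  also have "\<dots> \<longleftrightarrow> (\<exists>k::int. real (degree p) * \<theta>' = real (degree p) * \<theta> + 2 * pi * real_of_int k)"
  proof
    assume "cis (real (degree p) * \<theta>) = cis (real (degree p) * \<theta>')"
    then have "cis (real (degree p) * \<theta>' - real (degree p) * \<theta>) = 1" by (simp flip: cis_divide)
    then have "cos (real (degree p) * \<theta>' - real (degree p) * \<theta>) = 1" by (metis cis.sel(1) one_complex.sel(1))
    then obtain k :: int where "real (degree p) * \<theta>' - real (degree p) * \<theta> = 2 * pi * real_of_int k"
      by (auto simp: cos_one_2pi_int mult.commute)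
    then show "\<exists>k::int. real (degree p) * \<theta>' = real (degree p) * \<theta> + 2 * pi * real_of_int k"
      by (intro exI[of _ k]) simp
  next
    assume "\<exists>k::int. real (degree p) * \<theta>' = real (degree p) * \<theta> + 2 * pi * real_of_int k"
    then obtain k :: int where k: "real (degree p) * \<theta>' = real (degree p) * \<theta> + 2 * pi * real_of_int k" by blast
    show "cis (real (degree p) * \<theta>) = cis (real (degree p) * \<theta>')"
      unfolding k by (simp flip: cis_mult)
  qed
  also have "\<dots> \<longleftrightarrow> (\<exists>k::int. \<theta>' = \<theta> + 2 * pi * real_of_int k / real (degree p))"
    using degree_pos by (intro ex_cong1) (auto simp: field_simps)
  finally show ?thesis .
qed

lemma asymp_dir_surj: "norm v = 1 \<Longrightarrow> \<exists>\<theta>. asymp_dir \<theta> = v"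
proof -
  assume v: "norm v = 1"
  let ?s = "sgn (lead_coeff p)"
  have s: "?s \<noteq> 0" using norm_sgn_lc by auto
  have "norm (v / ?s) = 1" using v norm_sgn_lc by (simp add: norm_divide)
  then have "cis (Arg (v / ?s)) = v / ?s" by (metis cis_Arg norm_zero sgn_div_norm div_by_1 inverse_1 scaleR_one zero_neq_one)
  then show ?thesis using degree_pos s
    by (intro exI[of _ "Arg (v / ?s) / real (degree p)"]) (simp add: asymp_dir_def)
qed

end

text \<open>The chord grows with the angle up to \<open>pi\<close>. Hence turning
  \<open>sgn w\<close> towards \<open>u\<close> along the shorter arc never leaves a sector around
  \<open>u\<close>.\<close>

lemma norm_cis_minus_1_mono:
  assumes "\<bar>x\<bar> \<le> \<bar>y\<bar>" "\<bar>y\<bar> \<le> pi" shows "norm (cis x - 1) \<le> norm (cis y - 1)"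
proof -
  have n: "norm (cis t - 1) = 2 * sin (\<bar>t\<bar> / 2)" if "\<bar>t\<bar> \<le> pi" for t
  proof -
    have "norm (cis t - 1) = 2 * \<bar>sin (t / 2)\<bar>" using dist_exp_i_1[of t] by (simp add: cis_conv_exp)
    also have "\<bar>sin (t / 2)\<bar> = \<bar>sin (\<bar>t\<bar> / 2)\<bar>" by (simp add: abs_if)
    also have "\<dots> = sin (\<bar>t\<bar> / 2)" using that by (simp add: sin_ge_zero)
    finally show ?thesis .
  qed
  have "sin (\<bar>x\<bar> / 2) \<le> sin (\<bar>y\<bar> / 2)" by (rule sin_monotone_2pi_le) (use assms in auto)
  then show ?thesis using n[of x] n[of y] assms by simp
qed

lemma cis_Arg_norm1: "norm z = 1 \<Longrightarrow> cis (Arg z) = z"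
  using cis_Arg[of z] by (cases "z = 0") (simp_all add: sgn_div_norm)

lemma Arg_tendsto_0:
  assumes "(f \<longlongrightarrow> 1) F" shows "((\<lambda>x. Arg (f x)) \<longlongrightarrow> 0) F"
proof -
  have "isCont Arg 1" by (rule continuous_at_Arg) auto
  from isCont_tendsto_compose[OF this assms] show ?thesis by simp
qed

text \<open>After division by the principal branch of the root of \<open>f ^ n / v\<close>, which tends to 1, only
  finitely many values are left, so that continuity forces a constant.\<close>

lemma power_tendsto_imp_tendsto:
  fixes f :: "real \<Rightarrow> complex"
  assumes n: "n > 0" and "a < b" and cont: "continuous_on {a<..<b} f"
    and lim: "((\<lambda>t. f t ^ n) \<longlongrightarrow> v) (at_left b)" and "v \<noteq> 0"
  obtains \<zeta> where "\<zeta> ^ n = v" "(f \<longlongrightarrow> \<zeta>) (at_left b)"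
proof -
  define w where "w = (\<lambda>t. f t ^ n / v)"
  have w1: "(w \<longlongrightarrow> 1) (at_left b)"
    unfolding w_def using tendsto_divide[OF lim tendsto_const[of v] \<open>v \<noteq> 0\<close>] \<open>v \<noteq> 0\<close> by simp
  then have "\<forall>\<^sub>F t in at_left b. w t \<in> ball 1 1" by (rule topological_tendstoD) auto
  then obtain c where c: "c < b" "\<And>t. c < t \<Longrightarrow> t < b \<Longrightarrow> w t \<in> ball 1 1"
    unfolding eventually_at_left_field by blast
  define I where "I = {max a c<..<b}"
  have I: "connected I" "I \<subseteq> {a<..<b}" by (auto simp: I_def)
  have w_slit: "w t \<notin> \<real>\<^sub>\<le>\<^sub>0" if "t \<in> I" for t
  proof -
    have "dist 1 (w t) < 1" using c(2)[of t] that by (auto simp: I_def)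
    then have "\<bar>1 - Re (w t)\<bar> < 1" using abs_Re_le_cmod[of "1 - w t"] by (simp add: dist_norm)
    then show ?thesis by (auto simp: complex_nonpos_Reals_iff)
  qed
  define s where "s = (\<lambda>t. exp (Ln (w t) / of_nat n))"
  have w_nz: "w t \<noteq> 0" if "t \<in> I" for t using w_slit[OF that] by auto
  have s_pow: "s t ^ n = w t" if "t \<in> I" for t
    using w_nz[OF that] n by (simp add: s_def flip: exp_of_nat_mult)
  have s1: "(s \<longlongrightarrow> 1) (at_left b)"
  proof -
    have "((\<lambda>t. exp (Ln (w t) / of_nat n)) \<longlongrightarrow> exp (Ln 1 / of_nat n)) (at_left b)"
      by (intro tendsto_intros w1) (use n in auto)
    then show ?thesis by (simp add: s_def)
  qed
  define k where "k = (\<lambda>t. f t / s t)"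
  have "continuous_on I w" unfolding w_def
    by (intro continuous_intros continuous_on_subset[OF cont] I) (use \<open>v \<noteq> 0\<close> in auto)
  then have "continuous_on I s" unfolding s_def
    by (intro continuous_intros) (use w_slit n in auto)
  then have "continuous_on I k" unfolding k_def
    by (intro continuous_intros continuous_on_subset[OF cont] I) (auto simp: s_def)
  moreover have k_pow: "k t ^ n = v" if "t \<in> I" for t
    using s_pow[OF that] w_nz[OF that] \<open>v \<noteq> 0\<close> by (simp add: k_def power_divide) (simp add: w_def)
  then have "k ` I \<subseteq> {z. z ^ n = v}" by auto
  then have "finite (k ` I)" using finite_nth_roots[OF n] finite_subset by blast
  ultimately have "k constant_on I" by (intro continuous_finite_range_constant I(1))
  then obtain \<zeta> where \<zeta>: "\<And>t. t \<in> I \<Longrightarrow> k t = \<zeta>" unfolding constant_on_def by blast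
  have "max a c < b" using \<open>a < b\<close> c by simp
  have "(max a c + b) / 2 \<in> I" using \<open>max a c < b\<close> by (simp add: I_def field_simps)
  then have "\<zeta> ^ n = v" using k_pow \<zeta> by blast
  moreover have "(f \<longlongrightarrow> \<zeta>) (at_left b)"
  proof (rule Lim_transform_eventually)
    show "((\<lambda>t. \<zeta> * s t) \<longlongrightarrow> \<zeta>) (at_left b)" using tendsto_mult[OF tendsto_const s1] by simp
    have "f t = \<zeta> * s t" if "max a c < t" "t < b" for t
      using \<zeta>[of t] that by (simp add: k_def I_def s_def field_simps)
    then show "\<forall>\<^sub>F t in at_left b. \<zeta> * s t = f t"
      unfolding eventually_at_left_field using \<open>max a c < b\<close> by (intro exI[of _ "max a c"]) auto
  qed
  ultimately show ?thesis by (rule that)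
qed

lemma radius_at_left_1: "filterlim radius at_top (at_left 1)"
  unfolding radius_def by real_asymp

lemma radius_at_right: "(radius \<longlongrightarrow> 0) (at_right (-1))"
  unfolding radius_def by real_asymp

lemma eventually_unit: "\<forall>\<^sub>F t in at_left (1::real). t \<in> {-1<..<1}" "\<forall>\<^sub>F t in at_right (-1::real). t \<in> {-1<..<1}"
  unfolding eventually_at_left_field eventually_at_right_field
  by (rule exI[of _ 0], simp)+

section \<open>Pieces of a regular direction set and their points at infinity\<close>

context branches
begin

interpretation B: Metric_space "mspace BA" "mdist BA" by simp

text \<open>The point \<open>w\<close> is turned to the ray at constant modulus and the motion is
  lifted to the sheet. The height does not change, so the cost is the angle. Points of a sheet whose
  directions tend to \<open>u\<close> are thus asymptotic to the lifted ray.\<close>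

lemma dist_to_arc:
  assumes "a \<in> rts p" "w \<in> Sec"
  shows "pullback_dist p (g a w) (arc_pt a (height (cmod w))) \<le> \<bar>Arg (sgn w / u)\<bar>"
proof -
  define \<alpha> where "\<alpha> = Arg (sgn w / u)"
  have wnz: "w \<noteq> 0" and wd: "dist (sgn w) u < \<delta>" using assms(2) by (auto simp: sector_def)
  have "norm (sgn w / u) = 1" using wnz norm_u by (simp add: norm_divide norm_sgn)
  then have cis: "u * cis \<alpha> = sgn w" using u_nz by (simp add: \<alpha>_def cis_Arg_norm1)
  have \<alpha>: "\<bar>\<alpha>\<bar> \<le> pi" using Arg_bounded[of "sgn w / u"] by (auto simp: \<alpha>_def)
  define v where "v = (\<lambda>s. complex_of_real (cmod w) * (u * cis ((1 - s) * \<alpha>)))"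
  have sgn_v: "sgn (v s) = u * cis ((1 - s) * \<alpha>)" "cmod (v s) = cmod w" for s
    using wnz norm_u sgn_mult_pos[of "cmod w" "u * cis ((1 - s) * \<alpha>)"]
    by (simp_all add: v_def norm_mult sgn_div_norm)
  have "pullback_dist p (g a (v 0)) (g a (v 1)) \<le> \<bar>\<alpha>\<bar>"
  proof (rule dist_along_branch[OF assms(1)])
    show "continuous_on {0..1} v" unfolding v_def cis_conv_exp by (intro continuous_intros)
    show "v ` {0..1} \<subseteq> Sec"
    proof
      fix y assume "y \<in> v ` {0..1}"
      then obtain s where s: "s \<in> {0..1}" "y = v s" by blast
      have "\<bar>(1 - s) * \<alpha>\<bar> \<le> 1 * \<bar>\<alpha>\<bar>" unfolding abs_mult using s by (intro mult_right_mono) auto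
      then have "norm (cis ((1 - s) * \<alpha>) - 1) \<le> norm (cis \<alpha> - 1)" using \<alpha> by (intro norm_cis_minus_1_mono) auto
      moreover have "dist (u * c) u = norm (c - 1)" for c
      proof -
        have "u * c - u = u * (c - 1)" by (simp add: algebra_simps)
        then show ?thesis by (simp add: dist_norm norm_mult norm_u)
      qed
      ultimately have "dist (sgn (v s)) u \<le> dist (sgn w) u" unfolding sgn_v by (metis cis)
      moreover have "v s \<noteq> 0" using sgn_v(2)[of s] wnz by auto
      ultimately show "y \<in> Sec" using wd s by (simp add: sector_def)
    qed
    show "\<bar>\<alpha>\<bar>-lipschitz_on {0..1} (iA \<circ> v)"
    proof (rule lipschitz_onI)
      fix s t :: real
      have "dist ((iA \<circ> v) s) ((iA \<circ> v) t) = dist (u * cis ((1 - s) * \<alpha>)) (u * cis ((1 - t) * \<alpha>))"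
        by (simp add: iA_eq sgn_v dist_Pair_Pair)
      also have "\<dots> = dist (cis ((1 - s) * \<alpha>)) (cis ((1 - t) * \<alpha>))"
        unfolding dist_norm right_diff_distrib[symmetric] by (simp add: norm_mult norm_u)
      also have "\<dots> \<le> \<bar>(1 - s) * \<alpha> - (1 - t) * \<alpha>\<bar>" by (rule dist_cis_le)
      also have "(1 - s) * \<alpha> - (1 - t) * \<alpha> = (t - s) * \<alpha>" by (simp add: algebra_simps)
      also have "\<bar>(t - s) * \<alpha>\<bar> = \<bar>\<alpha>\<bar> * dist s t" by (simp add: abs_mult dist_real_def abs_minus_commute mult.commute)
      finally show "dist ((iA \<circ> v) s) ((iA \<circ> v) t) \<le> \<bar>\<alpha>\<bar> * dist s t" .
    qed simp
  qed
  moreover have "v 0 = w" using norm_mult_sgn[of w] by (simp add: v_def cis)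
  moreover have "g a (v 1) = arc_pt a (height (cmod w))" by (simp add: v_def arc_pt_def radius_height)
  ultimately show ?thesis by (simp add: \<alpha>_def)
qed

lemma arc_pt_notin_rts: "a \<in> rts p \<Longrightarrow> t \<in> {-1<..<1} \<Longrightarrow> arc_pt a t \<notin> rts p"
  using sheetD(3) arc_pt_sheet by blast

lemma mdist_arc_pt:
  assumes "a \<in> rts p" "t \<in> {-1<..<1}" "t' \<in> {-1<..<1}"
  shows "mdist BA (emb p (arc_pt a t)) (emb p (arc_pt a t')) \<le> \<bar>t - t'\<bar>"
  using dist_arc_pt[OF assms] emb_dist arc_pt_notin_rts assms by simp

lemma arc_limit:
  assumes "a \<in> rts p" "F \<noteq> bot" "((\<lambda>t. t) \<longlongrightarrow> c) F" "\<forall>\<^sub>F t in F. t \<in> {-1<..<1}"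
  obtains x where "limitin (btop p) (\<lambda>t. emb p (arc_pt a t)) x F"
proof -
  have "\<exists>P. eventually P F \<and> (\<forall>x y. P x \<longrightarrow> P y \<longrightarrow> emb p (arc_pt a x) \<in> mspace BA \<and>
      mdist BA (emb p (arc_pt a x)) (emb p (arc_pt a y)) < e)" if e: "0 < e" for e
  proof (intro exI[of _ "\<lambda>t. t \<in> {-1<..<1} \<and> dist t c < e / 2"] conjI allI impI)
    show "\<forall>\<^sub>F t in F. t \<in> {-1<..<1} \<and> dist t c < e / 2"
      using assms(4) tendstoD[OF assms(3), of "e / 2"] e by (auto elim: eventually_elim2)
    fix x y assume xy: "x \<in> {-1<..<1} \<and> dist x c < e / 2" "y \<in> {-1<..<1} \<and> dist y c < e / 2"
    then show "emb p (arc_pt a x) \<in> mspace BA" using emb_in arc_pt_notin_rts assms(1) by blast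
    have "\<bar>x - c\<bar> < e / 2" "\<bar>y - c\<bar> < e / 2" using xy by (auto simp: dist_real_def)
    then have "\<bar>x - y\<bar> < e" by linarith
    then show "mdist BA (emb p (arc_pt a x)) (emb p (arc_pt a y)) < e"
      using mdist_arc_pt[OF assms(1), of x y] xy by auto
  qed
  from Cauchy_filter_limit[OF assms(2) this] show ?thesis using that by blast
qed

definition arc_end :: "complex \<Rightarrow> bpoint" where
  "arc_end a = (SOME x. limitin (btop p) (\<lambda>t. emb p (arc_pt a t)) x (at_left 1))"

lemma arc_end_limit:
  assumes "a \<in> rts p"
  shows "limitin (btop p) (\<lambda>t. emb p (arc_pt a t)) (arc_end a) (at_left 1)"
proof -
  have "\<exists>x. limitin (btop p) (\<lambda>t. emb p (arc_pt a t)) x (at_left 1)"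
    by (rule arc_limit[OF assms, of "at_left 1" 1]) (use eventually_unit(1) in \<open>auto simp: tendsto_ident_at\<close>)
  then show ?thesis unfolding arc_end_def by (rule someI_ex)
qed

lemma arc_end_in: "a \<in> rts p \<Longrightarrow> arc_end a \<in> mspace BA"
  using arc_end_limit unfolding limitin_btop by blast

text \<open>The closure is taken in the completion, so a piece includes boundary points. Pieces
  stand in for the components of \<open>Dir p u\<close>: they are a distance \<delta> apart, and
  each has exactly one point on the circle at infinity, namely \<open>arc_end a\<close>.\<close>

definition piece :: "complex \<Rightarrow> bpoint set" where
  "piece a = Dir p u \<inter> btop p closure_of (emb p ` sheet a)"

lemma Dir_D: "x \<in> Dir p u \<Longrightarrow> x \<in> mspace BA \<and> fst (pA p x) = u"
  by (auto simp: Dir_def)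

lemma Dir_I: "x \<in> mspace BA \<Longrightarrow> fst (pA p x) = u \<Longrightarrow> x \<in> Dir p u"
  using pA_in_annulus[of x] by (cases "pA p x") (auto simp: Dir_def annulus_def)

lemma dist_sgn_near_Dir:
  assumes "x \<in> Dir p u" "z \<notin> rts p" shows "dist (sgn (poly p z)) u \<le> mdist BA x (emb p z)"
proof -
  have "dist u (sgn (poly p z)) = dist (fst (pA p x)) (fst (iA (poly p z)))"
    using Dir_D[OF assms(1)] by (simp add: iA_eq)
  also have "\<dots> \<le> dist (pA p x) (iA (poly p z))" by (rule dist_fst_le)
  also have "\<dots> \<le> mdist BA x (emb p z)" using pA_dist Dir_D assms by blast
  finally show ?thesis by (simp add: dist_commute)
qed

lemma near_Dir_in_sheet:
  assumes "x \<in> Dir p u" "z \<notin> rts p" "mdist BA x (emb p z) < \<delta>"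
  shows "\<exists>a\<in>rts p. z \<in> sheet a"
proof -
  have "poly p z \<in> Sec" using dist_sgn_near_Dir[OF assms(1,2)] assms(2,3) by (auto simp: sector_def rts_def)
  then show ?thesis by (rule sheets_cover)
qed

lemma pieces_cover:
  assumes "x \<in> Dir p u" obtains a where "a \<in> rts p" "x \<in> piece a"
proof -
  have "x \<in> btop p closure_of (\<Union>a\<in>rts p. emb p ` sheet a)"
  proof -
    have "\<exists>z\<in>(\<Union>a\<in>rts p. sheet a). emb p z \<in> mspace BA \<and> mdist BA x (emb p z) < e" if "0 < e" for e :: real
    proof -
      obtain z where z: "z \<notin> rts p" "mdist BA x (emb p z) < min e \<delta>"
        using emb_dense[of x "min e \<delta>"] Dir_D[OF assms] \<open>0 < e\<close> delta_pos by (metis min_less_iff_conj)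
      then obtain a where "a \<in> rts p" "z \<in> sheet a" using near_Dir_in_sheet[OF assms, of z] by auto
      then show ?thesis using z emb_in by auto
    qed
    then have "x \<in> btop p closure_of (emb p ` (\<Union>a\<in>rts p. sheet a))"
      unfolding in_closure_emb using Dir_D[OF assms] by blast
    then show ?thesis by (simp add: image_UN)
  qed
  \<comment> \<open>Closure commutes with the union because there are only finitely many
    sheets.\<close>
  then have "x \<in> (\<Union>a\<in>rts p. btop p closure_of (emb p ` sheet a))"
    using closure_of_Union[of "(\<lambda>a. emb p ` sheet a) ` rts p" "btop p"] finite_rts by auto
  then show ?thesis using that assms by (auto simp: piece_def)
qed

text \<open>The point \<open>y\<close> need not lie over \<open>u\<close>: only the approximants of
  \<open>x\<close> must have directions tending to \<open>u\<close>. This permits comparison with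
  points over a nearby direction and with points of the plane.\<close>

lemma piece_separation:
  assumes "a \<in> rts p" "b \<in> rts p" "a \<noteq> b" "x \<in> piece a" "y \<in> btop p closure_of (emb p ` sheet b)"
  shows "\<delta> \<le> mdist BA x y"
proof (rule field_le_epsilon)
  fix e :: real assume "0 < e"
  have x: "x \<in> Dir p u" "x \<in> btop p closure_of (emb p ` sheet a)" using assms(4) by (auto simp: piece_def)
  \<comment> \<open>Thirds, because the error at \<open>x\<close> is paid twice, in the metric and
    in the direction of \<open>p\<close>, and the error at \<open>y\<close> once.\<close>
  then obtain z where z: "z \<in> sheet a" "mdist BA x (emb p z) < e / 3"
    unfolding in_closure_emb using \<open>0 < e\<close> by (meson divide_pos_pos zero_less_numeral)
  obtain z' where z': "z' \<in> sheet b" "mdist BA y (emb p z') < e / 3"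
    using assms(5) unfolding in_closure_emb using \<open>0 < e\<close> by (meson divide_pos_pos zero_less_numeral)
  have nr: "z \<notin> rts p" "z' \<notin> rts p" using sheetD(3) z z' assms(1,2) by blast+
  have M: "x \<in> mspace BA" "y \<in> mspace BA" using x assms(5) unfolding in_closure_emb by blast+
  have "\<delta> - dist (sgn (poly p z)) u \<le> mdist BA (emb p z) (emb p z')"
    using sheet_separation[OF assms(1-3) z(1) z'(1)] nr by (simp add: emb_dist)
  also have "\<dots> \<le> mdist BA (emb p z) x + mdist BA x (emb p z')" by (intro B.triangle M emb_in nr)
  also have "mdist BA x (emb p z') \<le> mdist BA x y + mdist BA y (emb p z')" by (intro B.triangle M emb_in nr)
  finally show "\<delta> \<le> mdist BA x y + e"
    using dist_sgn_near_Dir[OF x(1) nr(1)] z(2) z'(2) B.commute[of x "emb p z"] by linarith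
qed

lemma piece_unique:
  assumes "a \<in> rts p" "b \<in> rts p" "x \<in> piece a" "x \<in> piece b" shows "a = b"
proof (rule ccontr)
  assume "a \<noteq> b"
  then have "\<delta> \<le> mdist BA x x" using piece_separation assms by (auto simp: piece_def)
  moreover have "x \<in> mspace BA" using assms(3) Dir_D by (auto simp: piece_def)
  ultimately show False using delta_pos by simp
qed

text \<open>On the direction set the closures of the sheets form finitely many disjoint closed sets,
  so a connected subset meets just one of them.\<close>

lemma connected_in_one_piece:
  assumes "connectedin (btop p) C" "C \<subseteq> Dir p u" "a \<in> rts p" "b \<in> rts p" "x \<in> C" "y \<in> C" "x \<in> piece a" "y \<in> piece b"
  shows "a = b"
proof (rule ccontr)
  assume "a \<noteq> b"
  let ?K = "\<lambda>c. btop p closure_of (emb p ` sheet c)"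
  let ?L = "\<Union>c\<in>rts p - {a}. ?K c"
  have "closedin (btop p) (?K a)" by simp
  moreover have "closedin (btop p) ?L" using finite_rts by (intro closedin_Union) auto
  moreover have "C \<subseteq> ?K a \<union> ?L"
  proof
    fix z assume "z \<in> C"
    then obtain c where "c \<in> rts p" "z \<in> piece c" using pieces_cover assms(2) by blast
    then show "z \<in> ?K a \<union> ?L" by (cases "c = a") (auto simp: piece_def)
  qed
  moreover have "?K a \<inter> ?L \<inter> C = {}"
  proof -
    have "False" if "z \<in> C" "z \<in> ?K a" "c \<in> rts p" "c \<noteq> a" "z \<in> ?K c" for z c
      using piece_unique[OF assms(3) that(3), of z] that assms(2) by (auto simp: piece_def)
    then show ?thesis by blast
  qed
  moreover have "?K a \<inter> C \<noteq> {}" "?L \<inter> C \<noteq> {}"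
    using assms \<open>a \<noteq> b\<close> by (auto simp: piece_def)
  ultimately show False using assms(1) unfolding connectedin_closedin by metis
qed

text \<open>A sequence tending to \<open>a\<close> eventually lies in the open image of the keyhole
  under \<open>g a\<close>, and convergence to a point over \<open>u\<close> forces its values under
  \<open>p\<close> into the sector. Here the disc of the keyhole connects the name of a sheet with
  the root circle.\<close>

lemma root_circle_piece:
  assumes "a \<in> rts p" "y \<in> root_circle p a" "y \<in> Dir p u" shows "y \<in> piece a"
proof -
  obtain \<zeta> where \<zeta>: "range \<zeta> \<subseteq> - rts p" "\<zeta> \<longlonglongrightarrow> a" "limitin (btop p) (emb p \<circ> \<zeta>) y sequentially"
    using assms(2) unfolding root_circle_def by blast
  have nr: "\<zeta> n \<notin> rts p" for n using \<zeta>(1) by auto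
  have zero: "0 \<in> keyhole u \<delta> \<epsilon>" using eps_pos by (simp add: keyhole_def)
  have "open (g a ` keyhole u \<delta> \<epsilon>)" by (rule open_branch_image[OF assms(1) order_refl open_keyhole])
  moreover have "a \<in> g a ` keyhole u \<delta> \<epsilon>" using g_0[OF assms(1)] zero by force
  ultimately have ev1: "\<forall>\<^sub>F n in sequentially. \<zeta> n \<in> g a ` keyhole u \<delta> \<epsilon>"
    using \<zeta>(2) topological_tendstoD by blast
  have "\<exists>z\<in>sheet a. emb p z \<in> mspace BA \<and> mdist BA y (emb p z) < e" if "0 < e" for e
  proof -
    have "\<forall>\<^sub>F n in sequentially. mdist BA (emb p (\<zeta> n)) y < min e \<delta>"
      using \<zeta>(3) that delta_pos unfolding limitin_btop o_def
      by (auto elim!: allE[of _ "min e \<delta>"] eventually_mono)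
    then have "\<forall>\<^sub>F n in sequentially. \<zeta> n \<in> g a ` keyhole u \<delta> \<epsilon> \<and> mdist BA (emb p (\<zeta> n)) y < min e \<delta>"
      using ev1 by (rule eventually_elim2) blast
    then obtain n where n: "\<zeta> n \<in> g a ` keyhole u \<delta> \<epsilon>" "mdist BA (emb p (\<zeta> n)) y < min e \<delta>"
      unfolding eventually_sequentially by blast
    then have "poly p (\<zeta> n) \<in> keyhole u \<delta> \<epsilon>" "\<zeta> n = g a (poly p (\<zeta> n))"
      using g_inv[OF assms(1)] by auto
    moreover have "poly p (\<zeta> n) \<in> Sec"
      using dist_sgn_near_Dir[OF assms(3) nr, of n] n(2) B.commute[of y] nr[of n]
      by (auto simp: sector_def rts_def)
    ultimately have "\<zeta> n \<in> sheet a" unfolding sheet_def by blast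
    then show ?thesis using n(2) emb_in[OF nr] B.commute[of y] by auto
  qed
  moreover have "y \<in> mspace BA" using Dir_D[OF assms(3)] by blast
  ultimately have "y \<in> btop p closure_of (emb p ` sheet a)" by (simp add: in_closure_emb)
  then show ?thesis using assms(3) by (simp add: piece_def)
qed

lemma joined_imp_piece:
  assumes "a \<in> rts p" "joined p u a x" shows "x \<in> piece a"
proof -
  obtain y C where y: "y \<in> root_circle p a" and C: "connectedin (subtopology (btop p) (Dir p u)) C" "y \<in> C" "x \<in> C"
    using assms(2) unfolding joined_def connected_component_of_def by blast
  then have C': "connectedin (btop p) C" "C \<subseteq> Dir p u" by (auto simp: connectedin_subtopology)
  then obtain b where b: "b \<in> rts p" "x \<in> piece b" using pieces_cover C(3) by blast
  have "y \<in> piece a" using root_circle_piece[OF assms(1) y] C(2) C'(2) by blast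
  then have "a = b" using connected_in_one_piece[OF C' assms(1) b(1) C(2,3)] b(2) by blast
  then show ?thesis using b by simp
qed

lemma pA_arc_limit:
  assumes "a \<in> rts p" "F \<noteq> bot" "((\<lambda>t. t) \<longlongrightarrow> c) F" "\<forall>\<^sub>F t in F. t \<in> {-1<..<1}"
    "limitin (btop p) (\<lambda>t. emb p (arc_pt a t)) x F"
  shows "pA p x = (u, c)" "x \<in> Dir p u"
proof -
  have "((\<lambda>t. iA (poly p (arc_pt a t))) \<longlongrightarrow> pA p x) F"
    by (rule pA_lim[OF assms(5)]) (use assms(4) arc_pt_notin_rts[OF assms(1)] in \<open>auto elim: eventually_mono\<close>)
  moreover have "\<forall>\<^sub>F t in F. (u, t) = iA (poly p (arc_pt a t))"
    using assms(4) by eventually_elim (simp only: poly_arc_pt[OF assms(1)] iA_ray)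
  then have "((\<lambda>t. iA (poly p (arc_pt a t))) \<longlongrightarrow> (u, c)) F"
    by (rule Lim_transform_eventually[rotated]) (intro tendsto_intros assms(3))
  ultimately show "pA p x = (u, c)" using assms(2) tendsto_unique by blast
  then show "x \<in> Dir p u" using assms(5) by (intro Dir_I) (auto simp: limitin_btop)
qed

lemma norm_arc_pt_tendsto: 
  assumes "a \<in> rts p" shows "filterlim (arc_pt a) at_infinity (at_left 1)"
  unfolding filterlim_at_infinity[OF order_refl]
proof (intro allI impI)
  fix r :: real assume "0 < r"
  have "compact (poly p ` cball 0 r)" by (intro compact_continuous_image continuous_intros compact_cball)
  then obtain M where M: "\<And>z. z \<in> cball 0 r \<Longrightarrow> norm (poly p z) \<le> M"
    by (meson bounded_iff compact_imp_bounded imageI)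
  have "\<forall>\<^sub>F t in at_left 1. M < radius t"
    using radius_at_left_1 by (simp add: filterlim_at_top_dense)
  then show "\<forall>\<^sub>F t in at_left 1. r \<le> norm (arc_pt a t)" using eventually_unit(1)
  proof eventually_elim
    case (elim t)
    have "norm (poly p (arc_pt a t)) = radius t"
      using poly_arc_pt[OF assms elim(2)] radius_pos[OF elim(2)] by (simp add: norm_mult norm_u)
    then have "arc_pt a t \<notin> cball 0 r" using M elim(1) by fastforce
    then show ?case by simp
  qed
qed

lemma arc_pt_at_root:
  assumes "a \<in> rts p" shows "(arc_pt a \<longlongrightarrow> a) (at_right (-1))"
proof -
  have K: "0 \<in> keyhole u \<delta> \<epsilon>" using eps_pos by (simp add: keyhole_def)
  then have cont: "isCont (g a) 0" using g_cont[OF assms] open_keyhole continuous_on_eq_continuous_at by blast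
  have "((\<lambda>t. complex_of_real (radius t) * u) \<longlongrightarrow> complex_of_real 0 * u) (at_right (-1))"
    by (intro tendsto_intros radius_at_right)
  then have lim: "((\<lambda>t. complex_of_real (radius t) * u) \<longlongrightarrow> 0) (at_right (-1))" by simp
  have "((\<lambda>t. g a (complex_of_real (radius t) * u)) \<longlongrightarrow> g a 0) (at_right (-1))"
    by (rule isCont_tendsto_compose[OF cont lim])
  then show ?thesis using g_0[OF assms] by (simp add: arc_pt_def[abs_def])
qed

lemma connectedin_arc: "a \<in> rts p \<Longrightarrow> connectedin (btop p) ((\<lambda>t. emb p (arc_pt a t)) ` {-1<..<1})"
proof -
  assume a: "a \<in> rts p"
  have "Lipschitz_continuous_map (submetric euclidean_metric {-1<..<1}) BA (\<lambda>t. emb p (arc_pt a t))"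
    unfolding Lipschitz_continuous_map_def
  proof (intro conjI exI[of _ 1] ballI)
    show "(\<lambda>t. emb p (arc_pt a t)) \<in> mspace (submetric euclidean_metric {-1<..<1}) \<rightarrow> mspace BA"
      using arc_pt_notin_rts[OF a] emb_in by auto
  qed (use mdist_arc_pt[OF a] in \<open>auto simp: dist_real_def\<close>)
  then have "continuous_map (top_of_set {-1<..<1}) (btop p) (\<lambda>t. emb p (arc_pt a t))"
    using Lipschitz_continuous_imp_continuous_map by (fastforce simp: mtopology_of_submetric)
  then show ?thesis by (rule connectedin_continuous_map_image) simp
qed

lemma arc_end_Dir: "a \<in> rts p \<Longrightarrow> arc_end a \<in> Dir p u"
  by (rule pA_arc_limit(2)[of a "at_left 1" 1])
     (use eventually_unit(1) arc_end_limit in \<open>auto simp: tendsto_ident_at\<close>)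

text \<open>The lifted ray has limits at both ends; at height -1 the limit lies on the root circle,
  since the ray tends to \<open>a\<close> in the plane. Adding both limits keeps the set connected,
  as it lies between a connected set and its closure.\<close>

lemma joined_arc_end:
  assumes a: "a \<in> rts p" shows "joined p u a (arc_end a)"
proof -
  let ?f = "\<lambda>t. emb p (arc_pt a t)"
  let ?S = "?f ` {-1<..<1}"
  obtain y where y: "limitin (btop p) ?f y (at_right (-1))"
    by (rule arc_limit[OF a, of "at_right (-1)" "-1"]) (use eventually_unit(2) in \<open>auto simp: tendsto_ident_at\<close>)
  have yD: "y \<in> Dir p u"
    by (rule pA_arc_limit(2)[OF a _ _ _ y, of "-1"]) (use eventually_unit(2) in \<open>auto simp: tendsto_ident_at\<close>)
  have "y \<in> root_circle p a"
  proof -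
    define t where "t = (\<lambda>n. -1 + inverse (real (Suc n)))"
    have "filterlim t (at_right (-1)) sequentially"
      unfolding t_def by real_asymp
    moreover have t: "t n \<in> {-1<..<1}" for n
    proof -
      have "0 < inverse (real (Suc n))" "inverse (real (Suc n)) \<le> 1" by (auto simp: field_simps)
      then show ?thesis by (simp add: t_def)
    qed
    moreover have "limitin (btop p) (emb p \<circ> (\<lambda>n. arc_pt a (t n))) y sequentially"
      unfolding limitin_btop o_def
    proof (intro conjI allI impI)
      show "y \<in> mspace BA" using Dir_D yD by blast
      fix e :: real assume "0 < e"
      then have "\<forall>\<^sub>F s in at_right (-1). ?f s \<in> mspace BA \<and> mdist BA (?f s) y < e"
        using y unfolding limitin_btop by blast
      then show "\<forall>\<^sub>F n in sequentially. ?f (t n) \<in> mspace BA \<and> mdist BA (?f (t n)) y < e"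
        by (rule eventually_compose_filterlim) fact
    qed
    ultimately show ?thesis
      unfolding root_circle_def using arc_pt_notin_rts[OF a]
      by (intro CollectI exI[of _ "\<lambda>n. arc_pt a (t n)"] conjI) (auto intro: filterlim_compose[OF arc_pt_at_root[OF a]])
  qed
  moreover have "connected_component_of (subtopology (btop p) (Dir p u)) y (arc_end a)"
    unfolding connected_component_of_def connectedin_subtopology
  proof (intro exI[of _ "?S \<union> {y, arc_end a}"] conjI)
    have "?S \<subseteq> Dir p u"
      using a arc_pt_notin_rts emb_in
      by (auto intro!: Dir_I simp: pA_emb poly_arc_pt iA_ray)
    then show "?S \<union> {y, arc_end a} \<subseteq> Dir p u" using yD arc_end_Dir[OF a] by simp
    have "y \<in> btop p closure_of ?S" "arc_end a \<in> btop p closure_of ?S"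
      by (rule limit_in_closure[OF y] limit_in_closure[OF arc_end_limit[OF a]],
          simp, use eventually_unit in \<open>auto elim: eventually_mono\<close>)+
    moreover have "?S \<subseteq> btop p closure_of ?S"
      using a arc_pt_notin_rts emb_in by (intro closure_of_subset) (auto simp: btop_eq)
    ultimately show "connectedin (btop p) (?S \<union> {y, arc_end a})"
      by (intro connectedin_intermediate_closure_of[OF connectedin_arc[OF a]]) auto
  qed auto
  ultimately show ?thesis unfolding joined_def by blast
qed

lemma arc_end_circle:
  assumes a: "a \<in> rts p" shows "arc_end a \<in> circle_at_infinity p"
proof -
  let ?f = "\<lambda>t. emb p (arc_pt a t)"
  define t where "t = (\<lambda>n. 1 - inverse (real (Suc n)))"
  have t_lim: "filterlim t (at_left 1) sequentially" unfolding t_def by real_asymp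
  moreover have t: "t n \<in> {-1<..<1}" for n
  proof -
    have "0 < inverse (real (Suc n))" "inverse (real (Suc n)) \<le> 1" by (auto simp: field_simps)
    then show ?thesis by (simp add: t_def)
  qed
  moreover have "limitin (btop p) (emb p \<circ> (\<lambda>n. arc_pt a (t n))) (arc_end a) sequentially"
    unfolding limitin_btop o_def
  proof (intro conjI allI impI arc_end_in[OF a])
    fix e :: real assume "0 < e"
    then have "\<forall>\<^sub>F s in at_left 1. ?f s \<in> mspace BA \<and> mdist BA (?f s) (arc_end a) < e"
      using arc_end_limit[OF a] unfolding limitin_btop by blast
    then show "\<forall>\<^sub>F n in sequentially. ?f (t n) \<in> mspace BA \<and> mdist BA (?f (t n)) (arc_end a) < e"
      by (rule eventually_compose_filterlim) (rule t_lim)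
  qed
  ultimately show ?thesis
    unfolding circle_at_infinity_def using arc_pt_notin_rts[OF a]
    by (intro CollectI exI[of _ "\<lambda>n. arc_pt a (t n)"] conjI) (auto intro: filterlim_compose[OF norm_arc_pt_tendsto[OF a]])
qed

text \<open>A sequence that defines \<open>x\<close> is replaced by points of the lifted ray of the
  same heights. Its directions tend to \<open>u\<close>, so by \<open>dist_to_arc\<close> the
  replacement moves each point by an amount tending to 0; as the heights tend to 1, the new sequence
  converges to \<open>arc_end a\<close>.\<close>

lemma piece_circle_unique:
  assumes a: "a \<in> rts p" and x: "x \<in> piece a" "x \<in> circle_at_infinity p"
  shows "x = arc_end a"
proof -
  obtain \<zeta> where \<zeta>: "range \<zeta> \<subseteq> - rts p" "filterlim \<zeta> at_infinity sequentially"
    "limitin (btop p) (emb p \<circ> \<zeta>) x sequentially"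
    using x(2) unfolding circle_at_infinity_def by blast
  have nr: "\<zeta> n \<notin> rts p" for n using \<zeta>(1) by auto
  have xD: "x \<in> Dir p u" "x \<in> mspace BA" "fst (pA p x) = u" using x(1) Dir_D by (auto simp: piece_def)
  define w where "w = (\<lambda>n. poly p (\<zeta> n))"
  define t where "t = (\<lambda>n. height (cmod (w n)))"
  have lim: "limitin (btop p) (\<lambda>n. emb p (\<zeta> n)) x sequentially" using \<zeta>(3) by (simp add: o_def)
  have iA_lim: "(\<lambda>n. iA (w n)) \<longlonglongrightarrow> pA p x"
    unfolding w_def by (rule pA_lim[OF lim]) (simp add: nr)
  have sgn_lim: "(\<lambda>n. sgn (w n)) \<longlonglongrightarrow> u"
    using tendsto_fst[OF iA_lim] xD(3) by (simp add: iA_eq)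
  \<comment> \<open>Closer than \<delta> to a point of piece \<open>a\<close> no other sheet
    occurs.\<close>
  have in_sheet: "\<forall>\<^sub>F n in sequentially. \<zeta> n \<in> sheet a"
  proof -
    have "\<forall>\<^sub>F n in sequentially. mdist BA (emb p (\<zeta> n)) x < \<delta>"
      using lim delta_pos unfolding limitin_btop by (auto elim!: allE[of _ \<delta>] eventually_mono)
    then show ?thesis
    proof eventually_elim
      case (elim n)
      then have lt: "mdist BA x (emb p (\<zeta> n)) < \<delta>" by (simp add: B.commute)
      then obtain b where b: "b \<in> rts p" "\<zeta> n \<in> sheet b" using near_Dir_in_sheet[OF xD(1) nr] by blast
      have "emb p (\<zeta> n) \<in> btop p closure_of (emb p ` sheet b)"
        unfolding in_closure_emb using b emb_in[OF nr] by (auto intro!: bexI[of _ "\<zeta> n"])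
      then have "a = b" using piece_separation[OF a b(1) _ x(1)] lt by (meson not_le)
      then show ?case using b by simp
    qed
  qed
  have t_lim: "filterlim t (at_left 1) sequentially"
  proof -
    have "filterlim (\<lambda>n. norm (w n)) at_top sequentially" unfolding w_def
      by (rule filterlim_compose[OF filterlim_at_infinity_imp_norm_at_top[OF poly_at_infinity] \<zeta>(2)])
    then have "t \<longlonglongrightarrow> 1" unfolding t_def by (rule filterlim_compose[OF height_tendsto])
    then show ?thesis unfolding filterlim_at t_def using height_bounds(2) by (auto intro: always_eventually simp: less_imp_neq)
  qed
  have arc_lim: "limitin (btop p) (\<lambda>n. emb p (arc_pt a (t n))) (arc_end a) sequentially"
    unfolding limitin_btop
  proof (intro conjI allI impI arc_end_in[OF a])
    fix e :: real assume "0 < e"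
    then have "\<forall>\<^sub>F s in at_left 1. emb p (arc_pt a s) \<in> mspace BA \<and> mdist BA (emb p (arc_pt a s)) (arc_end a) < e"
      using arc_end_limit[OF a] unfolding limitin_btop by blast
    then show "\<forall>\<^sub>F n in sequentially. emb p (arc_pt a (t n)) \<in> mspace BA \<and> mdist BA (emb p (arc_pt a (t n))) (arc_end a) < e"
      by (rule eventually_compose_filterlim) (rule t_lim)
  qed
  have t_in: "t n \<in> {-1<..<1}" for n
    using height_bounds(2,3)[of "cmod (w n)"] nr[of n] by (simp add: t_def w_def rts_def)
  have "limitin (btop p) (\<lambda>n. emb p (arc_pt a (t n))) x sequentially"
  proof (rule limitin_btop_close[OF lim])
    show "\<forall>\<^sub>F n in sequentially. emb p (arc_pt a (t n)) \<in> mspace BA"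
      using t_in arc_pt_notin_rts[OF a] emb_in by simp
    have "(\<lambda>n. sgn (w n) / u) \<longlonglongrightarrow> 1" using tendsto_divide[OF sgn_lim tendsto_const u_nz] u_nz by simp
    then have A0: "(\<lambda>n. \<bar>Arg (sgn (w n) / u)\<bar>) \<longlonglongrightarrow> 0" using Arg_tendsto_0 tendsto_rabs_zero by blast
    show "(\<lambda>n. mdist BA (emb p (\<zeta> n)) (emb p (arc_pt a (t n)))) \<longlonglongrightarrow> 0"
    proof (rule tendsto_sandwich[OF _ _ tendsto_const A0])
      show "\<forall>\<^sub>F n in sequentially. mdist BA (emb p (\<zeta> n)) (emb p (arc_pt a (t n))) \<le> \<bar>Arg (sgn (w n) / u)\<bar>"
        using in_sheet
      proof eventually_elim
        case (elim n)
        then show ?case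
          using dist_to_arc[OF a sheetD(1)[OF elim a]] sheetD(2)[OF elim a] nr[of n] arc_pt_notin_rts[OF a t_in[of n]]
          by (simp add: emb_dist w_def t_def)
      qed
    qed simp
  qed
  then show ?thesis using limitin_btop_unique[OF _ arc_lim] by simp
qed

lemma arc_end_piece: "a \<in> rts p \<Longrightarrow> arc_end a \<in> piece a"
  using joined_imp_piece joined_arc_end by blast

text \<open>Since \<open>p\<close> has the constant direction \<open>u\<close> on the lifted ray,
  the \<open>d\<close>-th power of the direction in the plane converges, and continuity selects one
  \<open>d\<close>-th root. The lifted ray then becomes close, in the pullback metric, to the
  straight ray in that limiting direction, so both end at the same point.\<close>

lemma arc_asymptotics:
  assumes a: "a \<in> rts p"
  obtains \<phi> where "asymp_dir \<phi> = u" "((\<lambda>t. sgn (arc_pt a t)) \<longlongrightarrow> cis \<phi>) (at_left 1)" "arc_end a = inf_pt p \<phi>"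
proof -
  let ?s = "sgn (lead_coeff p)" and ?d = "degree p"
  have snz: "?s \<noteq> 0" using norm_sgn_lc by auto
  have inf: "filterlim (arc_pt a) at_infinity (at_left 1)" by (rule norm_arc_pt_tendsto[OF a])
  have nz: "\<forall>\<^sub>F t in at_left 1. arc_pt a t \<noteq> 0"
  proof -
    have "\<forall>\<^sub>F t in at_left 1. 1 \<le> norm (arc_pt a t)"
      using inf unfolding filterlim_at_infinity[OF order_refl] by simp
    then show ?thesis by eventually_elim auto
  qed
  obtain c where c: "c < 1" "\<And>t. c < t \<Longrightarrow> t < 1 \<Longrightarrow> arc_pt a t \<noteq> 0"
    using nz unfolding eventually_at_left_field by blast
  \<comment> \<open>The lifted ray may pass through 0, where \<open>sgn\<close> is discontinuous;
    beyond \<open>b\<close> it no longer does.\<close>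
  define b where "b = max c (-1)"
  have b: "b < 1" "\<And>t. t \<in> {b<..<1} \<Longrightarrow> arc_pt a t \<noteq> 0" "{b<..<1} \<subseteq> {-1<..<1}" using c by (auto simp: b_def)
  have cont: "continuous_on {b<..<1} (\<lambda>t. sgn (arc_pt a t))"
  proof (rule continuous_on_compose2[OF continuous_on_sgn'])
    have "continuous_on {-1<..<1} (arc_pt a)" unfolding arc_pt_def
      by (rule continuous_on_compose2[OF g_cont_sec[OF a]])
         (use radius_pos ray_in_sector in \<open>auto intro!: continuous_intros continuous_on_radius\<close>)
    then show "continuous_on {b<..<1} (arc_pt a)" using b(3) by (rule continuous_on_subset)
  qed (use b in auto)
  have R: "((\<lambda>t. sgn (poly (reflect_poly p) (inverse (arc_pt a t)))) \<longlongrightarrow> ?s) (at_left 1)"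
    by (rule filterlim_compose[OF sgn_reflect_tendsto inf])
  \<comment> \<open>In \<open>sgn_poly_eq\<close> the left side is \<open>u\<close> and the factor
    from the reflected polynomial tends to the sign of the leading coefficient; dividing leaves the
    power of the direction.\<close>
  have "((\<lambda>t. u / sgn (poly (reflect_poly p) (inverse (arc_pt a t)))) \<longlongrightarrow> u / ?s) (at_left 1)"
    by (intro tendsto_intros R snz)
  moreover have "\<forall>\<^sub>F t in at_left 1. u / sgn (poly (reflect_poly p) (inverse (arc_pt a t))) = sgn (arc_pt a t) ^ ?d"
    using nz eventually_unit(1)
  proof eventually_elim
    case (elim t)
    have "sgn (poly p (arc_pt a t)) = u"
      using poly_arc_pt[OF a elim(2)] radius_pos[OF elim(2)] sgn_mult_pos sgn_u by simp
    then have "u = sgn (poly (reflect_poly p) (inverse (arc_pt a t))) * sgn (arc_pt a t) ^ ?d"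
      using sgn_poly_eq[OF elim(1)] by simp
    moreover from this have "sgn (poly (reflect_poly p) (inverse (arc_pt a t))) \<noteq> 0" using u_nz by (metis mult_zero_left)
    ultimately show ?case by (metis nonzero_mult_div_cancel_left)
  qed
  ultimately have pw: "((\<lambda>t. sgn (arc_pt a t) ^ ?d) \<longlongrightarrow> u / ?s) (at_left 1)"
    by (rule Lim_transform_eventually)
  obtain \<zeta> where \<zeta>: "\<zeta> ^ ?d = u / ?s" "((\<lambda>t. sgn (arc_pt a t)) \<longlongrightarrow> \<zeta>) (at_left 1)"
    by (rule power_tendsto_imp_tendsto[OF degree_pos b(1) cont pw]) (use u_nz snz in auto)
  have "norm \<zeta> ^ ?d = 1" using arg_cong[OF \<zeta>(1), of norm] norm_u norm_sgn_lc by (simp add: norm_power norm_divide)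
  then have "norm \<zeta> = 1" using degree_pos power_eq_imp_eq_base[of "norm \<zeta>" ?d 1] by simp
  define \<phi> where "\<phi> = Arg \<zeta>"
  have cis: "cis \<phi> = \<zeta>" using \<open>norm \<zeta> = 1\<close> by (simp add: \<phi>_def cis_Arg_norm1)
  have "asymp_dir \<phi> = ?s * cis \<phi> ^ ?d" by (simp add: asymp_dir_def Complex.DeMoivre)
  then have dir: "asymp_dir \<phi> = u" using \<zeta>(1) snz by (simp add: cis)
  obtain q0 C where C: "0 < q0" "0 < C"
    "\<And>q \<psi>. 0 < q \<Longrightarrow> q \<le> q0 \<Longrightarrow> far_pt q \<psi> \<notin> rts p"
    "\<And>q \<psi> \<theta>. 0 < q \<Longrightarrow> q \<le> q0 \<Longrightarrow> mdist BA (emb p (far_pt q \<psi>)) (inf_pt p \<theta>) \<le> C * (2 * q + \<bar>\<psi> - \<theta>\<bar>)"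
    by (rule inf_pt_near) (rule that)
  define q where "q = (\<lambda>t. inverse (norm (arc_pt a t)))"
  \<comment> \<open>The angle is measured from \<phi>, so that the argument is taken near 1, away
    from the branch cut.\<close>
  define \<alpha> where "\<alpha> = (\<lambda>t. Arg (sgn (arc_pt a t) / cis \<phi>))"
  have far: "far_pt (q t) (\<phi> + \<alpha> t) = arc_pt a t" if "arc_pt a t \<noteq> 0" for t
  proof -
    have "cis (\<alpha> t) = sgn (arc_pt a t) / cis \<phi>" unfolding \<alpha>_def
      by (rule cis_Arg_norm1) (use that in \<open>simp add: norm_divide norm_sgn\<close>)
    then have "cis (\<phi> + \<alpha> t) = sgn (arc_pt a t)" by (simp flip: cis_mult)
    then show ?thesis unfolding q_def far_pt_inverse using norm_mult_sgn by simp
  qed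
  have q_lim: "(q \<longlongrightarrow> 0) (at_left 1)" unfolding q_def
    by (rule tendsto_inverse_0_at_top[OF filterlim_at_infinity_imp_norm_at_top[OF inf]])
  have "((\<lambda>t. sgn (arc_pt a t) / cis \<phi>) \<longlongrightarrow> 1) (at_left 1)"
    using tendsto_divide[OF \<zeta>(2) tendsto_const[of "cis \<phi>"]] by (simp add: cis)
      (metis cis cis_neq_zero divide_self_if)
  then have \<alpha>_lim: "(\<alpha> \<longlongrightarrow> 0) (at_left 1)" unfolding \<alpha>_def by (rule Arg_tendsto_0)
  have "((\<lambda>t. C * (2 * q t + \<bar>\<alpha> t\<bar>)) \<longlongrightarrow> C * (2 * 0 + \<bar>0\<bar>)) (at_left 1)"
    by (intro tendsto_intros q_lim \<alpha>_lim)
  then have bnd: "((\<lambda>t. C * (2 * q t + \<bar>\<alpha> t\<bar>)) \<longlongrightarrow> 0) (at_left 1)" by simp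
  have "((\<lambda>t. mdist BA (emb p (arc_pt a t)) (inf_pt p \<phi>)) \<longlongrightarrow> 0) (at_left 1)"
  proof (rule tendsto_sandwich[OF _ _ tendsto_const bnd])
    have "\<forall>\<^sub>F t in at_left 1. q t < q0" by (rule order_tendstoD(2)[OF q_lim C(1)])
    then show "\<forall>\<^sub>F t in at_left 1. mdist BA (emb p (arc_pt a t)) (inf_pt p \<phi>) \<le> C * (2 * q t + \<bar>\<alpha> t\<bar>)"
      using nz
    proof eventually_elim
      case (elim t)
      then have "0 < q t" by (simp add: q_def)
      then show ?case using C(4)[of "q t" "\<phi> + \<alpha> t" \<phi>] elim far by simp
    qed
  qed simp
  from limitin_btop_close[OF arc_end_limit[OF a] _ this]
  have "limitin (btop p) (\<lambda>t. inf_pt p \<phi>) (arc_end a) (at_left (1::real))" by (simp add: inf_pt_in)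
  moreover have "limitin (btop p) (\<lambda>t. inf_pt p \<phi>) (inf_pt p \<phi>) (at_left (1::real))"
    using inf_pt_in by (simp add: btop_eq)
  ultimately have "arc_end a = inf_pt p \<phi>" by (rule limitin_btop_unique) simp
  with dir \<zeta>(2) show ?thesis using that by (simp add: cis)
qed

end

section \<open>Linear and cyclic orderings\<close>

context nonconstant_poly
begin

definition root_at :: "real \<Rightarrow> complex" where
  "root_at \<theta> = root_joined_to p (asymp_dir \<theta>) (inf_pt p \<theta>)"

lemma asymp_dir_step: "asymp_dir (\<theta> + 2 * pi * real k / real (degree p)) = asymp_dir \<theta>"
  by (rule sym, subst asymp_dir_eq_iff, rule exI[of _ "int k"]) simp

lemma root_at_periodic: "root_at (\<theta> + 2 * pi * real k) = root_at \<theta>"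
proof -
  have "cis (\<theta> + 2 * pi * real k) = cis \<theta> * cis (2 * pi * of_int (int k))" by (simp flip: cis_mult)
  also have "\<dots> = cis \<theta>" by (subst cis_multiple_2pi) auto
  finally have "inf_pt p (\<theta> + 2 * pi * real k) = inf_pt p \<theta>" by (rule inf_pt_cis)
  moreover have "asymp_dir (\<theta> + 2 * pi * real k) = asymp_dir \<theta>"
    using asymp_dir_step[of \<theta> "degree p * k"] degree_pos by (simp add: mult.assoc)
  ultimately show ?thesis by (simp add: root_at_def)
qed

text \<open>The direction has period \<open>2 * pi / d\<close> in the angle, so the angles to be
  read form an arithmetic progression, and the sorted set of the definition can be replaced by an
  explicit list.\<close>

lemma linear_ordering_eq:
  "linear_ordering p \<theta> = map (\<lambda>k. root_at (\<theta> + 2 * pi * real k / real (degree p))) [0..<degree p]"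
proof -
  let ?d = "degree p"
  define f where "f = (\<lambda>k. \<theta> + 2 * pi * real k / real ?d)"
  have mono: "f i < f j" if "i < j" for i j
    using that degree_pos by (simp add: f_def divide_strict_right_mono)
  have "{\<phi> \<in> {\<theta>..<\<theta> + 2 * pi}. inf_pt p \<phi> \<in> Dir p (dir_at p \<theta>)} = f ` {0..<?d}"
  proof (intro equalityI subsetI)
    fix \<phi> assume "\<phi> \<in> {\<phi> \<in> {\<theta>..<\<theta> + 2 * pi}. inf_pt p \<phi> \<in> Dir p (dir_at p \<theta>)}"
    then have \<phi>: "\<theta> \<le> \<phi>" "\<phi> < \<theta> + 2 * pi" "asymp_dir \<theta> = asymp_dir \<phi>"
      by (auto simp: inf_pt_in_Dir dir_at_eq)
    then obtain k :: int where k: "\<phi> = \<theta> + 2 * pi * real_of_int k / real ?d"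
      unfolding asymp_dir_eq_iff by blast
    have "0 \<le> 2 * pi * real_of_int k / real ?d" "2 * pi * real_of_int k / real ?d < 2 * pi"
      using \<phi>(1,2) k by auto
    then have "0 \<le> real_of_int k" "real_of_int k < real ?d"
      using degree_pos pi_gt_zero
      by (auto simp: zero_le_divide_iff zero_le_mult_iff divide_less_eq simp del: pi_gt_zero)
    then have "0 \<le> k" "k < int ?d" by linarith+
    then have "\<phi> = f (nat k)" "nat k < ?d" using k by (auto simp: f_def)
    then show "\<phi> \<in> f ` {0..<?d}" by auto
  next
    fix \<phi> assume "\<phi> \<in> f ` {0..<?d}"
    then obtain k where k: "k < ?d" "\<phi> = f k" by auto
    then have "f 0 \<le> \<phi>" "\<phi> < f ?d" using mono[of k ?d] mono[of 0 k] by (cases "k = 0"; simp)+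
    then show "\<phi> \<in> {\<phi> \<in> {\<theta>..<\<theta> + 2 * pi}. inf_pt p \<phi> \<in> Dir p (dir_at p \<theta>)}"
      using asymp_dir_step[of \<theta> k] k(2) degree_pos by (simp add: f_def inf_pt_in_Dir dir_at_eq)
  qed
  also have "\<dots> = set (map f [0..<?d])" by simp
  finally have "sorted_list_of_set {\<phi> \<in> {\<theta>..<\<theta> + 2 * pi}. inf_pt p \<phi> \<in> Dir p (dir_at p \<theta>)} = map f [0..<?d]"
  proof (rule ssubst)
    have "sorted (map f [0..<?d])"
      unfolding sorted_iff_nth_mono_less using mono by (auto intro: less_imp_le)
    moreover have "distinct (map f [0..<?d])"
      using mono by (auto simp: distinct_map inj_on_def) (metis linorder_neqE_nat less_irrefl)
    ultimately show "sorted_list_of_set (set (map f [0..<?d])) = map f [0..<?d]"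
      by (rule sorted_list_of_set.idem_if_sorted_distinct)
  qed
  then have "linear_ordering p \<theta> = map (\<lambda>k. root_joined_to p (dir_at p \<theta>) (inf_pt p (f k))) [0..<?d]"
    by (simp add: linear_ordering_def o_def)
  also have "\<dots> = map (\<lambda>k. root_at (f k)) [0..<?d]"
    unfolding root_at_def dir_at_eq f_def asymp_dir_step ..
  finally show ?thesis by (simp add: f_def)
qed

lemma length_linear_ordering [simp]: "length (linear_ordering p \<theta>) = degree p"
  by (simp add: linear_ordering_eq)

lemma nth_linear_ordering:
  "k < degree p \<Longrightarrow> linear_ordering p \<theta> ! k = root_at (\<theta> + 2 * pi * real k / real (degree p))"
  by (simp add: linear_ordering_eq)

lemma root_at_mod:
  "root_at (\<theta> + 2 * pi * real k / real (degree p)) = root_at (\<theta> + 2 * pi * real (k mod degree p) / real (degree p))"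
proof -
  let ?d = "degree p"
  have "real k = real (k div ?d) * real ?d + real (k mod ?d)"
    by (metis div_mult_mod_eq of_nat_add of_nat_mult)
  then have "\<theta> + 2 * pi * real k / real ?d = (\<theta> + 2 * pi * real (k mod ?d) / real ?d) + 2 * pi * real (k div ?d)"
    using degree_pos by (simp add: field_simps)
  then show ?thesis using root_at_periodic by metis
qed

text \<open>The source of the \<open>d\<close>-cycle: one full turn of the direction is the case
  \<open>j = 1\<close>, where the reading starts one place later.\<close>

lemma linear_ordering_step:
  "linear_ordering p (\<theta> + 2 * pi * real j / real (degree p)) = rotate j (linear_ordering p \<theta>)"
proof (rule nth_equalityI)
  fix k assume "k < length (linear_ordering p (\<theta> + 2 * pi * real j / real (degree p)))"
  then have k: "k < degree p" by simp
  have "linear_ordering p (\<theta> + 2 * pi * real j / real (degree p)) ! k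
      = root_at (\<theta> + 2 * pi * real (j + k) / real (degree p))"
    using k by (simp add: nth_linear_ordering add_divide_distrib distrib_left add.assoc)
  also have "\<dots> = root_at (\<theta> + 2 * pi * real ((j + k) mod degree p) / real (degree p))" by (rule root_at_mod)
  also have "\<dots> = rotate j (linear_ordering p \<theta>) ! k"
    using k degree_pos by (simp add: nth_rotate nth_linear_ordering)
  finally show "linear_ordering p (\<theta> + 2 * pi * real j / real (degree p)) ! k = rotate j (linear_ordering p \<theta>) ! k" .
qed simp

lemma linear_ordering_same_dir:
  assumes "asymp_dir \<theta> = asymp_dir \<phi>" obtains j where "linear_ordering p \<phi> = rotate j (linear_ordering p \<theta>)"
proof -
  obtain k :: int where k: "\<phi> = \<theta> + 2 * pi * real_of_int k / real (degree p)"
    using assms unfolding asymp_dir_eq_iff by blast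
  let ?d = "degree p"
  show ?thesis
  proof (cases "0 \<le> k")
    case True
    then show ?thesis using that[of "nat k"] linear_ordering_step[of \<theta> "nat k"] k by simp
  next
    case False
    define m where "m = nat (- k)"
    \<comment> \<open>A step backwards is \<open>d - 1\<close> steps forwards, \<open>d\<close>
      steps being the identity.\<close>
    define j where "j = m * (?d - 1)"
    have "\<theta> = \<phi> + 2 * pi * real m / real ?d" using False k by (simp add: m_def)
    then have "rotate j (linear_ordering p \<theta>) = rotate (j + m) (linear_ordering p \<phi>)"
      by (simp add: linear_ordering_step rotate_rotate)
    moreover have "j + m = m * ?d" using degree_pos by (cases ?d) (auto simp: j_def)
    then have "rotate (j + m) (linear_ordering p \<phi>) = linear_ordering p \<phi>" by (intro rotate_id) simp
    ultimately show ?thesis using that[of j] by simp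
  qed
qed

end

section \<open>Reading the roots over a regular direction\<close>

context branches
begin

lemma joined_iff:
  assumes "a \<in> rts p" "x \<in> circle_at_infinity p"
  shows "joined p u a x \<longleftrightarrow> x = arc_end a"
  using joined_imp_piece[OF assms(1)] piece_circle_unique[OF assms(1) _ assms(2)] joined_arc_end[OF assms(1)] by blast

lemma arc_end_inj: "a \<in> rts p \<Longrightarrow> b \<in> rts p \<Longrightarrow> arc_end a = arc_end b \<Longrightarrow> a = b"
  using piece_unique arc_end_piece by metis

lemma circle_Dir_ex1:
  assumes "x \<in> Dir p u" "x \<in> circle_at_infinity p"
  shows "\<exists>!a. a \<in> rts p \<and> joined p u a x"
proof -
  obtain a where a: "a \<in> rts p" "x \<in> piece a" using pieces_cover[OF assms(1)] by blast
  then have "x = arc_end a" using piece_circle_unique assms(2) by blast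
  then show ?thesis
    using a(1) joined_iff[OF _ assms(2)] arc_end_inj by (intro ex1I[of _ a]) auto
qed

lemma root_Dir_ex1:
  assumes "a \<in> rts p"
  shows "\<exists>!x. x \<in> Dir p u \<inter> circle_at_infinity p \<and> joined p u a x"
  using joined_iff[OF assms] arc_end_Dir[OF assms] arc_end_circle[OF assms] joined_arc_end[OF assms]
  by (intro ex1I[of _ "arc_end a"]) auto

lemma root_at_arc:
  assumes "asymp_dir \<theta> = u"
  shows "root_at \<theta> \<in> rts p" "inf_pt p \<theta> = arc_end (root_at \<theta>)"
proof -
  have x: "inf_pt p \<theta> \<in> Dir p u" "inf_pt p \<theta> \<in> circle_at_infinity p"
    using inf_pt_in_Dir inf_pt_circle assms by auto
  have "root_at \<theta> \<in> rts p \<and> joined p u (root_at \<theta>) (inf_pt p \<theta>)"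
    using theI'[OF circle_Dir_ex1[OF x]] by (simp add: root_at_def root_joined_to_def assms)
  then show "root_at \<theta> \<in> rts p" "inf_pt p \<theta> = arc_end (root_at \<theta>)"
    using joined_iff x(2) by auto
qed

text \<open>Every root occurs because its lifted ray ends at some \<open>inf_pt p \<phi>\<close>
  over \<open>u\<close>, by \<open>arc_asymptotics\<close>, and the orderings at \<phi> and \<theta>
  differ by a rotation. Distinctness is then forced by the number of entries.\<close>

lemma linear_ordering_enumerates:
  assumes "asymp_dir \<theta> = u"
  shows "set (linear_ordering p \<theta>) = rts p" "distinct (linear_ordering p \<theta>)"
proof -
  show s: "set (linear_ordering p \<theta>) = rts p"
  proof
    show "set (linear_ordering p \<theta>) \<subseteq> rts p"
      using root_at_arc(1) asymp_dir_step assms by (auto simp: linear_ordering_eq)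
    show "rts p \<subseteq> set (linear_ordering p \<theta>)"
    proof
      fix a assume a: "a \<in> rts p"
      obtain \<phi> where \<phi>: "asymp_dir \<phi> = u" "arc_end a = inf_pt p \<phi>" using arc_asymptotics[OF a] by blast
      then have "a = root_at \<phi>" using root_at_arc[OF \<phi>(1)] arc_end_inj a by metis
      moreover have "root_at \<phi> = linear_ordering p \<phi> ! 0" using degree_pos by (simp add: nth_linear_ordering)
      then have "root_at \<phi> \<in> set (linear_ordering p \<phi>)" using degree_pos by simp
      moreover obtain j where "linear_ordering p \<phi> = rotate j (linear_ordering p \<theta>)"
        using linear_ordering_same_dir assms \<phi>(1) by metis
      ultimately show "a \<in> set (linear_ordering p \<theta>)" by simp
    qed
  qed
  show "distinct (linear_ordering p \<theta>)"
    by (rule card_distinct) (simp add: s card_rts)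
qed

text \<open>Here the order in the completion is matched with directions in the plane. The angle
  \<phi> supplied by \<open>arc_asymptotics\<close> has the same end point as \<theta>; it is the
  distinctness of the ordering that makes the two angles agree modulo full turns.\<close>

lemma root_at_asymptotics:
  assumes "asymp_dir \<theta> = u"
  shows "((\<lambda>t. sgn (arc_pt (root_at \<theta>) t)) \<longlongrightarrow> cis \<theta>) (at_left 1)"
proof -
  let ?a = "root_at \<theta>" and ?d = "degree p"
  have a: "?a \<in> rts p" by (rule root_at_arc(1)[OF assms])
  obtain \<phi> where \<phi>: "asymp_dir \<phi> = u" "((\<lambda>t. sgn (arc_pt ?a t)) \<longlongrightarrow> cis \<phi>) (at_left 1)" "arc_end ?a = inf_pt p \<phi>"
    by (rule arc_asymptotics[OF a])
  then have eq: "root_at \<phi> = ?a" using root_at_arc[OF \<phi>(1)] arc_end_inj a by metis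
  obtain k :: int where k: "\<phi> = \<theta> + 2 * pi * real_of_int k / real ?d"
    using assms \<phi>(1) asymp_dir_eq_iff by metis
  define m where "m = nat (k mod int ?d)"
  have m: "m < ?d" "int m = k mod int ?d" using degree_pos by (auto simp: m_def nat_less_iff)
  have k': "real_of_int k = real_of_int (k div int ?d) * real ?d + real m"
    using m(2) by (metis div_mult_mod_eq of_int_add of_int_mult of_int_of_nat_eq)
  have cis: "cis \<phi> = cis (\<theta> + 2 * pi * real m / real ?d)"
  proof -
    have "\<phi> = (\<theta> + 2 * pi * real m / real ?d) + 2 * pi * real_of_int (k div int ?d)"
      unfolding k k' using degree_pos by (simp add: field_simps)
    then have "cis \<phi> = cis (\<theta> + 2 * pi * real m / real ?d) * cis (2 * pi * real_of_int (k div int ?d))"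
      by (simp only: cis_mult)
    moreover have "cis (2 * pi * real_of_int (k div int ?d)) = 1" by (rule cis_multiple_2pi) simp
    ultimately show ?thesis by (metis mult.right_neutral)
  qed
  have "root_at (\<theta> + 2 * pi * real m / real ?d) = root_at \<phi>"
    using inf_pt_cis[OF cis] asymp_dir_step[of \<theta> m] assms \<phi>(1) by (simp add: root_at_def)
  then have "linear_ordering p \<theta> ! m = linear_ordering p \<theta> ! 0"
    using eq m degree_pos by (simp add: nth_linear_ordering)
  then have "m = 0" using linear_ordering_enumerates(2)[OF assms] m degree_pos
    by (simp add: nth_eq_iff_index_eq)
  then show ?thesis using cis \<phi>(2) by simp
qed

end

section \<open>Dependence of the orderings on the direction\<close>

context simple_poly
begin

lemma dist_asymp_dir: "dist (asymp_dir \<theta>) (asymp_dir \<theta>') \<le> real (degree p) * \<bar>\<theta> - \<theta>'\<bar>"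
proof -
  have "dist (asymp_dir \<theta>) (asymp_dir \<theta>') = dist (cis (real (degree p) * \<theta>)) (cis (real (degree p) * \<theta>'))"
    unfolding asymp_dir_def dist_norm right_diff_distrib[symmetric] by (simp add: norm_mult norm_sgn_lc)
  also have "\<dots> \<le> \<bar>real (degree p) * \<theta> - real (degree p) * \<theta>'\<bar>" by (rule dist_cis_le)
  finally show ?thesis by (simp add: abs_mult flip: right_diff_distrib)
qed

text \<open>If the root read at some angle changed, two points at infinity would lie in the closures
  of different sheets of one family of branches, hence at least \<delta> apart, although their
  distance is at most \<open>C\<close> times the difference of angles.\<close>

lemma linear_ordering_locally_constant:
  assumes "regular_Dir p (asymp_dir \<theta>)"
  obtains \<eta> where "\<eta> > 0" "\<And>\<phi>. \<bar>\<theta> - \<phi>\<bar> < \<eta> \<Longrightarrow> linear_ordering p \<phi> = linear_ordering p \<theta>"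
proof -
  obtain \<delta> \<epsilon> g where br: "branches p (asymp_dir \<theta>) \<delta> \<epsilon> g"
    using branches_exist[OF norm_asymp_dir assms] by blast
  interpret b: branches p "asymp_dir \<theta>" \<delta> \<epsilon> g by fact
  obtain C where C: "0 < C" "\<And>\<theta> \<theta>'. mdist BA (inf_pt p \<theta>) (inf_pt p \<theta>') \<le> C * \<bar>\<theta> - \<theta>'\<bar>"
    by (rule inf_pt_lipschitz) (rule that)
  \<comment> \<open>Both the distance of the points at infinity, with constant \<open>C\<close>, and
    that of the directions, with constant \<open>degree p\<close>, have to stay below
    \<delta>.\<close>
  define \<eta> where "\<eta> = \<delta> / (C + real (degree p))"
  have pos: "C + real (degree p) > 0" using C(1) by simp
  have \<eta>: "\<eta> > 0" using b.delta_pos pos by (simp add: \<eta>_def)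
  have loc: "root_at \<psi>' = root_at \<psi>" if \<psi>: "asymp_dir \<psi> = asymp_dir \<theta>" "\<bar>\<psi> - \<psi>'\<bar> < \<eta>" for \<psi> \<psi>'
  proof (rule ccontr)
    assume ne: "root_at \<psi>' \<noteq> root_at \<psi>"
    have lt: "(C + real (degree p)) * \<bar>\<psi> - \<psi>'\<bar> < \<delta>"
      using \<psi>(2) pos by (simp add: \<eta>_def pos_less_divide_eq mult.commute)
    then have "C * \<bar>\<psi> - \<psi>'\<bar> < \<delta>" "real (degree p) * \<bar>\<psi> - \<psi>'\<bar> < \<delta>"
      using C(1) by (auto simp: distrib_right intro: le_less_trans[rotated])
    then have lt': "C * \<bar>\<psi> - \<psi>'\<bar> < \<delta>" "dist (asymp_dir \<theta>) (asymp_dir \<psi>') < \<delta>"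
      using dist_asymp_dir[of \<psi> \<psi>'] \<psi>(1) by auto
    \<comment> \<open>The same family \<open>g\<close> seen from the new direction: its sheets lie
      inside those of \<open>b\<close> of the same name.\<close>
    interpret b': branches p "asymp_dir \<psi>'" "\<delta> - dist (asymp_dir \<theta>) (asymp_dir \<psi>')" \<epsilon> g
      by (rule branches_shift[OF br norm_asymp_dir lt'(2)])
    have "inf_pt p \<psi> \<in> b.piece (root_at \<psi>)"
      using b.root_at_arc[OF \<psi>(1)] b.arc_end_piece by simp
    moreover have "inf_pt p \<psi>' \<in> b'.piece (root_at \<psi>')"
      using b'.root_at_arc[OF refl] b'.arc_end_piece by simp
    then have "inf_pt p \<psi>' \<in> btop p closure_of (emb p ` b.sheet (root_at \<psi>'))"
      using closure_of_mono[of "emb p ` b'.sheet (root_at \<psi>')" "emb p ` b.sheet (root_at \<psi>')" "btop p"] sector_mono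
      by (force simp: b'.piece_def b'.sheet_def b.sheet_def)
    ultimately have "\<delta> \<le> mdist BA (inf_pt p \<psi>) (inf_pt p \<psi>')"
      by (intro b.piece_separation[OF b.root_at_arc(1)[OF \<psi>(1)] b'.root_at_arc(1)[OF refl]]) (use ne in simp_all)
    then show False using C(2)[of \<psi> \<psi>'] lt'(1) by linarith
  qed
  have rt: "root_at (\<phi> + 2 * pi * real k / real (degree p)) = root_at (\<theta> + 2 * pi * real k / real (degree p))"
    if "\<bar>\<theta> - \<phi>\<bar> < \<eta>" for \<phi> k
    by (rule loc[OF asymp_dir_step]) (use that in simp)
  have "linear_ordering p \<phi> = linear_ordering p \<theta>" if "\<bar>\<theta> - \<phi>\<bar> < \<eta>" for \<phi>
    by (simp add: linear_ordering_eq rt[OF that])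
  with \<eta> show ?thesis using that by blast
qed

lemma linear_ordering_constant:
  assumes "\<theta> \<le> \<theta>'" "\<And>\<phi>. \<phi> \<in> {\<theta>..\<theta>'} \<Longrightarrow> regular_Dir p (asymp_dir \<phi>)"
  shows "linear_ordering p \<theta> = linear_ordering p \<theta>'"
proof (rule connected_local_const[of "{\<theta>..\<theta>'}"])
  show "\<forall>a\<in>{\<theta>..\<theta>'}. \<forall>\<^sub>F b in at a within {\<theta>..\<theta>'}. linear_ordering p a = linear_ordering p b"
  proof
    fix a assume "a \<in> {\<theta>..\<theta>'}"
    then obtain \<eta> where \<eta>: "\<eta> > 0" "\<And>\<phi>. \<bar>a - \<phi>\<bar> < \<eta> \<Longrightarrow> linear_ordering p \<phi> = linear_ordering p a"
      using linear_ordering_locally_constant assms(2) by metis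
    show "\<forall>\<^sub>F b in at a within {\<theta>..\<theta>'}. linear_ordering p a = linear_ordering p b"
      unfolding eventually_at
    proof (intro exI[of _ \<eta>] conjI \<eta>(1) ballI impI)
      fix b assume "b \<noteq> a \<and> dist b a < \<eta>"
      then show "linear_ordering p a = linear_ordering p b"
        using \<eta>(2)[of b] by (simp add: dist_real_def abs_minus_commute)
    qed
  qed
qed (use assms(1) in auto)

lemma regular_linear_ordering:
  assumes "regular_Dir p (asymp_dir \<theta>)"
  shows "set (linear_ordering p \<theta>) = rts p" "distinct (linear_ordering p \<theta>)"
proof -
  obtain \<delta> \<epsilon> g where "branches p (asymp_dir \<theta>) \<delta> \<epsilon> g"
    using branches_exist[OF norm_asymp_dir assms] by blast
  then interpret b: branches p "asymp_dir \<theta>" \<delta> \<epsilon> g .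
  show "set (linear_ordering p \<theta>) = rts p" "distinct (linear_ordering p \<theta>)"
    using b.linear_ordering_enumerates by auto
qed

lemma regular_cyclic_ordering:
  assumes "norm u = 1" "regular_Dir p u" shows "is_cyclic_ordering (rts p) (cyclic_ordering p u)"
proof -
  obtain \<theta> where \<theta>: "asymp_dir \<theta> = u" using asymp_dir_surj[OF assms(1)] by blast
  have "cyclic_ordering p u = {rotate n (linear_ordering p \<theta>) | n. True}"
  proof (intro equalityI subsetI)
    fix xs assume "xs \<in> cyclic_ordering p u"
    then obtain \<phi> where "xs = linear_ordering p \<phi>" "asymp_dir \<phi> = u"
      by (auto simp: cyclic_ordering_def inf_pt_in_Dir)
    then show "xs \<in> {rotate n (linear_ordering p \<theta>) | n. True}"
      using linear_ordering_same_dir[of \<theta> \<phi>] \<theta> by auto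
  next
    fix xs assume "xs \<in> {rotate n (linear_ordering p \<theta>) | n. True}"
    then obtain n where "xs = rotate n (linear_ordering p \<theta>)" by blast
    then have "xs = linear_ordering p (\<theta> + 2 * pi * real n / real (degree p))" by (simp add: linear_ordering_step)
    then show "xs \<in> cyclic_ordering p u"
      unfolding cyclic_ordering_def inf_pt_in_Dir using asymp_dir_step[of \<theta> n] \<theta> by blast
  qed
  then show ?thesis unfolding is_cyclic_ordering_def
    using regular_linear_ordering assms(2) \<theta> by metis
qed

end

section \<open>The factorization\<close>

lemma two_line_outside: "i \<notin> {1..length xs} \<Longrightarrow> two_line xs ys i = i"
  unfolding two_line_def by (rule if_not_P)

lemma two_line_unique:
  assumes "distinct xs" "i \<in> {1..length xs}" "j \<in> {1..length xs}" "xs ! (j - 1) = ys ! (i - 1)"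
  shows "two_line xs ys i = j"
proof -
  have "(THE j. j \<in> {1..length xs} \<and> xs ! (j - 1) = ys ! (i - 1)) = j"
  proof (rule the_equality)
    fix k assume k: "k \<in> {1..length xs} \<and> xs ! (k - 1) = ys ! (i - 1)"
    then have "xs ! (k - 1) = xs ! (j - 1)" using assms(4) by simp
    then have "k - 1 = j - 1" using assms(1,3) k by (subst (asm) nth_eq_iff_index_eq) auto
    then show "k = j" using assms(3) k by auto
  qed (use assms in simp)
  then show ?thesis using assms(2) by (simp add: two_line_def)
qed

lemma two_line_nth:
  assumes "distinct xs" "set ys = set xs" "length ys = length xs" "i \<in> {1..length xs}"
  shows "two_line xs ys i \<in> {1..length xs}" "xs ! (two_line xs ys i - 1) = ys ! (i - 1)"
proof -
  have "ys ! (i - 1) \<in> set xs" using assms(2-4) by (metis atLeastAtMost_iff diff_less less_le_trans nth_mem zero_less_one)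
  then obtain k where k: "k < length xs" "xs ! k = ys ! (i - 1)" by (auto simp: in_set_conv_nth)
  then have "two_line xs ys i = Suc k" by (intro two_line_unique assms) auto
  with k show "two_line xs ys i \<in> {1..length xs}" "xs ! (two_line xs ys i - 1) = ys ! (i - 1)" by auto
qed

lemma two_line_self: "distinct xs \<Longrightarrow> two_line xs xs = id"
proof
  fix i assume "distinct xs"
  then show "two_line xs xs i = id i"
    using two_line_unique[of xs i i xs] two_line_outside[of i xs xs] by (cases "i \<in> {1..length xs}") auto
qed

lemma two_line_comp:
  assumes "distinct xs" "distinct ys" "set ys = set xs" "length ys = length xs" "set zs = set xs" "length zs = length xs"
  shows "two_line xs ys \<circ> two_line ys zs = two_line xs zs"
proof
  fix i
  show "(two_line xs ys \<circ> two_line ys zs) i = two_line xs zs i"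
  proof (cases "i \<in> {1..length xs}")
    case True
    let ?j = "two_line ys zs i"
    have j: "?j \<in> {1..length xs}" "ys ! (?j - 1) = zs ! (i - 1)"
      using two_line_nth[of ys zs i] assms True by auto
    have "two_line xs ys ?j \<in> {1..length xs}" "xs ! (two_line xs ys ?j - 1) = zs ! (i - 1)"
      using two_line_nth[of xs ys ?j] assms j by auto
    then show ?thesis using two_line_unique[OF assms(1) True] by simp
  next
    case False
    then have "two_line ys zs i = i" "two_line xs ys i = i" "two_line xs zs i = i"
      using two_line_outside assms(4) by metis+
    then show ?thesis by simp
  qed
qed

lemma two_line_permutes:
  assumes "distinct xs" "distinct ys" "set ys = set xs" "length ys = length xs"
  shows "two_line xs ys permutes {1..length xs}"
proof -
  have "two_line xs ys \<circ> two_line ys xs = id" "two_line ys xs \<circ> two_line xs ys = id"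
    using two_line_comp[of xs ys xs] two_line_comp[of ys xs ys] two_line_self assms by auto
  then have "bij (two_line xs ys)" by (rule o_bij[rotated])
  then show ?thesis unfolding permutes_def bij_iff using two_line_outside by blast
qed

lemma two_line_rotate1:
  assumes "distinct xs"
  shows "two_line xs (rotate1 xs) = cycle_of_list [1..<Suc (length xs)]"
proof
  fix i
  let ?n = "length xs"
  let ?cs = "[1..<Suc ?n]"
  show "two_line xs (rotate1 xs) i = cycle_of_list ?cs i"
  proof (cases "i \<in> {1..?n}")
    case True
    then have n: "i - 1 < ?n" "Suc (i - 1) = i" "0 < ?n" by auto
    \<comment> \<open>Positions start at 1 and indices at 0: position \<open>i\<close> after
      rotation holds the entry of index \<open>i mod n\<close>, whose position is one more.\<close>
    have "rotate1 xs ! (i - 1) = xs ! (i mod ?n)" using n nth_rotate1[of "i - 1" xs] by simp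
    then have 1: "two_line xs (rotate1 xs) i = Suc (i mod ?n)"
      using n True by (intro two_line_unique assms) (auto simp: Suc_le_eq)
    have "map (cycle_of_list ?cs) ?cs = rotate1 ?cs" using cyclic_rotation[of ?cs 1] by simp
    then have "map (cycle_of_list ?cs) ?cs ! (i - 1) = rotate1 ?cs ! (i - 1)" by simp
    then have "cycle_of_list ?cs i = ?cs ! (i mod ?n)"
      using n nth_rotate1[of "i - 1" ?cs] by (simp del: upt_Suc)
    also have "\<dots> = Suc (i mod ?n)" using n by (simp del: upt_Suc)
    finally show ?thesis using 1 by simp
  next
    case False
    then have "i \<notin> set ?cs" by auto
    then show ?thesis using False two_line_outside id_outside_supp by metis
  qed
qed

context simple_poly
begin

lemma regular_asymp_iff: "regular_Dir p (asymp_dir \<phi>) \<longleftrightarrow> asymp_dir \<phi> \<notin> sgn ` cvl p"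
  using regular_Dir_iff norm_asymp_dir by blast

text \<open>The interval covers less than a full turn of the direction, so angles are determined by
  directions, and the critical directions are finitely many.\<close>

lemma finite_critical_angles: "finite (critical_angles p \<theta>)"
proof (rule finite_imageD)
  have "asymp_dir ` critical_angles p \<theta> \<subseteq> sgn ` cvl p"
    by (auto simp: critical_angles_def dir_at_eq regular_asymp_iff)
  then show "finite (asymp_dir ` critical_angles p \<theta>)" using finite_cvl finite_subset by blast
  show "inj_on asymp_dir (critical_angles p \<theta>)"
  proof (rule inj_onI)
    fix x y assume xy: "x \<in> critical_angles p \<theta>" "y \<in> critical_angles p \<theta>" "asymp_dir x = asymp_dir y"
    then obtain k :: int where k: "y = x + 2 * pi * real_of_int k / real (degree p)"
      unfolding asymp_dir_eq_iff by blast
    have "\<bar>y - x\<bar> < 2 * pi / real (degree p)" using xy by (auto simp: critical_angles_def)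
    then have "\<bar>real_of_int k\<bar> * (2 * pi / real (degree p)) < 1 * (2 * pi / real (degree p))"
      using k by (simp add: abs_mult mult.commute)
    then have "\<bar>real_of_int k\<bar> < 1" by (rule mult_right_less_imp_less) simp
    then have "k = 0" by linarith
    then show "x = y" using k by simp
  qed
qed

text \<open>The \<open>THE\<close> is legitimate: the ordering is constant on the regular stretch
  just before \<phi>, and \<open>at_left \<phi>\<close> is a proper filter.\<close>

lemma ordering_before_eq:
  assumes "\<alpha> < \<phi>" "\<And>x. \<alpha> \<le> x \<Longrightarrow> x < \<phi> \<Longrightarrow> regular_Dir p (asymp_dir x)"
  shows "ordering_before p \<phi> = linear_ordering p \<alpha>"
  unfolding ordering_before_def
proof (rule the_equality)
  have "linear_ordering p x = linear_ordering p \<alpha>" if "\<alpha> < x" "x < \<phi>" for x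
    using linear_ordering_constant[of \<alpha> x] assms(2) that by auto
  then show ev: "\<forall>\<^sub>F \<theta> in at_left \<phi>. linear_ordering p \<theta> = linear_ordering p \<alpha>"
    unfolding eventually_at_left_field using assms(1) by blast
  fix xs assume "\<forall>\<^sub>F \<theta> in at_left \<phi>. linear_ordering p \<theta> = xs"
  with ev have "\<forall>\<^sub>F \<theta> in at_left \<phi>. xs = linear_ordering p \<alpha>" by eventually_elim simp
  then show "xs = linear_ordering p \<alpha>" by (simp add: eventually_const_iff)
qed

lemma ordering_after_eq:
  assumes "\<phi> < \<beta>" "\<And>x. \<phi> < x \<Longrightarrow> x \<le> \<beta> \<Longrightarrow> regular_Dir p (asymp_dir x)"
  shows "ordering_after p \<phi> = linear_ordering p \<beta>"
  unfolding ordering_after_def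
proof (rule the_equality)
  have "linear_ordering p x = linear_ordering p \<beta>" if "\<phi> < x" "x < \<beta>" for x
    using linear_ordering_constant[of x \<beta>] assms(2) that by auto
  then show ev: "\<forall>\<^sub>F \<theta> in at_right \<phi>. linear_ordering p \<theta> = linear_ordering p \<beta>"
    unfolding eventually_at_right_field using assms(1) by blast
  fix xs assume "\<forall>\<^sub>F \<theta> in at_right \<phi>. linear_ordering p \<theta> = xs"
  with ev have "\<forall>\<^sub>F \<theta> in at_right \<phi>. xs = linear_ordering p \<beta>" by eventually_elim simp
  then show "xs = linear_ordering p \<beta>" by (simp add: eventually_const_iff)
qed

text \<open>Induction on the number of critical angles, with the left end moved past the first of
  them. Each factor relates the orderings on the two adjacent stretches, so
  \<open>two_line_comp\<close> cancels everything between the first and the last ordering.\<close>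

lemma factor_product:
  assumes "finite K" "K = {\<phi> \<in> {\<alpha><..<\<beta>}. \<not> regular_Dir p (asymp_dir \<phi>)}" "\<alpha> < \<beta>"
    "regular_Dir p (asymp_dir \<alpha>)" "regular_Dir p (asymp_dir \<beta>)"
  defines "fs \<equiv> \<lambda>K. map (\<lambda>\<phi>. two_line (ordering_before p \<phi>) (ordering_after p \<phi>)) (sorted_list_of_set K)"
  shows "(\<forall>\<pi>\<in>set (fs K). \<pi> permutes {1..degree p}) \<and>
    foldr (\<circ>) (fs K) id = two_line (linear_ordering p \<alpha>) (linear_ordering p \<beta>)"
  using assms(1-5)
proof (induction "card K" arbitrary: K \<alpha>)
  case 0
  then have "K = {}" by simp
  then have "regular_Dir p (asymp_dir \<phi>)" if "\<phi> \<in> {\<alpha>..\<beta>}" for \<phi>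
    using 0(3,5,6) that by (cases "\<phi> = \<alpha> \<or> \<phi> = \<beta>") auto
  then have "linear_ordering p \<alpha> = linear_ordering p \<beta>"
    using linear_ordering_constant \<open>\<alpha> < \<beta>\<close> by simp
  then have "two_line (linear_ordering p \<alpha>) (linear_ordering p \<beta>) = id"
    using two_line_self[OF regular_linear_ordering(2)[OF 0(6)]] by simp
  moreover have "fs K = []" using \<open>K = {}\<close> by (simp add: fs_def)
  ultimately show ?case by simp
next
  case (Suc n)
  define \<phi> where "\<phi> = Min K"
  define K' where "K' = K - {\<phi>}"
  \<comment> \<open>The next critical angle, or \<beta> if there is none; the midpoint between
    \<phi> and \<open>m\<close> is then regular and separates \<phi> from the remaining critical
    angles.\<close>
  define m where "m = Min (insert \<beta> K')"
  define \<alpha>' where "\<alpha>' = (\<phi> + m) / 2"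
  have "K \<noteq> {}" using Suc(2) by auto
  then have \<phi>: "\<phi> \<in> K" "\<And>x. x \<in> K \<Longrightarrow> \<phi> \<le> x" using Suc(3) by (auto simp: \<phi>_def)
  have \<phi>_in: "\<alpha> < \<phi>" "\<phi> < \<beta>" using \<phi>(1) unfolding Suc(4) by auto
  have finK': "finite K'" using Suc(3) by (simp add: K'_def)
  have m_le: "m \<le> \<beta>" "\<And>x. x \<in> K' \<Longrightarrow> m \<le> x" using finK' by (auto simp: m_def)
  have "m \<in> insert \<beta> K'" unfolding m_def using finK' by (intro Min_in) auto
  then have "\<phi> < m"
  proof
    assume "m \<in> K'"
    then have "\<phi> \<le> m" "m \<noteq> \<phi>" using \<phi>(2) by (auto simp: K'_def)
    then show "\<phi> < m" by simp
  qed (use \<phi>_in in simp)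
  then have \<alpha>': "\<phi> < \<alpha>'" "\<alpha>' < m" by (auto simp: \<alpha>'_def)
  have reg: "regular_Dir p (asymp_dir x)" if "\<alpha> < x" "x < m" "x \<noteq> \<phi>" for x
  proof (rule ccontr)
    assume "\<not> ?thesis"
    then have "x \<in> K" unfolding Suc(4) using that m_le(1) by simp
    then have "x \<in> K'" using that(3) by (simp add: K'_def)
    then show False using m_le(2) that(2) by fastforce
  qed
  have reg': "regular_Dir p (asymp_dir x)" if "\<alpha> \<le> x" "x < m" "x \<noteq> \<phi>" for x
    using reg[of x] Suc(6) that by (cases "x = \<alpha>") auto
  have reg_\<alpha>': "regular_Dir p (asymp_dir \<alpha>')" using reg[of \<alpha>'] \<alpha>' \<phi>_in by simp
  have K'_eq: "K' = {x \<in> {\<alpha>'<..<\<beta>}. \<not> regular_Dir p (asymp_dir x)}"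
  proof (intro equalityI subsetI)
    fix x assume x: "x \<in> K'"
    then have "x \<in> K" by (simp add: K'_def)
    then show "x \<in> {x \<in> {\<alpha>'<..<\<beta>}. \<not> regular_Dir p (asymp_dir x)}"
      using m_le(2)[OF x] \<alpha>'(2) unfolding Suc(4) by auto
  next
    fix x assume x: "x \<in> {x \<in> {\<alpha>'<..<\<beta>}. \<not> regular_Dir p (asymp_dir x)}"
    then have "x \<in> K" unfolding Suc(4) using \<alpha>'(1) \<phi>_in by auto
    then show "x \<in> K'" using x \<alpha>'(1) by (auto simp: K'_def)
  qed
  have "n = card K'" using Suc(2,3) \<phi>(1) by (simp add: K'_def)
  then have IH: "\<forall>\<pi>\<in>set (fs K'). \<pi> permutes {1..degree p}"
    "foldr (\<circ>) (fs K') id = two_line (linear_ordering p \<alpha>') (linear_ordering p \<beta>)"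
    using Suc(1)[OF _ finK' K'_eq _ reg_\<alpha>' Suc(7)] \<alpha>'(2) m_le(1) by auto
  have before: "ordering_before p \<phi> = linear_ordering p \<alpha>"
    by (rule ordering_before_eq[OF \<phi>_in(1)]) (use reg' \<open>\<phi> < m\<close> in auto)
  have after: "ordering_after p \<phi> = linear_ordering p \<alpha>'"
    by (rule ordering_after_eq[OF \<alpha>'(1)]) (use reg \<alpha>'(2) \<phi>_in in auto)
  have fs: "fs K = two_line (linear_ordering p \<alpha>) (linear_ordering p \<alpha>') # fs K'"
    using sorted_list_of_set_nonempty[OF Suc(3) \<open>K \<noteq> {}\<close>]
    by (simp add: fs_def before after flip: \<phi>_def K'_def)
  note LO = regular_linear_ordering[OF Suc(6)] regular_linear_ordering[OF reg_\<alpha>'] regular_linear_ordering[OF Suc(7)]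
  have "two_line (linear_ordering p \<alpha>) (linear_ordering p \<alpha>') permutes {1..degree p}"
    using two_line_permutes[of "linear_ordering p \<alpha>" "linear_ordering p \<alpha>'"] LO by simp
  moreover have "two_line (linear_ordering p \<alpha>) (linear_ordering p \<alpha>') \<circ> two_line (linear_ordering p \<alpha>') (linear_ordering p \<beta>)
      = two_line (linear_ordering p \<alpha>) (linear_ordering p \<beta>)"
    by (rule two_line_comp) (use LO in auto)
  ultimately show ?case using IH by (simp add: fs)
qed

lemma factors_product:
  assumes "regular_Dir p (asymp_dir \<theta>)"
  shows "\<forall>\<pi>\<in>set (factors p \<theta>). \<pi> permutes {1..degree p}"
    "foldr (\<circ>) (factors p \<theta>) id = cycle_of_list [1..<Suc (degree p)]"
proof -
  \<comment> \<open>Written with \<open>real 1\<close> so as to be an instance of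
    \<open>asymp_dir_step\<close> and \<open>linear_ordering_step\<close>.\<close>
  let ?\<beta> = "\<theta> + 2 * pi * real 1 / real (degree p)"
  have dir: "asymp_dir ?\<beta> = asymp_dir \<theta>" by (rule asymp_dir_step)
  have "critical_angles p \<theta> = {\<phi> \<in> {\<theta><..<?\<beta>}. \<not> regular_Dir p (asymp_dir \<phi>)}"
    by (simp add: critical_angles_def dir_at_eq)
  from factor_product[OF finite_critical_angles this] assms dir degree_pos
  have *: "(\<forall>\<pi>\<in>set (factors p \<theta>). \<pi> permutes {1..degree p}) \<and>
    foldr (\<circ>) (factors p \<theta>) id = two_line (linear_ordering p \<theta>) (linear_ordering p ?\<beta>)"
    by (simp add: factors_def)
  then show "\<forall>\<pi>\<in>set (factors p \<theta>). \<pi> permutes {1..degree p}" by blast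
  have "linear_ordering p ?\<beta> = rotate1 (linear_ordering p \<theta>)"
    unfolding linear_ordering_step by (simp add: rotate_Suc)
  then show "foldr (\<circ>) (factors p \<theta>) id = cycle_of_list [1..<Suc (degree p)]"
    using * two_line_rotate1[OF regular_linear_ordering(2)[OF assms]] by simp
qed

end

section \<open>Convex hulls of roots of unity\<close>

text \<open>The line through the vertices \<open>m\<close> and \<open>M\<close> separates:
  \<open>A\<close> lies on one closed side, \<open>B\<close> strictly on the other. For
  \<open>m = M\<close> it is the tangent at that vertex.\<close>

lemma hull_arc_disjoint:
  assumes "A \<subseteq> {m..M}" "B \<inter> {m..M} = {}" "B \<subseteq> {..<n}" "m \<le> M" "M < n"
  defines "v \<equiv> \<lambda>k. cis (2 * pi * real k / real n)"
  shows "convex hull (v ` A) \<inter> convex hull (v ` B) = {}"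
proof -
  define x where "x = (\<lambda>k. 2 * pi * (real k - (real m + real M) / 2) / real n)"
  \<comment> \<open>\<open>c\<close> points to the middle of the arc and \<open>h\<close> is half
    its angle; on the separating line the inner product with \<open>c\<close> equals
    \<open>cos h\<close>.\<close>
  define c where "c = cis (pi * (real m + real M) / real n)"
  define h where "h = pi * (real M - real m) / real n"
  have n: "real n > 0" using assms(5) by simp
  have h: "0 \<le> h" "h \<le> pi" using assms(4,5) n by (auto simp: h_def divide_simps)
  have inner: "c \<bullet> v k = cos (x k)" for k
  proof -
    have "2 * pi * real k / real n = pi * (real m + real M) / real n + x k"
      using n by (simp add: x_def field_simps)
    then have "c \<bullet> v k = cos (pi * (real m + real M) / real n) * cos (pi * (real m + real M) / real n + x k)
      + sin (pi * (real m + real M) / real n) * sin (pi * (real m + real M) / real n + x k)"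
      by (simp add: v_def c_def inner_complex_def)
    also have "\<dots> = cos (pi * (real m + real M) / real n - (pi * (real m + real M) / real n + x k))"
      by (simp only: cos_diff)
    finally show ?thesis by simp
  qed
  have in_arc: "cos h \<le> cos (x k)" if "k \<in> A" for k
  proof -
    have "m \<le> k" "k \<le> M" using assms(1) that by auto
    then have le: "\<bar>real k - (real m + real M) / 2\<bar> \<le> (real M - real m) / 2"
      by (auto simp: abs_if field_simps)
    have "\<bar>x k\<bar> = 2 * pi * \<bar>real k - (real m + real M) / 2\<bar> / real n"
      using n by (simp add: x_def abs_mult)
    moreover have "2 * pi * \<bar>real k - (real m + real M) / 2\<bar> / real n \<le> 2 * pi * ((real M - real m) / 2) / real n"
      using le n by (intro divide_right_mono mult_left_mono) auto
    ultimately have "\<bar>x k\<bar> \<le> h" by (simp add: h_def)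
    then have "cos h \<le> cos \<bar>x k\<bar>" using h by (intro cos_monotone_0_pi_le) auto
    then show ?thesis by simp
  qed
  have off_arc: "cos (x k) < cos h" if "k \<in> B" for k
  proof -
    have k: "k < n" "k < m \<or> M < k" using assms(2,3) that by (auto simp: not_le disjoint_iff)
    have "(real M - real m) / 2 < \<bar>real k - (real m + real M) / 2\<bar>"
      "\<bar>real k - (real m + real M) / 2\<bar> < real n - (real M - real m) / 2"
      using k assms(4,5) by (auto simp: abs_if field_simps)
    then have "2 * pi * ((real M - real m) / 2) / real n < 2 * pi * \<bar>real k - (real m + real M) / 2\<bar> / real n"
      "2 * pi * \<bar>real k - (real m + real M) / 2\<bar> / real n < 2 * pi * (real n - (real M - real m) / 2) / real n"
      using n by (auto intro!: divide_strict_right_mono mult_strict_left_mono)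
    moreover have "\<bar>x k\<bar> = 2 * pi * \<bar>real k - (real m + real M) / 2\<bar> / real n"
      using n by (simp add: x_def abs_mult)
    moreover have "2 * pi * (real n - (real M - real m) / 2) / real n = 2 * pi - h"
      using n by (simp add: h_def field_simps)
    ultimately have x: "h < \<bar>x k\<bar>" "\<bar>x k\<bar> < 2 * pi - h" by (auto simp: h_def)
    \<comment> \<open>The angle is not reduced, so it may exceed \<open>pi\<close>; then its
      complement to a full turn is compared with \<open>h\<close>.\<close>
    show ?thesis
    proof (cases "\<bar>x k\<bar> \<le> pi")
      case True
      then have "cos \<bar>x k\<bar> < cos h" using x h by (intro cos_monotone_0_pi) auto
      then show ?thesis by simp
    next
      case False
      then have "cos (2 * pi - \<bar>x k\<bar>) < cos h" using x h by (intro cos_monotone_0_pi) auto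
      then show ?thesis by (simp add: cos_diff)
    qed
  qed
  have "convex hull (v ` A) \<subseteq> {z. c \<bullet> z \<ge> cos h}"
    by (rule hull_minimal) (use in_arc inner in \<open>auto simp: convex_halfspace_ge\<close>)
  moreover have "convex hull (v ` B) \<subseteq> {z. c \<bullet> z < cos h}"
    by (rule hull_minimal) (use off_arc inner in \<open>auto simp: convex_halfspace_lt\<close>)
  ultimately show ?thesis by fastforce
qed

text \<open>Without interlacing, one of the two sets avoids the whole range of indices spanned by
  the other: if an index of \<open>B\<close> falls between those of \<open>A\<close>, all of
  \<open>B\<close> must, and then no index of \<open>A\<close> can fall between those of
  \<open>B\<close>.\<close>

lemma hulls_meet_imp_interlaced:
  assumes "A \<subseteq> {..<n}" "B \<subseteq> {..<n}" "A \<inter> B = {}"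
  defines "v \<equiv> \<lambda>k. cis (2 * pi * real k / real n)"
  assumes meet: "convex hull (v ` A) \<inter> convex hull (v ` B) \<noteq> {}"
  shows "\<exists>i j k l. i < j \<and> j < k \<and> k < l \<and>
    (i \<in> A \<and> k \<in> A \<and> j \<in> B \<and> l \<in> B \<or> i \<in> B \<and> k \<in> B \<and> j \<in> A \<and> l \<in> A)"
proof (rule ccontr)
  assume no: "\<not> ?thesis"
  have fin: "finite A" "finite B" using assms(1,2) finite_subset by blast+
  have ne: "A \<noteq> {}" "B \<noteq> {}" using meet by auto
  have mm: "Min A \<in> A" "Max A \<in> A" "Min B \<in> B" "Max B \<in> B" using fin ne by auto
  have AB: "A \<subseteq> {Min A..Max A}" "B \<subseteq> {Min B..Max B}" using fin by auto
  have le: "Min A \<le> Max A" "Min B \<le> Max B" using fin ne by simp_all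
  have lt: "Max A < n" "Max B < n" using mm assms(1,2) by blast+
  show False
  proof (cases "B \<inter> {Min A..Max A} = {}")
    case True
    then show False
      using hull_arc_disjoint[OF AB(1) True assms(2) le(1) lt(1)] meet unfolding v_def by blast
  next
    case False
    then obtain y where y: "y \<in> B" "Min A \<le> y" "y \<le> Max A" by auto
    then have y': "Min A < y" "y < Max A" using assms(3) mm by (metis disjoint_iff le_neq_implies_less)+
    have B_in: "Min A < b \<and> b < Max A" if "b \<in> B" for b
    proof (rule ccontr)
      assume "\<not> ?thesis"
      moreover have "b \<noteq> Min A" "b \<noteq> Max A" using that assms(3) mm by auto
      ultimately consider "b < Min A" | "Max A < b" by linarith
      then show False
      proof cases
        case 1 then show False using no y y' mm that by blast
      next
        case 2 then show False using no y y' mm that by blast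
      qed
    qed
    have "A \<inter> {Min B..Max B} = {}"
    proof (rule ccontr)
      assume "\<not> ?thesis"
      then obtain a where a: "a \<in> A" "Min B \<le> a" "a \<le> Max B" by auto
      then have "Min B < a" "a < Max B" using assms(3) mm by (metis disjoint_iff le_neq_implies_less)+
      then show False using no a mm B_in by blast
    qed
    then show False
      using hull_arc_disjoint[OF AB(2) _ assms(1) le(2) lt(2)] meet unfolding v_def by blast
  qed
qed

section \<open>Crossing continua in a half-plane and in a disc\<close>

text \<open>A continuum need not be path connected, but Fashoda's theorem needs paths. The
  neighbourhood is taken relative to \<open>H\<close> so that the paths do not leave it; convexity
  of \<open>H\<close> keeps each ball connected after intersection and makes \<open>H\<close>
  locally path connected.\<close>

lemma path_connected_relative_neighbourhood:
  fixes C :: "'a::euclidean_space set"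
  assumes "connected C" "C \<noteq> {}" "C \<subseteq> H" "convex H" "e > 0"
  shows "path_connected (\<Union>c\<in>C. ball c e \<inter> H)"
proof -
  let ?N = "\<Union>c\<in>C. ball c e \<inter> H"
  have eq: "?N = (\<Union>c\<in>C. C \<union> (ball c e \<inter> H))" using assms(2,3,5) by force
  have "connected (\<Union>c\<in>C. C \<union> (ball c e \<inter> H))"
  proof (rule connected_Union)
    fix S assume "S \<in> (\<lambda>c. C \<union> (ball c e \<inter> H)) ` C"
    then obtain c where c: "c \<in> C" "S = C \<union> (ball c e \<inter> H)" by blast
    have "connected (ball c e \<inter> H)" by (intro convex_connected convex_Int convex_ball assms(4))
    then show "connected S" unfolding c(2)
      by (rule connected_Un[OF assms(1)]) (use c(1) assms(3,5) in auto)
  qed (use assms(2) in blast)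
  then have conn: "connected ?N" by (simp only: eq)
  have "openin (top_of_set H) ?N"
    by (auto simp: openin_open intro!: exI[of _ "\<Union>c\<in>C. ball c e"])
  then have lpc: "locally path_connected ?N"
    by (rule locally_open_subset[OF convex_imp_locally_path_connected[OF assms(4)]])
  show ?thesis unfolding path_connected_component_set
    by (intro ballI, subst path_component_eq_connected_component_set[OF lpc]) (rule connected_component_eq_self[OF conn])
qed

text \<open>Disjoint compacta have a positive distance \<open>d\<close>, and their
  \<open>d / 2\<close>-neighbourhoods are still disjoint. Inside these the real points are joined by
  paths, which must meet in a box standing on the real axis.\<close>

lemma crossing_half_plane:
  fixes C D :: "complex set"
  assumes "compact C" "connected C" "compact D" "connected D"
    "C \<subseteq> {z. Im z \<ge> 0}" "D \<subseteq> {z. Im z \<ge> 0}"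
    "complex_of_real x1 \<in> C" "complex_of_real x2 \<in> D" "complex_of_real x3 \<in> C" "complex_of_real x4 \<in> D"
    "x1 < x2" "x2 < x3" "x3 < x4"
  shows "C \<inter> D \<noteq> {}"
proof
  assume "C \<inter> D = {}"
  let ?H = "{z. Im z \<ge> 0}"
  have "convex ?H" by (rule convex_halfspace_Im_ge)
  obtain d where d: "d > 0" "\<And>x y. x \<in> C \<Longrightarrow> y \<in> D \<Longrightarrow> d \<le> dist x y"
    using separate_compact_closed[OF assms(1) compact_imp_closed[OF assms(3)] \<open>C \<inter> D = {}\<close>] by blast
  define C' where "C' = (\<Union>c\<in>C. ball c (d / 2) \<inter> ?H)"
  define D' where "D' = (\<Union>c\<in>D. ball c (d / 2) \<inter> ?H)"
  have disj: "C' \<inter> D' = {}"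
  proof -
    have False if "z \<in> C'" "z \<in> D'" for z
    proof -
      obtain c c' where "c \<in> C" "c' \<in> D" "dist c z < d / 2" "dist c' z < d / 2"
        using \<open>z \<in> C'\<close> \<open>z \<in> D'\<close> by (auto simp: C'_def D'_def)
      then show False using d(2)[of c c'] dist_triangle2[of c c' z] by simp
    qed
    then show ?thesis by blast
  qed
  have sub: "C \<subseteq> C'" "D \<subseteq> D'" using assms(5,6) d(1) by (auto simp: C'_def D'_def)
  have "path_connected C'" unfolding C'_def
    by (rule path_connected_relative_neighbourhood) (use assms d \<open>convex ?H\<close> in auto)
  then obtain f where f: "path f" "path_image f \<subseteq> C'" "pathstart f = complex_of_real x1" "pathfinish f = complex_of_real x3"
    unfolding path_connected_def using sub(1) assms(7,9) by blast
  have "path_connected D'" unfolding D'_def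
    by (rule path_connected_relative_neighbourhood) (use assms d \<open>convex ?H\<close> in auto)
  then obtain g where g: "path g" "path_image g \<subseteq> D'" "pathstart g = complex_of_real x2" "pathfinish g = complex_of_real x4"
    unfolding path_connected_def using sub(2) assms(8,10) by blast
  \<comment> \<open>\<open>fashoda_interlace\<close> is stated for paths in
    \<open>real^2\<close>.\<close>
  define T where "T = (\<lambda>z. (\<chi> i. if i = 1 then Re z else Im z) :: real^2)"
  have T_nth: "T z $ 1 = Re z" "T z $ 2 = Im z" for z by (simp_all add: T_def)
  have T_cont: "continuous_on S T" for S
    unfolding T_def
  proof (rule continuous_on_vec_lambda)
    show "continuous_on S (\<lambda>z. if i = 1 then Re z else Im z)" for i :: 2
      by (cases "i = 1") (auto intro: continuous_intros)
  qed
  have "compact (path_image f \<union> path_image g)" using f g by (intro compact_Un compact_path_image)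
  from compact_imp_bounded[OF this]
  obtain R where R: "\<And>z. z \<in> path_image f \<union> path_image g \<Longrightarrow> norm z \<le> R"
    unfolding bounded_iff by blast
  define a :: "real^2" where "a = vector [-R, 0]"
  define b :: "real^2" where "b = vector [R, R]"
  have box: "T z \<in> cbox a b" if "z \<in> path_image f \<union> path_image g" for z
  proof -
    have "0 \<le> Im z" using that f(2) g(2) by (auto simp: C'_def D'_def)
    moreover have "\<bar>Re z\<bar> \<le> R" "\<bar>Im z\<bar> \<le> R" using R[OF that] abs_Re_le_cmod[of z] abs_Im_le_cmod[of z] by linarith+
    ultimately show ?thesis by (auto simp: mem_box_cart forall_2 T_nth a_def b_def)
  qed
  have "path (T \<circ> f)" "path (T \<circ> g)" using f(1) g(1) T_cont by (auto simp: path_continuous_image)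
  moreover have "path_image (T \<circ> f) \<subseteq> cbox a b" "path_image (T \<circ> g) \<subseteq> cbox a b"
    using box by (auto simp: path_image_compose)
  moreover have "pathstart (T \<circ> f) $ 2 = a $ 2" "pathfinish (T \<circ> f) $ 2 = a $ 2"
    "pathstart (T \<circ> g) $ 2 = a $ 2" "pathfinish (T \<circ> g) $ 2 = a $ 2"
    using f g by (simp_all add: pathstart_compose pathfinish_compose T_nth a_def)
  moreover have "pathstart (T \<circ> f) $ 1 < pathstart (T \<circ> g) $ 1" "pathstart (T \<circ> g) $ 1 < pathfinish (T \<circ> f) $ 1"
    "pathfinish (T \<circ> f) $ 1 < pathfinish (T \<circ> g) $ 1"
    using f g assms(11-13) by (simp_all add: pathstart_compose pathfinish_compose T_nth)
  ultimately obtain w where w: "w \<in> path_image (T \<circ> f)" "w \<in> path_image (T \<circ> g)"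
    by (rule fashoda_interlace)
  then obtain y z where yz: "y \<in> path_image f" "z \<in> path_image g" "T y = T z" by (auto simp: path_image_compose)
  then have "y = z" using T_nth complex_eqI by metis
  then show False using yz f(2) g(2) disj by blast
qed

text \<open>Sending the free boundary point \<open>cis \<beta>\<close> to infinity cuts the circle
  open there, so the cyclic order of the four points becomes their order on the real axis.\<close>

lemma crossing_disc:
  fixes C D :: "complex set"
  assumes "compact C" "connected C" "compact D" "connected D" "C \<subseteq> cball 0 1" "D \<subseteq> cball 0 1"
    "cis \<phi>1 \<in> C" "cis \<phi>2 \<in> D" "cis \<phi>3 \<in> C" "cis \<phi>4 \<in> D"
    "\<phi>1 < \<phi>2" "\<phi>2 < \<phi>3" "\<phi>3 < \<phi>4" "\<phi>4 < \<beta>" "\<beta> < \<phi>1 + 2 * pi"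
    "cis \<beta> \<notin> C" "cis \<beta> \<notin> D"
  shows "C \<inter> D \<noteq> {}"
proof -
  define w where "w = cis \<beta>"
  \<comment> \<open>the Cayley transform sending \<open>w\<close> to infinity\<close>
  define K where "K = (\<lambda>z. \<i> * (w + z) / (w - z))"
  have nw: "norm w = 1" by (simp add: w_def)
  have K_inj: "y = z" if "y \<noteq> w" "z \<noteq> w" "K y = K z" for y z
  proof -
    have "(w + y) * (w - z) = (w + z) * (w - y)"
      using that by (simp add: K_def frac_eq_eq)
    then have "2 * w * (y - z) = 0" by (simp add: algebra_simps)
    then show ?thesis using nw by auto
  qed
  have K_Im: "0 \<le> Im (K z)" if "norm z \<le> 1" "z \<noteq> w" for z
  proof -
    have "K z = \<i> * (w + z) * cnj (w - z) / complex_of_real ((cmod (w - z))\<^sup>2)"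
    proof -
      have "complex_of_real ((cmod (w - z))\<^sup>2) = (w - z) * cnj (w - z)"
        by (rule complex_norm_square)
      moreover have "cnj (w - z) \<noteq> 0" using that(2) by simp
      ultimately show ?thesis unfolding K_def by (metis mult_divide_mult_cancel_right)
    qed
    then have "Im (K z) = Im (\<i> * (w + z) * cnj (w - z)) / (cmod (w - z))\<^sup>2"
      by (simp only: Im_divide_of_real)
    also have "Im (\<i> * (w + z) * cnj (w - z)) = (cmod w)\<^sup>2 - (cmod z)\<^sup>2"
      unfolding cmod_power2 by (simp add: power2_eq_square algebra_simps)
    finally show ?thesis using that(1) nw by (simp add: power_le_one)
  qed
  have K_cont: "continuous_on S K" if "w \<notin> S" for S
    unfolding K_def by (intro continuous_intros) (use that in auto)
  \<comment> \<open>Minus the cotangent of half the angle from \<beta>: the place of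
    \<open>cis \<phi>\<close> on the real axis. The half angles lie in \<open>(-pi, 0)\<close>,
    where the sine is negative and the cotangent decreases.\<close>
  define x where "x = (\<lambda>\<phi>. - cos ((\<phi> - \<beta>) / 2) / sin ((\<phi> - \<beta>) / 2))"
  have sin_neg: "sin ((\<phi> - \<beta>) / 2) < 0" if "\<phi>1 \<le> \<phi>" "\<phi> \<le> \<phi>4" for \<phi>
  proof -
    have "0 < sin (- ((\<phi> - \<beta>) / 2))" by (rule sin_gt_zero) (use that assms(14,15) in \<open>simp_all add: field_simps\<close>)
    then show ?thesis by simp
  qed
  have K_cis: "K (cis \<phi>) = complex_of_real (x \<phi>)" if "\<phi>1 \<le> \<phi>" "\<phi> \<le> \<phi>4" for \<phi>
  proof -
    define \<psi> where "\<psi> = (\<phi> - \<beta>) / 2"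
    define y where "y = cis ((\<phi> + \<beta>) / 2)"
    have s: "sin \<psi> \<noteq> 0" using sin_neg[OF that] by (simp add: \<psi>_def)
    have "w = y * cis (- \<psi>)" "cis \<phi> = y * cis \<psi>"
      by (simp_all add: w_def y_def \<psi>_def cis_mult field_simps)
    moreover have "cis (- \<psi>) + cis \<psi> = 2 * complex_of_real (cos \<psi>)" "cis (- \<psi>) - cis \<psi> = - 2 * \<i> * complex_of_real (sin \<psi>)"
      by (simp_all add: complex_eq_iff)
    ultimately have "w + cis \<phi> = y * (2 * complex_of_real (cos \<psi>))" "w - cis \<phi> = y * (- 2 * \<i> * complex_of_real (sin \<psi>))"
      by (metis distrib_left, metis right_diff_distrib)
    then have "K (cis \<phi>) = \<i> * (y * (2 * complex_of_real (cos \<psi>))) / (y * (- 2 * \<i> * complex_of_real (sin \<psi>)))"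
      unfolding K_def by metis
    also have "\<dots> = - complex_of_real (cos \<psi>) / complex_of_real (sin \<psi>)"
      using s by (simp add: y_def field_simps)
    finally show ?thesis by (simp add: x_def \<psi>_def)
  qed
  have x_less: "x \<phi> < x \<phi>'" if "\<phi>1 \<le> \<phi>" "\<phi> < \<phi>'" "\<phi>' \<le> \<phi>4" for \<phi> \<phi>'
  proof -
    define s where "s = sin ((\<phi> - \<beta>) / 2)"
    define s' where "s' = sin ((\<phi>' - \<beta>) / 2)"
    have neg: "s < 0" "s' < 0" unfolding s_def s'_def by (rule sin_neg; use that in simp)+
    have "(\<phi>' - \<phi>) / 2 = (\<phi>' - \<beta>) / 2 - (\<phi> - \<beta>) / 2" by (simp add: field_simps)
    then have "sin ((\<phi>' - \<phi>) / 2) = s' * cos ((\<phi> - \<beta>) / 2) - cos ((\<phi>' - \<beta>) / 2) * s"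
      by (simp only: sin_diff s_def s'_def)
    \<comment> \<open>The difference of two cotangents by the subtraction formula for the sine; both
      denominators are negative, so their product is positive.\<close>
    then have "x \<phi>' - x \<phi> = sin ((\<phi>' - \<phi>) / 2) / (s * s')"
      using neg by (simp add: x_def s_def[symmetric] s'_def[symmetric] field_simps)
    moreover have "0 < sin ((\<phi>' - \<phi>) / 2)" by (rule sin_gt_zero) (use that assms(14,15) in \<open>simp_all add: field_simps\<close>)
    moreover have "0 < s * s'" using neg by (simp add: mult_neg_neg)
    ultimately show ?thesis by (metis diff_gt_0_iff_gt divide_pos_pos)
  qed
  have nwC: "w \<notin> C" "w \<notin> D" using assms(16,17) by (auto simp: w_def)
  have "K ` C \<inter> K ` D \<noteq> {}"
  proof (rule crossing_half_plane[of _ _ "x \<phi>1" "x \<phi>2" "x \<phi>3" "x \<phi>4"])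
    show "compact (K ` C)" "connected (K ` C)" "compact (K ` D)" "connected (K ` D)"
      using assms(1-4) K_cont nwC by (auto intro: compact_continuous_image connected_continuous_image)
    show "K ` C \<subseteq> {z. 0 \<le> Im z}" "K ` D \<subseteq> {z. 0 \<le> Im z}"
      using K_Im assms(5,6) nwC by fastforce+
    show "complex_of_real (x \<phi>1) \<in> K ` C" using K_cis[of \<phi>1] assms(7,11-13) by (metis imageI less_imp_le order_refl order_trans)
    show "complex_of_real (x \<phi>2) \<in> K ` D" using K_cis[of \<phi>2] assms(8,11-13) by (metis imageI less_imp_le order_trans)
    show "complex_of_real (x \<phi>3) \<in> K ` C" using K_cis[of \<phi>3] assms(9,11-13) by (metis imageI less_imp_le order_trans)
    show "complex_of_real (x \<phi>4) \<in> K ` D" using K_cis[of \<phi>4] assms(10,11-13) by (metis imageI less_imp_le order_refl order_trans)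
  qed (use x_less assms(11-13) in auto)
  then obtain y z where "y \<in> C" "z \<in> D" "K y = K z" by blast
  then show ?thesis using K_inj[of y z] nwC by blast
qed

section \<open>Noncrossing partitions\<close>

text \<open>This identifies the plane with the open unit disc so that a curve escaping to infinity
  in a limiting direction gets that direction as its end point on the unit circle.\<close>

definition shrink :: "complex \<Rightarrow> complex" where
  "shrink z = z / complex_of_real (1 + norm z)"

lemma norm_shrink: "norm (shrink z) = norm z / (1 + norm z)"
proof -
  have "\<bar>1 + norm z\<bar> = 1 + norm z" by simp
  then show ?thesis by (simp only: shrink_def norm_divide norm_of_real)
qed

lemma norm_shrink_less: "norm (shrink z) < 1"
proof -
  have "1 + norm z > 0" by (simp add: add_pos_nonneg)
  then show ?thesis by (simp add: norm_shrink)
qed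

lemma shrink_inj: "shrink x = shrink y \<Longrightarrow> x = y"
proof -
  assume eq: "shrink x = shrink y"
  have pos: "1 + norm x > 0" "1 + norm y > 0" by (simp_all add: add_pos_nonneg)
  have "norm x / (1 + norm x) = norm y / (1 + norm y)" using arg_cong[OF eq, of norm] by (simp add: norm_shrink)
  then have "norm x = norm y" using pos by (simp add: frac_eq_eq algebra_simps)
  moreover have "complex_of_real (1 + norm y) \<noteq> 0" using pos by (simp only: of_real_eq_0_iff)
  ultimately show ?thesis using eq by (simp add: shrink_def)
qed

lemma continuous_on_shrink: "continuous_on S shrink"
proof -
  have "complex_of_real (1 + norm x) \<noteq> 0" for x :: complex
    using norm_ge_zero[of x] by (simp only: of_real_eq_0_iff)
  then show ?thesis unfolding shrink_def by (intro continuous_intros) blast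
qed

lemma shrink_tendsto:
  assumes "filterlim f at_infinity F" "((\<lambda>t. sgn (f t)) \<longlongrightarrow> c) F"
  shows "((\<lambda>t. shrink (f t)) \<longlongrightarrow> c) F"
proof -
  have "((\<lambda>r::real. r / (1 + r)) \<longlongrightarrow> 1) at_top" by real_asymp
  from filterlim_compose[OF this filterlim_at_infinity_imp_norm_at_top[OF assms(1)]]
  have "((\<lambda>t. complex_of_real (norm (f t) / (1 + norm (f t))) * sgn (f t)) \<longlongrightarrow> complex_of_real 1 * c) F"
    by (intro tendsto_intros assms(2))
  moreover have "complex_of_real (norm z / (1 + norm z)) * sgn z = shrink z" for z
    using norm_mult_sgn[of z] unfolding shrink_def of_real_divide
    by (metis times_divide_eq_left)
  ultimately show ?thesis by simp
qed

lemma (in nonconstant_poly) compact_sublevel: "compact {z. cmod (poly p z) \<le> r}"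
proof -
  have "closed {z. cmod (poly p z) \<le> r}" by (intro closed_Collect_le continuous_intros)
  moreover have "bounded {z. cmod (poly p z) \<le> r}"
  proof -
    have "\<forall>\<^sub>F z in at_infinity. r < norm (poly p z)"
      using filterlim_at_infinity_imp_norm_at_top[OF poly_at_infinity] by (simp add: filterlim_at_top_dense)
    then obtain b where "\<And>z. b \<le> norm z \<Longrightarrow> r < norm (poly p z)" unfolding eventually_at_infinity by blast
    then have "norm z \<le> b" if "cmod (poly p z) \<le> r" for z using that by (meson leD linear)
    then show ?thesis unfolding bounded_iff by blast
  qed
  ultimately show ?thesis by (simp add: compact_eq_bounded_closed)
qed

section \<open>Lifted rays as arcs in the closed disc\<close>

context branches
begin

definition ray_image :: "complex \<Rightarrow> complex set" where
  "ray_image a = (\<lambda>\<rho>. g a (complex_of_real \<rho> * u)) ` {0..}"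

definition closed_arc :: "complex \<Rightarrow> real \<Rightarrow> complex set" where
  "closed_arc a \<phi> = insert (cis \<phi>) (shrink ` ray_image a)"

lemma root_in_ray: "a \<in> rts p \<Longrightarrow> a \<in> ray_image a"
  unfolding ray_image_def using g_0 by (intro image_eqI[of _ _ 0]) auto

lemma arc_pt_in_ray: "t \<in> {-1<..<1} \<Longrightarrow> arc_pt a t \<in> ray_image a"
  unfolding ray_image_def arc_pt_def using radius_pos[of t] by auto

lemma ray_imageE:
  assumes "z \<in> ray_image a" "a \<in> rts p"
  obtains "z = a" | t where "t \<in> {-1<..<1}" "z = arc_pt a t"
proof -
  have "\<exists>\<rho>\<ge>0. z = g a (complex_of_real \<rho> * u)" using assms(1) by (auto simp: ray_image_def)
  then obtain \<rho> where \<rho>: "0 \<le> \<rho>" "z = g a (complex_of_real \<rho> * u)" by metis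
  show ?thesis
  proof (cases "\<rho> = 0")
    case True
    then show ?thesis using that(1) \<rho>(2) g_0[OF assms(2)] by simp
  next
    case False
    have "z = arc_pt a (height \<rho>)" using \<rho> by (simp add: arc_pt_def radius_height)
    moreover have "height \<rho> \<in> {-1<..<1}" using height_bounds False by auto
    ultimately show ?thesis using that(2) by blast
  qed
qed

lemma rays_disjoint:
  assumes "a \<in> rts p" "b \<in> rts p" "a \<noteq> b" shows "ray_image a \<inter> ray_image b = {}"
proof -
  have False if z: "z \<in> ray_image a" "z \<in> ray_image b" for z
  proof -
    obtain \<rho> where \<rho>: "0 \<le> \<rho>" "z = g a (complex_of_real \<rho> * u)" using z(1) by (auto simp: ray_image_def)
    obtain \<sigma> where \<sigma>: "0 \<le> \<sigma>" "z = g b (complex_of_real \<sigma> * u)" using z(2) by (auto simp: ray_image_def)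
    have "complex_of_real \<rho> * u = complex_of_real \<sigma> * u"
      using g_inv[OF assms(1) ray_in_keyhole[OF \<rho>(1)]] g_inv[OF assms(2) ray_in_keyhole[OF \<sigma>(1)]] \<rho>(2) \<sigma>(2) by simp
    then have "g a (complex_of_real \<rho> * u) = g b (complex_of_real \<rho> * u)" using \<rho>(2) \<sigma>(2) by metis
    then show False using g_inj[OF assms(1,2) ray_in_keyhole[OF \<rho>(1)]] assms(3) by blast
  qed
  then show ?thesis by blast
qed

lemma closed_arc_compact_connected:
  assumes a: "a \<in> rts p" and lim: "((\<lambda>t. sgn (arc_pt a t)) \<longlongrightarrow> cis \<phi>) (at_left 1)"
  shows "compact (closed_arc a \<phi>)" "connected (closed_arc a \<phi>)"
proof -
  \<comment> \<open>The lifted ray in the disc, continued by its two limits; it exhibits the closed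
    arc as a continuous image of \<open>[-1, 1]\<close>.\<close>
  define G where "G = (\<lambda>t. if t \<le> -1 then shrink a else if 1 \<le> t then cis \<phi> else shrink (arc_pt a t))"
  have G_mid: "G t = shrink (arc_pt a t)" if "t \<in> {-1<..<1}" for t using that by (simp add: G_def)
  have cont_arc: "continuous_on {-1<..<1} (arc_pt a)" unfolding arc_pt_def
    by (rule continuous_on_compose2[OF g_cont_sec[OF a]])
       (use radius_pos ray_in_sector in \<open>auto intro!: continuous_intros continuous_on_radius\<close>)
  have "continuous_on {-1..1} G"
  proof (rule continuous_on_IccI)
    have "((\<lambda>t. shrink (arc_pt a t)) \<longlongrightarrow> shrink a) (at_right (-1))"
      using continuous_on_shrink[of UNIV] arc_pt_at_root[OF a]
      by (auto intro: isCont_tendsto_compose simp: continuous_on_eq_continuous_at)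
    then show "(G \<longlongrightarrow> G (-1)) (at_right (-1))"
      by (rule Lim_transform_eventually[THEN tendsto_cong_limit])
         (use eventually_unit(2) in \<open>auto elim!: eventually_mono simp: G_def\<close>)
    have "((\<lambda>t. shrink (arc_pt a t)) \<longlongrightarrow> cis \<phi>) (at_left 1)"
      by (rule shrink_tendsto[OF norm_arc_pt_tendsto[OF a] lim])
    then show "(G \<longlongrightarrow> G 1) (at_left 1)"
      by (rule Lim_transform_eventually[THEN tendsto_cong_limit])
         (use eventually_unit(1) in \<open>auto elim!: eventually_mono simp: G_def\<close>)
    fix x :: real assume x: "-1 < x" "x < 1"
    have "continuous_on {-1<..<1} (\<lambda>t. shrink (arc_pt a t))"
      by (rule continuous_on_compose2[OF continuous_on_shrink[of UNIV] cont_arc]) auto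
    then have "continuous_on {-1<..<1} G" by (rule continuous_on_cong[THEN iffD1, rotated -1]) (simp_all add: G_mid)
    then show "G \<midarrow>x\<rightarrow> G x" using x by (simp add: continuous_on_eq_continuous_at isCont_def)
  qed simp
  moreover have "closed_arc a \<phi> = G ` {-1..1}"
  proof (intro equalityI subsetI)
    fix z assume "z \<in> closed_arc a \<phi>"
    then consider "z = cis \<phi>" | y where "z = shrink y" "y \<in> ray_image a" by (auto simp: closed_arc_def)
    then show "z \<in> G ` {-1..1}"
    proof cases
      case 1
      then show ?thesis by (intro image_eqI[of _ _ 1]) (auto simp: G_def)
    next
      case 2
      from 2(2) a show ?thesis
      proof (cases rule: ray_imageE)
        case 1
        then show ?thesis using 2(1) by (intro image_eqI[of _ _ "-1"]) (auto simp: G_def)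
      next
        case (2 t)
        then show ?thesis using \<open>z = shrink y\<close> G_mid by (intro image_eqI[of _ _ t]) auto
      qed
    qed
  next
    fix z assume "z \<in> G ` {-1..1}"
    then obtain t where t: "-1 \<le> t" "t \<le> 1" "z = G t" by auto
    consider "t = -1" | "t = 1" | "t \<in> {-1<..<1}" using t by force
    then show "z \<in> closed_arc a \<phi>"
      using t(3) G_mid root_in_ray[OF a] arc_pt_in_ray[of t a] by cases (auto simp: closed_arc_def G_def)
  qed
  ultimately show "compact (closed_arc a \<phi>)" "connected (closed_arc a \<phi>)"
    by (auto intro: compact_continuous_image connected_continuous_image)
qed

text \<open>Along the lifted ray the modulus of \<open>p\<close> is the parameter, so the stretch
  from the root to \<open>z\<close> stays in the sublevel set. A lifted ray therefore meets no
  component other than that of its own root.\<close>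

lemma ray_sublevel_connected:
  assumes a: "a \<in> rts p" and z: "z \<in> ray_image a" "cmod (poly p z) \<le> r"
  shows "connected_component {z. cmod (poly p z) \<le> r} a z"
proof -
  obtain \<rho> where \<rho>: "0 \<le> \<rho>" "z = g a (complex_of_real \<rho> * u)" using z(1) by (auto simp: ray_image_def)
  have pz: "poly p (g a (complex_of_real \<sigma> * u)) = complex_of_real \<sigma> * u" if "0 \<le> \<sigma>" for \<sigma>
    using g_inv[OF a ray_in_keyhole[OF that]] .
  have "\<rho> \<le> r" using z(2) pz[OF \<rho>(1)] \<rho> by (simp add: norm_mult norm_u)
  let ?S = "(\<lambda>\<sigma>. g a (complex_of_real \<sigma> * u)) ` {0..\<rho>}"
  have "connected ?S"
    by (intro connected_continuous_image continuous_on_compose2[OF g_cont[OF a]] continuous_intros)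
       (use ray_in_keyhole in auto)
  moreover have "?S \<subseteq> {z. cmod (poly p z) \<le> r}" using pz \<open>\<rho> \<le> r\<close> by (auto simp: norm_mult norm_u)
  moreover have "a \<in> ?S" using g_0[OF a] \<rho>(1) by (intro image_eqI[of _ _ 0]) auto
  moreover have "z \<in> ?S" using \<rho> by auto
  ultimately show ?thesis unfolding connected_component_def by blast
qed

text \<open>By \<open>root_at_asymptotics\<close> the lifted ray of \<open>root_at \<theta>\<close>
  ends at \<open>cis \<theta>\<close> in the closed disc, so the order in which roots are read is
  the order of these end points on the unit circle.\<close>

lemma no_interlacing:
  assumes \<theta>: "\<theta>1 < \<theta>2" "\<theta>2 < \<theta>3" "\<theta>3 < \<theta>4" "\<theta>4 < \<theta>1 + 2 * pi"
    and dir: "asymp_dir \<theta>1 = u" "asymp_dir \<theta>2 = u" "asymp_dir \<theta>3 = u" "asymp_dir \<theta>4 = u"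
    and joined: "connected_component {z. cmod (poly p z) \<le> r} (root_at \<theta>1) (root_at \<theta>3)"
      "connected_component {z. cmod (poly p z) \<le> r} (root_at \<theta>2) (root_at \<theta>4)"
  shows "connected_component {z. cmod (poly p z) \<le> r} (root_at \<theta>1) (root_at \<theta>2)"
proof (rule ccontr)
  let ?L = "{z. cmod (poly p z) \<le> r}"
  assume sep: "\<not> connected_component ?L (root_at \<theta>1) (root_at \<theta>2)"
  have rt: "root_at \<theta>1 \<in> rts p" "root_at \<theta>2 \<in> rts p" "root_at \<theta>3 \<in> rts p" "root_at \<theta>4 \<in> rts p"
    using root_at_arc(1) dir by blast+
  define K where "K = connected_component_set ?L (root_at \<theta>1)"
  define K' where "K' = connected_component_set ?L (root_at \<theta>2)"
  have disj: "K \<inter> K' = {}"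
    using sep connected_component_trans connected_component_sym unfolding K_def K'_def by blast
  have "compact (connected_component_set ?L x)" for x
    using compact_Int_closed[OF compact_sublevel closed_connected_component[OF compact_imp_closed[OF compact_sublevel]]]
      connected_component_subset by (metis inf.absorb2)
  then have compK: "compact K" "compact K'" unfolding K_def K'_def by blast+
  have connK: "connected K" "connected K'" unfolding K_def K'_def by auto
  have K_mem: "z \<in> K" if "z \<in> ray_image a" "a \<in> rts p" "a \<in> K" "cmod (poly p z) \<le> r" for z a
    using ray_sublevel_connected[OF that(2,1,4)] that(3) connected_component_trans unfolding K_def by blast
  have K'_mem: "z \<in> K'" if "z \<in> ray_image a" "a \<in> rts p" "a \<in> K'" "cmod (poly p z) \<le> r" for z a
    using ray_sublevel_connected[OF that(2,1,4)] that(3) connected_component_trans unfolding K'_def by blast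
  have inL: "root_at \<theta>1 \<in> ?L" "root_at \<theta>2 \<in> ?L" using joined connected_component_in by blast+
  have inK: "root_at \<theta>1 \<in> K" "root_at \<theta>3 \<in> K" "root_at \<theta>2 \<in> K'" "root_at \<theta>4 \<in> K'"
    using joined inL by (simp_all add: K_def K'_def connected_component_refl)
  have KL: "K \<subseteq> ?L" "K' \<subseteq> ?L" unfolding K_def K'_def by (rule connected_component_subset)+
  let ?arc = "\<lambda>\<theta>. closed_arc (root_at \<theta>) \<theta>"
  have arcs: "compact (?arc \<theta>)" "connected (?arc \<theta>)" if "asymp_dir \<theta> = u" for \<theta>
    using closed_arc_compact_connected[OF root_at_arc(1)[OF that] root_at_asymptotics[OF that]] by auto
  have arc_root: "shrink (root_at \<theta>) \<in> ?arc \<theta>" if "asymp_dir \<theta> = u" for \<theta>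
    using root_in_ray[OF root_at_arc(1)[OF that]] by (simp add: closed_arc_def)
  define C where "C = shrink ` K \<union> ?arc \<theta>1 \<union> ?arc \<theta>3"
  define D where "D = shrink ` K' \<union> ?arc \<theta>2 \<union> ?arc \<theta>4"
  have arc_disc: "?arc \<theta> \<subseteq> cball 0 1" for \<theta>
    using less_imp_le[OF norm_shrink_less] by (auto simp: closed_arc_def)
  have shr: "shrink ` S \<subseteq> cball 0 1" for S using less_imp_le[OF norm_shrink_less] by auto
  have CD: "compact C" "compact D" "C \<subseteq> cball 0 1" "D \<subseteq> cball 0 1"
    unfolding C_def D_def using compK arcs(1) dir arc_disc shr
    by (auto intro!: compact_Un compact_continuous_image continuous_on_shrink)
  have cs: "connected (shrink ` K)" "connected (shrink ` K')"
    using connK by (auto intro: connected_continuous_image continuous_on_shrink)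
  have "connected C" unfolding C_def
    by (intro connected_Un cs arcs(2) dir) (use arc_root dir inK in blast)+
  have "connected D" unfolding D_def
    by (intro connected_Un cs arcs(2) dir) (use arc_root dir inK in blast)+
  \<comment> \<open>A boundary point in the gap after the fourth end point and before the first,
    which \<open>crossing_disc\<close> can send to infinity.\<close>
  define \<beta> where "\<beta> = (\<theta>4 + \<theta>1 + 2 * pi) / 2"
  have \<beta>: "\<theta>4 < \<beta>" "\<beta> < \<theta>1 + 2 * pi" using \<theta> by (auto simp: \<beta>_def)
  have cis_ne: "cis x \<noteq> cis y" if "x < y" "y < x + 2 * pi" for x y
  proof
    assume "cis x = cis y"
    then have "cis (y - x) = 1" by (simp flip: cis_divide)
    then have "cos (y - x) = 1" by (metis cis.sel(1) one_complex.sel(1))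
    then obtain k :: int where k: "y - x = real_of_int k * 2 * pi" by (auto simp: cos_one_2pi_int)
    have "real_of_int k * (2 * pi) = y - x" using k by simp
    then have "0 < real_of_int k * (2 * pi)" "real_of_int k * (2 * pi) < 1 * (2 * pi)" using that by linarith+
    then have "0 < real_of_int k" "real_of_int k < 1"
      by (simp_all add: zero_less_mult_iff)
    then show False by simp
  qed
  have shrink_cis: "shrink z \<noteq> cis x" for z x using norm_shrink_less[of z] by (metis less_irrefl norm_cis)
  have nb: "cis \<beta> \<notin> C" "cis \<beta> \<notin> D"
    using cis_ne[of \<theta>1 \<beta>] cis_ne[of \<theta>2 \<beta>] cis_ne[of \<theta>3 \<beta>] cis_ne[of \<theta>4 \<beta>] \<theta> \<beta> shrink_cis[symmetric]
    by (auto simp: C_def D_def closed_arc_def)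
  have "C \<inter> D \<noteq> {}"
  proof (rule crossing_disc[OF CD(1) \<open>connected C\<close> CD(2) \<open>connected D\<close> CD(3,4) _ _ _ _ \<theta>(1-3) \<beta> nb])
    show "cis \<theta>1 \<in> C" "cis \<theta>2 \<in> D" "cis \<theta>3 \<in> C" "cis \<theta>4 \<in> D" by (auto simp: C_def D_def closed_arc_def)
  qed
  moreover have "C \<inter> D = {}"
  proof -
    have arc_arc: "?arc x \<inter> ?arc y = {}" if "asymp_dir x = u" "asymp_dir y = u" "root_at x \<in> K" "root_at y \<in> K'" "cis x \<noteq> cis y" for x y
    proof -
      have "root_at x \<noteq> root_at y" using that(3,4) disj by auto
      then have "ray_image (root_at x) \<inter> ray_image (root_at y) = {}"
        using rays_disjoint root_at_arc(1) that(1,2) by blast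
      then have "shrink ` ray_image (root_at x) \<inter> shrink ` ray_image (root_at y) = {}"
        using shrink_inj by blast
      then show ?thesis using that(5) shrink_cis shrink_cis[symmetric] unfolding closed_arc_def by auto
    qed
    \<comment> \<open>A common point would lie in the sublevel set, hence in the component of the
      root of its ray, which is \<open>K'\<close>; but \<open>K\<close> and \<open>K'\<close> are
      disjoint.\<close>
    have K_arc: "shrink ` K \<inter> ?arc y = {}" if "asymp_dir y = u" "root_at y \<in> K'" for y
    proof -
      have False if "z \<in> K" "z \<in> ray_image (root_at y)" for z
        using K'_mem[OF that(2) root_at_arc(1)[OF \<open>asymp_dir y = u\<close>] \<open>root_at y \<in> K'\<close>] that(1) KL(1) disj by blast
      then have "shrink ` K \<inter> shrink ` ray_image (root_at y) = {}" using shrink_inj by blast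
      then show ?thesis using shrink_cis shrink_cis[symmetric] unfolding closed_arc_def by auto
    qed
    have K'_arc: "shrink ` K' \<inter> ?arc y = {}" if "asymp_dir y = u" "root_at y \<in> K" for y
    proof -
      have False if "z \<in> K'" "z \<in> ray_image (root_at y)" for z
        using K_mem[OF that(2) root_at_arc(1)[OF \<open>asymp_dir y = u\<close>] \<open>root_at y \<in> K\<close>] that(1) KL(2) disj by blast
      then have "shrink ` K' \<inter> shrink ` ray_image (root_at y) = {}" using shrink_inj by blast
      then show ?thesis using shrink_cis shrink_cis[symmetric] unfolding closed_arc_def by auto
    qed
    have KK': "shrink ` K \<inter> shrink ` K' = {}" using disj shrink_inj by blast
    have ne: "cis \<theta>1 \<noteq> cis \<theta>2" "cis \<theta>1 \<noteq> cis \<theta>4" "cis \<theta>3 \<noteq> cis \<theta>2" "cis \<theta>3 \<noteq> cis \<theta>4"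
      using cis_ne[of \<theta>1 \<theta>2] cis_ne[of \<theta>1 \<theta>4] cis_ne[of \<theta>2 \<theta>3] cis_ne[of \<theta>3 \<theta>4] \<theta> by auto
    show ?thesis unfolding C_def D_def
      using KK' K_arc[OF dir(2) inK(3)] K_arc[OF dir(4) inK(4)] K'_arc[OF dir(1) inK(1)] K'_arc[OF dir(3) inK(2)]
        arc_arc[OF dir(1,2) inK(1,3) ne(1)] arc_arc[OF dir(1,4) inK(1,4) ne(2)]
        arc_arc[OF dir(3,2) inK(2,3) ne(3)] arc_arc[OF dir(3,4) inK(2,4) ne(4)]
      by (simp add: Int_Un_distrib Int_Un_distrib2 Int_commute)
  qed
  ultimately show False by blast
qed

end

section \<open>Level partitions\<close>

text \<open>Least elements are split off one after another. The order axioms are relative to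
  \<open>S\<close> because refinement is total only on a family such as that of the level
  partitions.\<close>

lemma finite_total_order_sorted_list:
  assumes "finite S" "\<And>P Q R. P \<in> S \<Longrightarrow> Q \<in> S \<Longrightarrow> R \<in> S \<Longrightarrow> le P Q \<Longrightarrow> le Q R \<Longrightarrow> le P R"
    "\<And>P Q. P \<in> S \<Longrightarrow> Q \<in> S \<Longrightarrow> le P Q \<or> le Q P"
    "\<And>P Q. P \<in> S \<Longrightarrow> Q \<in> S \<Longrightarrow> le P Q \<Longrightarrow> le Q P \<Longrightarrow> P = Q"
  shows "\<exists>Ps. sorted_wrt (\<lambda>P Q. le P Q \<and> P \<noteq> Q) Ps \<and> set Ps = S"
  using assms
proof (induction S rule: finite_psubset_induct)
  case (psubset S)
  show ?case
  proof (cases "S = {}")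
    case False
    have "\<exists>m\<in>T. \<forall>P\<in>T. le m P" if "finite T" "T \<noteq> {}" "T \<subseteq> S" for T
      using that
    proof (induction T rule: finite_ne_induct)
      case (singleton x) then show ?case using psubset.prems(2)[of x x] by auto
    next
      case (insert x T)
      then obtain m where m: "m \<in> T" "\<forall>P\<in>T. le m P" by auto
      have xm: "x \<in> S" "m \<in> S" using insert.prems m(1) by auto
      have xx: "le x x" using psubset.prems(2)[OF xm(1) xm(1)] by blast
      show ?case
      proof (cases "le m x")
        case True
        then show ?thesis using m by auto
      next
        case False
        then have "le x m" using psubset.prems(2) xm by blast
        then have "le x P" if "P \<in> T" for P
          using psubset.prems(1)[OF xm, of P] m(2) insert.prems that by blast
        then show ?thesis using xx by auto
      qed
    qed
    then obtain m where m: "m \<in> S" "\<And>P. P \<in> S \<Longrightarrow> le m P" using psubset.hyps False by (metis order_refl)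
    have "S - {m} \<subset> S" using m(1) by blast
    have "\<exists>Ps. sorted_wrt (\<lambda>P Q. le P Q \<and> P \<noteq> Q) Ps \<and> set Ps = S - {m}"
      by (rule psubset.IH[OF \<open>S - {m} \<subset> S\<close>]) (use psubset.prems in blast)+
    then obtain Ps where Ps: "sorted_wrt (\<lambda>P Q. le P Q \<and> P \<noteq> Q) Ps" "set Ps = S - {m}" by blast
    have "sorted_wrt (\<lambda>P Q. le P Q \<and> P \<noteq> Q) (m # Ps)" using Ps m(2) by auto
    moreover have "set (m # Ps) = S" using Ps(2) m(1) by auto
    ultimately show ?thesis by blast
  qed (auto intro: exI[of _ "[]"])
qed

context simple_poly
begin

lemma level_partition_eq:
  "level_partition p t = (\<lambda>a. {b \<in> rts p. connected_component {z. cmod (poly p z) \<le> radius t} a b}) ` rts p"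
  by (simp add: level_partition_def radius_def)

lemma root_in_sublevel: "a \<in> rts p \<Longrightarrow> t \<in> {-1<..<1} \<Longrightarrow> a \<in> {z. cmod (poly p z) \<le> radius t}"
  using radius_pos[of t] by (simp add: rts_def)

lemma level_partition_on:
  assumes "t \<in> {-1<..<1}" shows "partition_on (rts p) (level_partition p t)"
proof (rule partition_onI)
  let ?cc = "connected_component {z. cmod (poly p z) \<le> radius t}"
  have self: "?cc a a" if "a \<in> rts p" for a
    using root_in_sublevel[OF that assms] by (simp add: connected_component_refl_eq)
  show "\<Union> (level_partition p t) = rts p" using self by (auto simp: level_partition_eq)
  show "{} \<notin> level_partition p t" using self by (auto simp: level_partition_eq)
  fix X Y assume XY: "X \<in> level_partition p t" "Y \<in> level_partition p t" "X \<noteq> Y"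
  then obtain a b where ab: "X = {c \<in> rts p. ?cc a c}" "Y = {c \<in> rts p. ?cc b c}" by (auto simp: level_partition_eq)
  have "False" if "c \<in> X" "c \<in> Y" for c
  proof -
    have "?cc a c" "?cc b c" using that ab by auto
    then have "Collect (?cc a) = Collect (?cc c)" "Collect (?cc b) = Collect (?cc c)"
      using connected_component_eq[symmetric] by (metis mem_Collect_eq)+
    then have "Collect (?cc a) = Collect (?cc b)" by simp
    moreover have "X = rts p \<inter> Collect (?cc a)" "Y = rts p \<inter> Collect (?cc b)" using ab by auto
    ultimately show False using XY(3) by metis
  qed
  then show "disjnt X Y" by (auto simp: disjnt_def)
qed

lemma level_partition_refines:
  assumes "s \<in> {-1<..<1}" "t \<in> {-1<..<1}" "s \<le> t"
  shows "refines (rts p) (level_partition p s) (level_partition p t)"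
  unfolding refines_def
proof (intro conjI level_partition_on assms ballI)
  fix X assume "X \<in> level_partition p s"
  then obtain a where a: "a \<in> rts p" "X = {b \<in> rts p. connected_component {z. cmod (poly p z) \<le> radius s} a b}"
    by (auto simp: level_partition_eq)
  have "{z. cmod (poly p z) \<le> radius s} \<subseteq> {z. cmod (poly p z) \<le> radius t}"
    using radius_mono[OF assms] by auto
  then have "X \<subseteq> {b \<in> rts p. connected_component {z. cmod (poly p z) \<le> radius t} a b}"
    using a(2) connected_component_of_subset by blast
  then show "\<exists>Y\<in>level_partition p t. X \<subseteq> Y" using a(1) by (auto simp: level_partition_eq)
qed

lemma level_partitions_chain:
  "\<exists>Ps. sorted_wrt (\<lambda>P Q. refines (rts p) P Q \<and> P \<noteq> Q) Ps \<and>
     set Ps = {level_partition p t | t. t \<in> {-1<..<1} \<and> regular_Lvl p t}"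
proof (rule finite_total_order_sorted_list)
  \<comment> \<open>Although heights vary over an interval, all these partitions are sets of subsets
    of the finite set \<open>rts p\<close>.\<close>
  have "{level_partition p t | t. t \<in> {-1<..<1} \<and> regular_Lvl p t} \<subseteq> Pow (Pow (rts p))"
    by (auto simp: level_partition_eq)
  then show "finite {level_partition p t | t. t \<in> {-1<..<1} \<and> regular_Lvl p t}"
    using finite_rts finite_subset by blast
  fix P Q assume "P \<in> {level_partition p t | t. t \<in> {-1<..<1} \<and> regular_Lvl p t}"
    "Q \<in> {level_partition p t | t. t \<in> {-1<..<1} \<and> regular_Lvl p t}"
  then obtain s t where "P = level_partition p s" "s \<in> {-1<..<1}" "Q = level_partition p t" "t \<in> {-1<..<1}" by blast
  then show "refines (rts p) P Q \<or> refines (rts p) Q P"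
    using level_partition_refines[of s t] level_partition_refines[of t s] by (cases "s \<le> t") auto
qed (use refines_trans refines_asym in blast)+

text \<open>Interlaced vertices of the polygon are interlaced angles at infinity. Two roots of one
  block are joined within the sublevel set, so \<open>no_interlacing\<close> joins the two blocks as
  well, and they coincide.\<close>

lemma regular_noncrossing:
  assumes t: "t \<in> {-1<..<1}" and u: "norm u = 1" "regular_Dir p u"
  shows "noncrossing (cyclic_ordering p u) (level_partition p t)"
  unfolding noncrossing_def Let_def
proof (intro ballI impI)
  fix xs X Y assume "xs \<in> cyclic_ordering p u" and XY: "X \<in> level_partition p t" "Y \<in> level_partition p t" "X \<noteq> Y"
  then obtain \<theta> where \<theta>: "xs = linear_ordering p \<theta>" "asymp_dir \<theta> = u"
    by (auto simp: cyclic_ordering_def inf_pt_in_Dir)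
  obtain \<delta> \<epsilon> g where "branches p u \<delta> \<epsilon> g" using branches_exist[OF u] by blast
  then interpret b: branches p u \<delta> \<epsilon> g .
  let ?d = "degree p"
  let ?cc = "connected_component {z. cmod (poly p z) \<le> radius t}"
  define I where "I = (\<lambda>Z. {k. k < ?d \<and> xs ! k \<in> Z})"
  have len: "length xs = ?d" by (simp add: \<theta>(1))
  have block: "?cc x y" if Z: "Z \<in> level_partition p t" "x \<in> Z" "y \<in> Z" for x y Z
  proof -
    obtain a where "Z = {b \<in> rts p. ?cc a b}" using Z(1) by (auto simp: level_partition_eq)
    then have "?cc a x" "?cc a y" using Z(2,3) by auto
    then show ?thesis by (meson connected_component_sym connected_component_trans)
  qed
  have same: "Z = W" if Z: "Z \<in> level_partition p t" "W \<in> level_partition p t" "x \<in> Z" "y \<in> W" "?cc x y" for x y Z W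
  proof -
    obtain a where a: "Z = {b \<in> rts p. ?cc a b}" using Z(1) by (auto simp: level_partition_eq)
    have "y \<in> rts p" using Z(2,4) partition_onD1[OF level_partition_on[OF t]] by blast
    moreover have "?cc a y" using a Z(3,5) connected_component_trans by blast
    ultimately have "y \<in> Z" using a by simp
    then show ?thesis using partition_onD2[OF level_partition_on[OF t]] Z(1,2,4) unfolding disjoint_def by blast
  qed
  define ang where "ang = (\<lambda>k. \<theta> + 2 * pi * real k / real ?d)"
  have nth: "xs ! k = root_at (ang k)" if "k < ?d" for k
    using that by (simp add: \<theta>(1) nth_linear_ordering ang_def)
  have ang_less: "ang i < ang j" if "i < j" for i j
    using that degree_pos by (simp add: ang_def divide_strict_right_mono)
  have ang_dir: "asymp_dir (ang k) = u" for k using asymp_dir_step \<theta>(2) by (simp add: ang_def)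
  have no: False if ijkl: "i < j" "j < k" "k < l" "l < ?d" "xs ! i \<in> Z" "xs ! k \<in> Z" "xs ! j \<in> W" "xs ! l \<in> W"
    and ZW: "Z \<in> level_partition p t" "W \<in> level_partition p t" "Z \<noteq> W" for i j k l Z W
  proof -
    \<comment> \<open>The indices stay below \<open>d\<close>, so the four angles fit into less than
      a full turn, as \<open>no_interlacing\<close> demands.\<close>
    have "ang l < \<theta> + 2 * pi" using ang_less[OF ijkl(4)] degree_pos by (simp add: ang_def)
    also have "\<dots> \<le> ang i + 2 * pi" by (simp add: ang_def)
    finally have lt: "ang l < ang i + 2 * pi" .
    have "?cc (xs ! i) (xs ! k)" "?cc (xs ! j) (xs ! l)" using block ijkl ZW by blast+
    then have "?cc (xs ! i) (xs ! j)"
      using b.no_interlacing[OF ang_less[OF ijkl(1)] ang_less[OF ijkl(2)] ang_less[OF ijkl(3)] lt ang_dir ang_dir ang_dir ang_dir, of "radius t"]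
        nth ijkl(1-4) by simp
    then show False using same[OF ZW(1,2) ijkl(5,7)] ZW(3) by blast
  qed
  have hull: "{cis (2 * pi * real k / real (length xs)) | k. k < length xs \<and> xs ! k \<in> Z}
      = (\<lambda>k. cis (2 * pi * real k / real ?d)) ` I Z" for Z
    by (auto simp: I_def len)
  have "I X \<inter> I Y = {}"
    using partition_onD2[OF level_partition_on[OF t]] XY unfolding disjoint_def I_def by blast
  show "convex hull {cis (2 * pi * real k / real (length xs)) | k. k < length xs \<and> xs ! k \<in> X} \<inter>
      convex hull {cis (2 * pi * real k / real (length xs)) | k. k < length xs \<and> xs ! k \<in> Y} = {}"
    unfolding hull
  proof (rule ccontr)
    assume "convex hull (\<lambda>k. cis (2 * pi * real k / real ?d)) ` I X \<inter> convex hull (\<lambda>k. cis (2 * pi * real k / real ?d)) ` I Y \<noteq> {}"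
    then have "\<exists>i j k l. i < j \<and> j < k \<and> k < l \<and>
      (i \<in> I X \<and> k \<in> I X \<and> j \<in> I Y \<and> l \<in> I Y \<or> i \<in> I Y \<and> k \<in> I Y \<and> j \<in> I X \<and> l \<in> I X)"
      by (intro hulls_meet_imp_interlaced[of _ ?d] \<open>I X \<inter> I Y = {}\<close>) (auto simp: I_def)
    then obtain i j k l where o: "i < j" "j < k" "k < l" and
      "i \<in> I X \<and> k \<in> I X \<and> j \<in> I Y \<and> l \<in> I Y \<or> i \<in> I Y \<and> k \<in> I Y \<and> j \<in> I X \<and> l \<in> I X" by blast
    then show False
    proof (elim disjE)
      assume "i \<in> I X \<and> k \<in> I X \<and> j \<in> I Y \<and> l \<in> I Y"
      then show False using no[OF o, of X Y] XY by (simp add: I_def)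
    next
      assume "i \<in> I Y \<and> k \<in> I Y \<and> j \<in> I X \<and> l \<in> I X"
      then show False using no[OF o, of Y X] XY by (simp add: I_def)
    qed
  qed
qed

end

theorem theorem3:
  fixes p :: "complex poly" and d :: nat
  assumes "d \<ge> 1" and "degree p = d" and "card (rts p) = d"
  shows
    "(\<forall>t\<in>{-1<..<1}. regular_Lvl p t \<longrightarrow> partition_on (rts p) (level_partition p t)) \<and>
     (\<forall>s\<in>{-1<..<1}. \<forall>t\<in>{-1<..<1}. regular_Lvl p s \<and> regular_Lvl p t \<and> s \<le> t \<longrightarrow>
        refines (rts p) (level_partition p s) (level_partition p t)) \<and>
     (\<exists>Ps. sorted_wrt (\<lambda>P Q. refines (rts p) P Q \<and> P \<noteq> Q) Ps \<and>
        set Ps = {level_partition p t | t. t \<in> {-1<..<1} \<and> regular_Lvl p t}) \<and>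
     (\<forall>u\<in>sphere 0 1. regular_Dir p u \<longrightarrow>
        (\<forall>a\<in>rts p. \<exists>!x. x \<in> Dir p u \<inter> circle_at_infinity p \<and> joined p u a x) \<and>
        (\<forall>x\<in>Dir p u \<inter> circle_at_infinity p. \<exists>!a. a \<in> rts p \<and> joined p u a x) \<and>
        is_cyclic_ordering (rts p) (cyclic_ordering p u)) \<and>
     (\<forall>\<theta> \<theta>'. \<theta> \<le> \<theta>' \<and> (\<forall>\<phi>\<in>{\<theta>..\<theta>'}. regular_Dir p (dir_at p \<phi>)) \<longrightarrow>
        linear_ordering p \<theta> = linear_ordering p \<theta>') \<and>
     (\<forall>\<theta>. regular_Dir p (dir_at p \<theta>) \<longrightarrow>
        finite (critical_angles p \<theta>) \<and>
        (\<forall>\<pi> \<in> set (factors p \<theta>). \<pi> permutes {1..d}) \<and>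
        foldr (\<circ>) (factors p \<theta>) id = cycle_of_list [1..<Suc d]) \<and>
     (\<forall>t\<in>{-1<..<1}. \<forall>u\<in>sphere 0 1. regular_Lvl p t \<and> regular_Dir p u \<longrightarrow>
        noncrossing (cyclic_ordering p u) (level_partition p t))"
proof -
  interpret simple_poly p by unfold_locales (use assms in auto)
  have arcs: "(\<forall>a\<in>rts p. \<exists>!x. x \<in> Dir p u \<inter> circle_at_infinity p \<and> joined p u a x) \<and>
      (\<forall>x\<in>Dir p u \<inter> circle_at_infinity p. \<exists>!a. a \<in> rts p \<and> joined p u a x)"
    if u: "norm u = 1" "regular_Dir p u" for u
  proof -
    obtain \<delta> \<epsilon> g where "branches p u \<delta> \<epsilon> g" using branches_exist[OF u] by blast
    then interpret b: branches p u \<delta> \<epsilon> g .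
    show ?thesis
    proof (intro conjI ballI)
      show "\<exists>!x. x \<in> Dir p u \<inter> circle_at_infinity p \<and> joined p u a x" if "a \<in> rts p" for a
        by (rule b.root_Dir_ex1[OF that])
      show "\<exists>!a. a \<in> rts p \<and> joined p u a x" if "x \<in> Dir p u \<inter> circle_at_infinity p" for x
        by (rule b.circle_Dir_ex1) (use that in auto)
    qed
  qed
  show ?thesis
  proof (intro conjI)
    show "\<forall>t\<in>{-1<..<1}. regular_Lvl p t \<longrightarrow> partition_on (rts p) (level_partition p t)"
      by (intro ballI impI level_partition_on)
    show "\<forall>s\<in>{-1<..<1}. \<forall>t\<in>{-1<..<1}. regular_Lvl p s \<and> regular_Lvl p t \<and> s \<le> t \<longrightarrow>
        refines (rts p) (level_partition p s) (level_partition p t)"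
      by (intro ballI impI level_partition_refines) auto
    show "\<exists>Ps. sorted_wrt (\<lambda>P Q. refines (rts p) P Q \<and> P \<noteq> Q) Ps \<and>
        set Ps = {level_partition p t | t. t \<in> {-1<..<1} \<and> regular_Lvl p t}"
      by (rule level_partitions_chain)
    show "\<forall>u\<in>sphere 0 1. regular_Dir p u \<longrightarrow>
        (\<forall>a\<in>rts p. \<exists>!x. x \<in> Dir p u \<inter> circle_at_infinity p \<and> joined p u a x) \<and>
        (\<forall>x\<in>Dir p u \<inter> circle_at_infinity p. \<exists>!a. a \<in> rts p \<and> joined p u a x) \<and>
        is_cyclic_ordering (rts p) (cyclic_ordering p u)"
    proof (intro ballI impI)
      fix u :: complex assume "u \<in> sphere 0 1" and reg: "regular_Dir p u"
      then have u: "norm u = 1" by simp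
      show "(\<forall>a\<in>rts p. \<exists>!x. x \<in> Dir p u \<inter> circle_at_infinity p \<and> joined p u a x) \<and>
        (\<forall>x\<in>Dir p u \<inter> circle_at_infinity p. \<exists>!a. a \<in> rts p \<and> joined p u a x) \<and>
        is_cyclic_ordering (rts p) (cyclic_ordering p u)"
        using arcs[OF u reg] regular_cyclic_ordering[OF u reg] by (intro conjI) (elim conjE, assumption)+
    qed
    show "\<forall>\<theta> \<theta>'. \<theta> \<le> \<theta>' \<and> (\<forall>\<phi>\<in>{\<theta>..\<theta>'}. regular_Dir p (dir_at p \<phi>)) \<longrightarrow>
        linear_ordering p \<theta> = linear_ordering p \<theta>'"
      by (intro allI impI linear_ordering_constant) (auto simp: dir_at_eq)
    show "\<forall>\<theta>. regular_Dir p (dir_at p \<theta>) \<longrightarrow>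
        finite (critical_angles p \<theta>) \<and>
        (\<forall>\<pi> \<in> set (factors p \<theta>). \<pi> permutes {1..d}) \<and>
        foldr (\<circ>) (factors p \<theta>) id = cycle_of_list [1..<Suc d]"
    proof (intro allI impI)
      fix \<theta> assume "regular_Dir p (dir_at p \<theta>)"
      then have "regular_Dir p (asymp_dir \<theta>)" by (simp add: dir_at_eq)
      from factors_product[OF this] finite_critical_angles
      show "finite (critical_angles p \<theta>) \<and> (\<forall>\<pi> \<in> set (factors p \<theta>). \<pi> permutes {1..d}) \<and>
        foldr (\<circ>) (factors p \<theta>) id = cycle_of_list [1..<Suc d]"
        unfolding assms(2) by blast
    qed
    show "\<forall>t\<in>{-1<..<1}. \<forall>u\<in>sphere 0 1. regular_Lvl p t \<and> regular_Dir p u \<longrightarrow>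
        noncrossing (cyclic_ordering p u) (level_partition p t)"
      by (intro ballI impI regular_noncrossing) auto
  qed
qed

end
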